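(* Let $\ell$ be an odd positive integer, let $\mathbb{Z}_\varepsilon:=\mathbb{Z}[q,q^{-1}]/(\phi_\ell(q))$ and $\varepsilon:=\bar q\in\mathbb{Z}_\varepsilon$, and let $G\in\{M_n,GL_n\}$. Fix any total order on $\{1,\dots,n\}^{\times 2}$. Then the set of ordered monomials $$\mathrm{B}^M_{GL}:=\Big\{\prod_{i,j=1}^n t_{i,j}^{N_{i,j}} : 0\le N_{i,j}\le \ell-1\ \forall i,j\Big\}$$ (product taken in increasing order of $(i,j)$ for the fixed total order), viewed as a subset of $\mathcal{O}_\varepsilon^{\mathbb{Z}_\varepsilon}(M_n)\subset\mathcal{O}_\varepsilon^{\mathbb{Z}_\varepsilon}(GL_n)$, is a basis of $\mathcal{O}_\varepsilon^{\mathbb{Z}_\varepsilon}(M_n)$ as a module over $\mathcal{O}^{\mathbb{Z}_\varepsilon}(M_n)$, and a basis of $\mathcal{O}_\varepsilon^{\mathbb{Z}_\varepsilon}(GL_n)$ as a module over $\mathcal{O}^{\mathbb{Z}_\varepsilon}(GL_n)$ (module structures via the quantum Frobenius morphism). In particular both modules are free of rank $\ell^{\dim G}$, i.e. of rank $\ell^{n^2}$.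
   Context: For a commutative unital ring $R$ and invertible $q\in R$, $\mathcal{O}_q^{R}(M_n)$ is the unital associative $R$-algebra with generators $t_{i,j}$ ($1\le i,j\le n$) and relations $t_{i,j}t_{i,k}=q\,t_{i,k}t_{i,j}$, $t_{i,k}t_{h,k}=q\,t_{h,k}t_{i,k}$ for $j<k$, $i<h$, and $t_{i,l}t_{j,k}=t_{j,k}t_{i,l}$, $t_{i,k}t_{j,l}-t_{j,l}t_{i,k}=(q-q^{-1})t_{i,l}t_{j,k}$ for $i<j$, $k<l$. The quantum determinant $D_q:=\sum_{\sigma\in S_n}(-q)^{\ell(\sigma)}t_{1,\sigma(1)}\cdots t_{n,\sigma(n)}$ ($\ell(\sigma)$ the length of $\sigma$) is central, and $\mathcal{O}_q^{R}(GL_n):=\mathcal{O}_q^{R}(M_n)[D_q^{-1}]$. Let $\mathbb{Z}_q:=\mathbb{Z}[q,q^{-1}]$ with $q$ an indeterminate, $\phi_\ell$ the $\ell$-th cyclotomic polynomial. Set $\mathcal{O}_\varepsilon^{\mathbb{Z}_\varepsilon}(G):=\mathcal{O}_q^{\mathbb{Z}_q}(G)/\phi_\ell(q)\mathcal{O}_q^{\mathbb{Z}_q}(G)$ for $G\in\{M_n,GL_n\}$; images of $t_{i,j}$, $D_q$ there are again denoted $t_{i,j}$, and $D_\varepsilon$. Let $\mathcal{O}^{\mathbb{Z}}(M_n)=\mathbb{Z}[\bar t_{i,j}]$ be the polynomial ring (coordinate ring of the $n\times n$ matrix scheme over $\mathbb{Z}$), $D$ the ordinary determinant, $\mathcal{O}^{\mathbb{Z}}(GL_n)=\mathcal{O}^{\mathbb{Z}}(M_n)[D^{-1}]$,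 and $\mathcal{O}^{\mathbb{Z}_\varepsilon}(G):=\mathbb{Z}_\varepsilon\otimes_{\mathbb{Z}}\mathcal{O}^{\mathbb{Z}}(G)$. The quantum Frobenius morphism is the (injective) algebra morphism $\mathcal{O}^{\mathbb{Z}_\varepsilon}(G)\to\mathcal{O}_\varepsilon^{\mathbb{Z}_\varepsilon}(G)$ given by $\bar t_{i,j}\mapsto t_{i,j}^{\ell}$ (and $D^{-1}\mapsto D_\varepsilon^{-\ell}$ for $GL_n$); its image is central, so $\mathcal{O}_\varepsilon^{\mathbb{Z}_\varepsilon}(G)$ is an $\mathcal{O}^{\mathbb{Z}_\varepsilon}(G)$-module through it. *)

theory Defs
  imports Complex_Main "HOL-Library.Poly_Mapping" "HOL-Computational_Algebra.Polynomial"
          "HOL-Combinatorics.Permutations"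
begin

definition cyclo :: "nat \<Rightarrow> int poly" where
  "cyclo ell = (THE p. map_poly of_int p =
     (\<Prod>k\<in>{k. k < ell \<and> coprime k ell}. [:- cis (2 * pi * real k / real ell), 1:]))"

text \<open>Generators: t_{i,j} (written T i j) and an extra generator Z used for D^{-1} in GL_n.\<close>
datatype gen = T nat nat | Z

datatype word = Wd "gen list"

instantiation word :: monoid_add
begin
definition zero_word :: word where "zero_word = Wd []"
fun plus_word :: "word \<Rightarrow> word \<Rightarrow> word" where
  "plus_word (Wd a) (Wd b) = Wd (a @ b)"
instance
proof
  fix a b c :: word
  show "a + b + c = a + (b + c)" by (cases a; cases b; cases c) simp
  show "0 + a = a" by (cases a) (simp add: zero_word_def)
  show "a + 0 = a" by (cases a) (simp add: zero_word_def)
qed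
end

text \<open>Elements of the free (noncommutative) Z[q]-algebra on the generators.\<close>
type_synonym fa = "word \<Rightarrow>\<^sub>0 int poly"

definition gw :: "gen list \<Rightarrow> fa" where
  "gw w = Poly_Mapping.single (Wd w) 1"

definition sc :: "int poly \<Rightarrow> fa" where
  "sc c = Poly_Mapping.single (Wd []) c"

abbreviation tt :: "nat \<Rightarrow> nat \<Rightarrow> fa" where
  "tt i j \<equiv> gw [T i j]"

abbreviation qq :: fa where
  "qq \<equiv> sc [:0, 1:]"

inductive_set tideal :: "fa set \<Rightarrow> fa set" for S :: "fa set" where
  gen: "r \<in> S \<Longrightarrow> r \<in> tideal S"
| zero: "0 \<in> tideal S"
| add: "x \<in> tideal S \<Longrightarrow> y \<in> tideal S \<Longrightarrow> x + y \<in> tideal S"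
| mult: "x \<in> tideal S \<Longrightarrow> a * x * b \<in> tideal S"

definition perm_length :: "nat \<Rightarrow> (nat \<Rightarrow> nat) \<Rightarrow> nat" where
  "perm_length n \<sigma> = card {(i, j). 1 \<le> i \<and> i < j \<and> j \<le> n \<and> \<sigma> j < \<sigma> i}"

definition qdet :: "nat \<Rightarrow> fa" where
  "qdet n = (\<Sum>\<sigma>\<in>{\<sigma>. \<sigma> permutes {1..n}}.
      sc ((- [:0, 1:]) ^ perm_length n \<sigma>) * gw (map (\<lambda>i. T i (\<sigma> i)) [1..<n+1]))"

text \<open>Defining relations of O_eps(M_n) over Z[q]: the quantum-matrix relations (the last
  one multiplied by the unit q to clear q^{-1}) together with phi_ell(q).\<close>
definition relsM :: "nat \<Rightarrow> nat \<Rightarrow> fa set" where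
  "relsM ell n =
     {tt i j * tt i k - qq * tt i k * tt i j | i j k.
        i \<in> {1..n} \<and> j \<in> {1..n} \<and> k \<in> {1..n} \<and> j < k}
   \<union> {tt i k * tt h k - qq * tt h k * tt i k | i h k.
        i \<in> {1..n} \<and> h \<in> {1..n} \<and> k \<in> {1..n} \<and> i < h}
   \<union> {tt i l * tt j k - tt j k * tt i l | i j k l.
        i \<in> {1..n} \<and> j \<in> {1..n} \<and> k \<in> {1..n} \<and> l \<in> {1..n} \<and> i < j \<and> k < l}
   \<union> {qq * tt i k * tt j l - qq * tt j l * tt i k - (qq ^ 2 - 1) * tt i l * tt j k | i j k l.
        i \<in> {1..n} \<and> j \<in> {1..n} \<and> k \<in> {1..n} \<and> l \<in> {1..n} \<and> i < j \<and> k < l}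
   \<union> {sc (cyclo ell)}"

text \<open>Relations of O_eps(GL_n) = O_eps(M_n)[D^{-1}] (D central): adjoin Z central with
  Z D = D Z = 1.\<close>
definition relsGL :: "nat \<Rightarrow> nat \<Rightarrow> fa set" where
  "relsGL ell n = relsM ell n
   \<union> {gw [Z] * tt i j - tt i j * gw [Z] | i j. i \<in> {1..n} \<and> j \<in> {1..n}}
   \<union> {gw [Z] * qdet n - 1, qdet n * gw [Z] - 1}"

definition in_freeM :: "nat \<Rightarrow> fa \<Rightarrow> bool" where
  "in_freeM n x \<longleftrightarrow> (\<forall>w. Wd w \<in> Poly_Mapping.keys x \<longrightarrow>
      set w \<subseteq> {T i j | i j. i \<in> {1..n} \<and> j \<in> {1..n}})"

definition in_freeGL :: "nat \<Rightarrow> fa \<Rightarrow> bool" where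
  "in_freeGL n x \<longleftrightarrow> (\<forall>w. Wd w \<in> Poly_Mapping.keys x \<longrightarrow>
      set w \<subseteq> insert Z {T i j | i j. i \<in> {1..n} \<and> j \<in> {1..n}})"

text \<open>Ordered monomial prod t_{ij}^{N_{ij}}, product taken along the list ps
  (which enumerates the index pairs in increasing order of the chosen total order).\<close>
definition omon :: "(nat \<times> nat) list \<Rightarrow> (nat \<times> nat \<Rightarrow> nat) \<Rightarrow> fa" where
  "omon ps N = gw (concat (map (\<lambda>(i, j). replicate (N (i, j)) (T i j)) ps))"

definition expset :: "nat \<Rightarrow> nat \<Rightarrow> (nat \<times> nat \<Rightarrow> nat) set" where
  "expset ell n = {N. (\<forall>p. p \<notin> {1..n} \<times> {1..n} \<longrightarrow> N p = 0) \<and> (\<forall>p. N p < ell)}"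

text \<open>Commutative polynomials in variables tbar_{(i,j)} with Z[q]-coefficients.\<close>
type_synonym cp = "((nat \<times> nat) \<Rightarrow>\<^sub>0 nat) \<Rightarrow>\<^sub>0 int poly"

definition validM :: "nat \<Rightarrow> cp \<Rightarrow> bool" where
  "validM n c \<longleftrightarrow> (\<forall>m\<in>Poly_Mapping.keys c. Poly_Mapping.keys m \<subseteq> {1..n} \<times> {1..n})"

text \<open>c represents zero in Z_eps[tbar] = Z[q][tbar] / phi_ell(q).\<close>
definition zeroE :: "nat \<Rightarrow> cp \<Rightarrow> bool" where
  "zeroE ell c \<longleftrightarrow> (\<forall>m. cyclo ell dvd Poly_Mapping.lookup c m)"

definition cdet :: "nat \<Rightarrow> cp" where
  "cdet n = (\<Sum>\<sigma>\<in>{\<sigma>. \<sigma> permutes {1..n}}.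
      Poly_Mapping.single (\<Sum>i\<in>{1..n}. Poly_Mapping.single (i, \<sigma> i) 1) (of_int (sign \<sigma>)))"

text \<open>Quantum Frobenius tbar_{ij} |-> t_{ij}^ell on O(M_n) (images are central, so the
  ordering of the factors of a monomial is immaterial; we use the list ps).\<close>
definition frob :: "nat \<Rightarrow> (nat \<times> nat) list \<Rightarrow> cp \<Rightarrow> fa" where
  "frob ell ps c = (\<Sum>m\<in>Poly_Mapping.keys c.
      sc (Poly_Mapping.lookup c m) * omon ps (\<lambda>p. ell * Poly_Mapping.lookup m p))"

text \<open>Quantum Frobenius on O(GL_n): c / D^k |-> frob c * D_eps^{-ell k} = frob c * Z^{ell k}.\<close>
definition frobGL :: "nat \<Rightarrow> (nat \<times> nat) list \<Rightarrow> cp \<Rightarrow> nat \<Rightarrow> fa" where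
  "frobGL ell ps c k = frob ell ps c * gw (replicate (ell * k) Z)"

text \<open>c / D^k represents zero in O^{Z_eps}(GL_n).\<close>
definition zeroGL :: "nat \<Rightarrow> nat \<Rightarrow> cp \<Rightarrow> bool" where
  "zeroGL ell n c \<longleftrightarrow> (\<exists>m. zeroE ell (cdet n ^ m * c))"

end

(* Spanning. Commuting t_ik past t_jl (i < j, k < l) produces the word t_il t_jk, for which the sum of
   the products of the two indices is smaller, while all other letters q-commute; so every word reduces
   to ordered monomials for any order. Since q^ell = 1, the powers t_ij^ell are central and exponents can
   be split modulo ell. In GL_n one writes Z = D^(ell-1) Z^ell.

   Independence. Evaluating q at every primitive ell-th root of unity z detects divisibility by
   phi_ell, so irreducibility of phi_ell is not needed. For each z, quantum matrices act by T = L X U,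
   where X is a diagonal of commuting shifts and L, U are products of elementary quantum matrices
   built from Weyl pairs; the quantum determinant is multiplicative, hence acts as a single shift and
   is invertible. Each t_ij is a sum over lattice paths with one path of largest weight, and the exponents
   of these leading monomials separate all products of a Frobenius image, a power of Z and a restricted
   ordered monomial, even when the powers of Z differ. Therefore the identity D^ell = Fr(det) is
   not used. *)
theory Submission
  imports Defs
begin

section \<open>Cyclotomic polynomials\<close>

text \<open>Two demands shape the independence proof: it must be insensitive to the order of the
  factors, and the exponent of \<open>Z\<close> may vary with \<open>N\<close>. Leading exponents
  add up under multiplication in any order, so they depend only on the multiplicities of the
  letters. In a lattice with one coordinate for each pair (i,j), the off-diagonal coordinates of
  such an exponent are partial row and column sums of the multiplicities, and \<open>Z\<close> moves
  only the diagonal ones. A coefficient with Z^(ell k) thus changes diagonal coordinates by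
  multiples of ell: residues modulo ell give back \<open>N\<close>, then \<open>N\<close> fixes
  \<open>k N\<close>, and the Frobenius monomial follows.

  The diagonal of shifts between the two unitriangular factors has two purposes: it supplies the n
  coordinates that these factors leave free, and it makes D act as one invertible shift, so that the
  representation extends to \<open>Z\<close>. Words without \<open>Z\<close> are the case k = 0,
  hence one representation settles both algebras.\<close>

lemma map_poly_of_int_add:
  "map_poly (of_int :: int \<Rightarrow> complex) (p + q) = map_poly of_int p + map_poly of_int q"
  by (rule poly_eqI) (simp add: coeff_map_poly)

lemma map_poly_of_int_diff:
  "map_poly (of_int :: int \<Rightarrow> complex) (p - q) = map_poly of_int p - map_poly of_int q"
  by (rule poly_eqI) (simp add: coeff_map_poly)

lemma map_poly_of_int_mult:
  "map_poly (of_int :: int \<Rightarrow> complex) (p * q) = map_poly of_int p * map_poly of_int q"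
  by (rule poly_eqI) (simp add: coeff_map_poly coeff_mult)

lemma map_poly_of_int_prod:
  "map_poly (of_int :: int \<Rightarrow> complex) (\<Prod>x\<in>A. f x) = (\<Prod>x\<in>A. map_poly of_int (f x))"
  by (induction A rule: infinite_finite_induct)
     (simp_all add: map_poly_of_int_mult map_poly_1)

lemma map_poly_of_int_inj:
  "map_poly (of_int :: int \<Rightarrow> complex) p = map_poly of_int q \<Longrightarrow> p = q"
  by (rule poly_eqI) (metis coeff_map_poly of_int_0 of_int_eq_iff)

lemma degree_map_poly_of_int [simp]:
  "degree (map_poly (of_int :: int \<Rightarrow> complex) p) = degree p"
  by (rule degree_map_poly) simp

section \<open>Evaluation of integer polynomials at complex numbers\<close>

definition ev :: "complex \<Rightarrow> int poly \<Rightarrow> complex" where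
  "ev z p = poly (map_poly of_int p) z"

lemma ev_add: "ev z (p + q) = ev z p + ev z q"
  by (simp add: ev_def map_poly_of_int_add)

lemma ev_mult: "ev z (p * q) = ev z p * ev z q"
  by (simp add: ev_def map_poly_of_int_mult)

lemma ev_0 [simp]: "ev z 0 = 0" and ev_1 [simp]: "ev z 1 = 1" and ev_X [simp]: "ev z [:0, 1:] = z"
  by (simp_all add: ev_def map_poly_1 map_poly_pCons)

lemma ev_diff: "ev z (p - q) = ev z p - ev z q"
  by (simp add: ev_def map_poly_of_int_diff)

lemma ev_uminus: "ev z (- p) = - ev z p"
  using ev_diff[of z 0 p] by simp

lemma ev_power: "ev z (p ^ k) = ev z p ^ k"
  by (induction k) (simp_all add: ev_mult)

text \<open>Pseudo-division scales \<open>f\<close> by a power of the leading coefficient of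
  \<open>g\<close>; for monic \<open>g\<close> this factor is 1, so it is genuine division in
  Z[X].\<close>

lemma monic_division:
  fixes f g :: "int poly"
  assumes "lead_coeff g = 1"
  obtains q r where "f = g * q + r" "r = 0 \<or> degree r < degree g"
proof -
  obtain q r where qr: "pseudo_divmod f g = (q, r)" by fastforce
  have "g \<noteq> 0" using assms by auto
  from pseudo_divmod[OF this qr] assms that show thesis by simp
qed

section \<open>Primitive roots of unity and their root polynomials\<close>

definition primroots :: "nat \<Rightarrow> complex set" where
  "primroots d = (\<lambda>k. cis (2 * pi * real k / real d)) ` {k. k < d \<and> coprime k d}"

lemma finite_primroots [simp]: "finite (primroots d)"
  unfolding primroots_def by auto

lemma primroots_power:
  assumes "d > 0" "z \<in> primroots d"
  shows "z ^ d = 1"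
proof -
  from assms obtain k where "k < d" "z = cis (2 * pi * real k / real d)"
    by (auto simp: primroots_def)
  with bij_betw_roots_unity[OF assms(1)] show ?thesis by (auto simp: bij_betw_def)
qed

lemma primroots_nonzero: "d > 0 \<Longrightarrow> z \<in> primroots d \<Longrightarrow> z \<noteq> 0"
  using primroots_power[of d z] by (auto simp: power_0_left)

text \<open>Comparing angles gives \<open>d dvd k * m\<close>, and \<open>k\<close> is coprime to
  \<open>d\<close>. So the order of \<open>z\<close> is exactly \<open>d\<close>, which keeps the
  sets \<open>primroots d\<close> for different \<open>d\<close> apart.\<close>

lemma primroots_power_eq_1D:
  assumes "z \<in> primroots d" "z ^ m = 1"
  shows "d dvd m"
proof -
  from assms obtain k where k: "k < d" "coprime k d" "z = cis (2 * pi * real k / real d)"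
    by (auto simp: primroots_def)
  have "cis (2 * pi * real k * real m / real d) = 1"
    using assms(2) k by (simp add: DeMoivre mult_ac)
  hence "cos (2 * pi * real k * real m / real d) = 1" by (simp add: complex_eq_iff)
  then obtain i :: int where "2 * pi * real k * real m / real d = real_of_int i * 2 * pi"
    by (subst (asm) cos_one_2pi_int) blast
  hence "real k * real m = real_of_int i * real d" using k by (simp add: field_simps)
  hence "real_of_int (int (k * m)) = real_of_int (i * int d)" by simp
  hence "int (k * m) = i * int d" by (simp only: of_int_eq_iff)
  hence "int d dvd int (k * m)" by simp
  hence "d dvd k * m" by (simp only: of_nat_dvd_iff)
  thus ?thesis using k(2) by (simp add: coprime_dvd_mult_right_iff coprime_commute)
qed

lemma primroots_disjoint: "d \<noteq> e \<Longrightarrow> d > 0 \<Longrightarrow> e > 0 \<Longrightarrow> primroots d \<inter> primroots e = {}"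
  by (metis disjoint_iff dvd_antisym primroots_power primroots_power_eq_1D)

lemma roots_unity_eq_primroots:
  assumes "n > 0"
  shows "{z. z ^ n = 1} = (\<Union>d\<in>{d. d dvd n}. primroots d)"
proof (intro equalityI subsetI)
  fix z :: complex assume "z \<in> {z. z ^ n = 1}"
  then obtain k where k: "k < n" "z = cis (2 * pi * real k / real n)"
    using bij_betw_roots_unity[OF assms] by (auto simp: bij_betw_def image_iff set_eq_iff)
  \<comment> \<open>Reducing the fraction k/n to lowest terms exhibits \<open>z\<close> as a
    primitive root of order n/g.\<close>
  define g where "g = gcd k n"
  have g: "g > 0" using assms by (simp add: g_def)
  have kn: "k = k div g * g" "n = n div g * g" by (simp_all add: g_def)
  have "k div g < n div g" using k(1) kn g by (metis mult_less_cancel2)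
  moreover have "coprime (k div g) (n div g)"
    unfolding g_def using assms by (intro div_gcd_coprime) auto
  moreover have "real k = real (k div g) * real g" "real n = real (n div g) * real g"
    using kn by (metis of_nat_mult)+
  hence "real k / real n = real (k div g) / real (n div g)" using g by simp
  hence "z = cis (2 * pi * real (k div g) / real (n div g))" using k by (simp add: field_simps)
  ultimately have "z \<in> primroots (n div g)" by (auto simp: primroots_def)
  moreover have "n div g dvd n" using kn by (metis dvd_triv_left)
  ultimately show "z \<in> (\<Union>d\<in>{d. d dvd n}. primroots d)" by blast
next
  fix z assume "z \<in> (\<Union>d\<in>{d. d dvd n}. primroots d)"
  then obtain d where d: "d dvd n" "z \<in> primroots d" by auto
  hence "d > 0" using assms by (auto intro!: Nat.gr0I)
  with d primroots_power[of d z] show "z \<in> {z. z ^ n = 1}" by (auto elim!: dvdE simp: power_mult)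
qed

abbreviation rootpoly :: "complex set \<Rightarrow> complex poly" where
  "rootpoly A \<equiv> \<Prod>z\<in>A. [:- z, 1:]"

lemma monic_rootpoly: "lead_coeff (rootpoly A) = 1"
  by (simp add: lead_coeff_prod)

lemma degree_rootpoly: "degree (rootpoly A) = card A"
  by (subst degree_prod_eq_sum_degree) auto

lemma poly_rootpoly: "finite A \<Longrightarrow> poly (rootpoly A) z = 0 \<longleftrightarrow> z \<in> A"
  by (auto simp: poly_prod)

text \<open>Both sides are monic of degree n, so a nonzero difference would have degree below n and
  yet vanish at n points.\<close>

lemma rootpoly_unity:
  assumes "n > 0"
  shows "rootpoly {z. z ^ n = 1} = monom 1 n - 1"
proof (rule ccontr)
  define f :: "complex poly" where "f = monom 1 n - 1"
  define A where "A = {z :: complex. z ^ n = 1}"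
  define p where "p = rootpoly A - f"
  assume "rootpoly {z. z ^ n = 1} \<noteq> monom 1 n - 1"
  hence p0: "p \<noteq> 0" by (simp add: p_def f_def A_def)
  have A: "finite A" "card A = n"
    using assms by (simp_all add: A_def card_roots_unity_eq finite_roots_unity)
  have coeffn: "coeff (rootpoly A) n = 1" 
    using monic_rootpoly[of A] degree_rootpoly[of A] A by simp
  have "degree p \<le> n" unfolding p_def f_def
    by (intro degree_diff_le) (auto simp: degree_rootpoly A degree_monom_le)
  moreover have "coeff p n = 0" using coeffn assms by (simp add: p_def f_def)
  ultimately have "degree p < n" using p0
    by (cases "degree p = n") auto
  moreover have "A \<subseteq> {z. poly p z = 0}"
  proof
    fix z assume z: "z \<in> A"
    hence "poly (rootpoly A) z = 0" by (simp only: poly_rootpoly[OF A(1)])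
    moreover have "poly f z = 0" using z by (simp add: f_def A_def poly_monom)
    ultimately show "z \<in> {z. poly p z = 0}" by (simp add: p_def)
  qed
  hence "card A \<le> degree p"
    using card_poly_roots_bound[OF p0] card_mono[OF poly_roots_finite[OF p0]] order_trans by blast
  ultimately show False using A by simp
qed

lemma rootpoly_unity_split:
  assumes "n > 0"
  shows "monom 1 n - 1 = rootpoly (primroots n) * (\<Prod>d\<in>{d. d dvd n \<and> d \<noteq> n}. rootpoly (primroots d))"
proof -
  have fin: "finite {d. d dvd n}" using assms by simp
  have "monom 1 n - 1 = rootpoly (\<Union>d\<in>{d. d dvd n}. primroots d)"
    using rootpoly_unity[OF assms] roots_unity_eq_primroots[OF assms] by simp
  also have "\<dots> = (\<Prod>d\<in>{d. d dvd n}. rootpoly (primroots d))"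
  proof (intro prod.UNION_disjoint)
    show "\<forall>i\<in>{d. d dvd n}. \<forall>j\<in>{d. d dvd n}. i \<noteq> j \<longrightarrow> primroots i \<inter> primroots j = {}"
      using assms by (metis dvd_pos_nat mem_Collect_eq primroots_disjoint)
  qed (use fin in auto)
  also have "{d. d dvd n} = insert n {d. d dvd n \<and> d \<noteq> n}" by auto
  also have "(\<Prod>d\<in>insert n {d. d dvd n \<and> d \<noteq> n}. rootpoly (primroots d))
      = rootpoly (primroots n) * (\<Prod>d\<in>{d. d dvd n \<and> d \<noteq> n}. rootpoly (primroots d))"
    by (rule prod.insert) (use fin in auto)
  finally show ?thesis .
qed

text \<open>Strong induction over divisors. The product over the proper divisors is a monic integer
  polynomial, so X^n - 1 can be divided by it within Z[X]; uniqueness of division over the complex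
  numbers identifies the quotient with the remaining root polynomial.\<close>

lemma int_rootpoly_primroots:
  "n > 0 \<Longrightarrow> \<exists>p. map_poly of_int p = rootpoly (primroots n)"
proof (induction n rule: less_induct)
  case (less n)
  have "\<forall>d\<in>{d. d dvd n \<and> d \<noteq> n}. \<exists>p. map_poly of_int p = rootpoly (primroots d)"
  proof safe
    fix d assume "d dvd n" "d \<noteq> n"
    hence "d > 0" "d < n" using less.prems dvd_pos_nat[of n d] dvd_imp_le[of d n] by linarith+
    thus "\<exists>p. map_poly of_int p = rootpoly (primroots d)" using less.IH by blast
  qed
  then obtain P where P: "\<forall>d\<in>{d. d dvd n \<and> d \<noteq> n}. map_poly of_int (P d) = rootpoly (primroots d)"
    by (rule bchoice[THEN exE])
  define A where "A = (\<Prod>d\<in>{d. d dvd n \<and> d \<noteq> n}. P d)"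
  let ?m = "map_poly (of_int :: int \<Rightarrow> complex)"
  have mA: "?m A = (\<Prod>d\<in>{d. d dvd n \<and> d \<noteq> n}. rootpoly (primroots d))"
    unfolding A_def map_poly_of_int_prod using P by (intro prod.cong refl) blast
  have "lead_coeff (?m A) = 1"
    unfolding mA by (simp add: lead_coeff_prod monic_rootpoly)
  hence lA: "lead_coeff A = 1" by (simp add: coeff_map_poly)
  obtain Q R where QR: "monom 1 n - 1 = A * Q + R" "R = 0 \<or> degree R < degree A"
    using monic_division[OF lA] by blast
  have "?m (monom 1 n - 1) = monom 1 n - 1"
    by (simp add: map_poly_of_int_diff map_poly_monom map_poly_1')
  hence "rootpoly (primroots n) * ?m A = ?m A * ?m Q + ?m R"
    using rootpoly_unity_split[OF less.prems] unfolding mA[symmetric] QR(1)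
    by (simp add: map_poly_of_int_add map_poly_of_int_mult)
  hence eq: "?m A * (rootpoly (primroots n) - ?m Q) = ?m R" by (simp add: algebra_simps)
  have A0: "?m A \<noteq> 0" using \<open>lead_coeff (?m A) = 1\<close> by auto
  have "rootpoly (primroots n) - ?m Q = 0"
  proof (rule ccontr)
    assume B: "rootpoly (primroots n) - ?m Q \<noteq> 0"
    hence "?m R \<noteq> 0" using eq A0 by (metis mult_eq_0_iff)
    hence "degree R < degree A" using QR(2) by auto
    moreover have "degree (?m R) \<ge> degree (?m A)"
      unfolding eq[symmetric] using A0 B by (subst degree_mult_eq) auto
    ultimately show False by simp
  qed
  thus ?case by (intro exI[of _ Q]) simp
qed

text \<open>Resolves the definite description in \<open>cyclo\<close>: existence is
  \<open>int_rootpoly_primroots\<close>, uniqueness the injectivity of Z[X] into C[X].\<close>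

lemma map_poly_cyclo:
  assumes "n > 0"
  shows "map_poly of_int (cyclo n) = rootpoly (primroots n)"
proof -
  have "inj_on (\<lambda>k. cis (2 * pi * real k / real n)) {k. k < n \<and> coprime k n}"
    using bij_betw_roots_unity[OF assms] by (auto simp: bij_betw_def intro: inj_on_subset)
  hence "(\<Prod>k\<in>{k. k < n \<and> coprime k n}. [:- cis (2 * pi * real k / real n), 1:]) = rootpoly (primroots n)"
    unfolding primroots_def by (subst prod.reindex) simp_all
  with int_rootpoly_primroots[OF assms] obtain p
    where "map_poly of_int p = (\<Prod>k\<in>{k. k < n \<and> coprime k n}. [:- cis (2 * pi * real k / real n), 1:])"
    and eq: "(\<Prod>k\<in>{k. k < n \<and> coprime k n}. [:- cis (2 * pi * real k / real n), 1:]) = rootpoly (primroots n)"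
    by auto
  from this(1) have "cyclo n = p"
    unfolding cyclo_def by (intro the_equality) (metis map_poly_of_int_inj)+
  with \<open>map_poly of_int p = _\<close> eq show ?thesis by simp
qed

lemma monic_cyclo: "n > 0 \<Longrightarrow> lead_coeff (cyclo n) = 1"
  using monic_rootpoly[of "primroots n"]
  by (subst (asm) (1 2) map_poly_cyclo[symmetric]) (simp_all add: coeff_map_poly)

lemma ev_cyclo: "n > 0 \<Longrightarrow> z \<in> primroots n \<Longrightarrow> ev z (cyclo n) = 0"
  by (simp add: ev_def map_poly_cyclo poly_rootpoly)

text \<open>The remainder of \<open>p\<close> vanishes at all primitive roots, and there are as many
  of these as the degree of the monic divisor, so the remainder is 0.\<close>

lemma cyclo_dvd_iff:
  assumes "n > 0"
  shows "cyclo n dvd p \<longleftrightarrow> (\<forall>z\<in>primroots n. ev z p = 0)"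
proof
  assume "cyclo n dvd p"
  then obtain r where p: "p = cyclo n * r" ..
  thus "\<forall>z\<in>primroots n. ev z p = 0" by (simp add: p ev_mult ev_cyclo assms)
next
  assume *: "\<forall>z\<in>primroots n. ev z p = 0"
  obtain q r where qr: "p = cyclo n * q + r" "r = 0 \<or> degree r < degree (cyclo n)"
    using monic_division[OF monic_cyclo[OF assms]] by blast
  have "ev z r = 0" if "z \<in> primroots n" for z
    using * that by (simp add: qr ev_add ev_mult ev_cyclo assms)
  hence sub: "primroots n \<subseteq> {z. poly (map_poly of_int r) z = 0}" by (auto simp: ev_def)
  have "r = 0"
  proof (rule ccontr)
    assume r: "r \<noteq> 0"
    hence r': "map_poly (of_int :: int \<Rightarrow> complex) r \<noteq> 0" using map_poly_of_int_inj[of r 0] by auto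
    have "card (primroots n) \<le> degree r"
      using card_poly_roots_bound[OF r'] card_mono[OF poly_roots_finite[OF r'] sub] by simp
    moreover have "degree (cyclo n) = card (primroots n)"
      using map_poly_cyclo[OF assms] degree_rootpoly by (metis degree_map_poly_of_int)
    ultimately show False using qr r by simp
  qed
  thus "cyclo n dvd p" using qr by simp
qed

lemma cyclo_dvd_X_power_minus_1: "n > 0 \<Longrightarrow> cyclo n dvd [:0, 1:] ^ n - 1"
  by (simp add: cyclo_dvd_iff ev_diff ev_power primroots_power)

section \<open>The free algebra and its congruences\<close>

lemma gw_mult: "gw u * gw v = gw (u @ v)"
  by (simp add: gw_def mult_single)

lemma gw_Nil [simp]: "gw [] = 1"
  by (simp add: gw_def flip: zero_word_def)

lemma gw_Cons: "gw (x # w) = gw [x] * gw w"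
  by (simp add: gw_mult)

lemma gw_replicate: "gw (replicate k x) = gw [x] ^ k"
  by (induction k) (simp_all add: gw_Cons[of x "replicate _ x"])

lemma sc_0 [simp]: "sc 0 = 0" and sc_1 [simp]: "sc 1 = 1"
  by (simp_all add: sc_def flip: zero_word_def)

lemma sc_add: "sc (c + d) = sc c + sc d"
  by (simp add: sc_def single_add)

lemma sc_diff: "sc (c - d) = sc c - sc d"
  by (simp add: sc_def single_diff)

lemma sc_mult: "sc (c * d) = sc c * sc d"
  by (simp add: sc_def mult_single flip: zero_word_def)

lemma sc_power: "sc (c ^ k) = sc c ^ k"
  by (induction k) (simp_all add: sc_mult)

lemma sc_gw: "sc c * gw w = Poly_Mapping.single (Wd w) c"
  by (simp add: sc_def gw_def mult_single)

lemma fa_expand: "x = (\<Sum>k\<in>Poly_Mapping.keys x. Poly_Mapping.single k (Poly_Mapping.lookup x k))"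
  by (rule poly_mapping_eqI)
     (auto simp: lookup_sum lookup_single when_def in_keys_iff sum.If_cases sum.delta' cong: if_cong)

text \<open>The word case carries \<open>Wd w \<in> keys x\<close>; this is how hypotheses
  \<open>in_freeM\<close> and \<open>in_freeGL\<close> on \<open>x\<close> reach its words.\<close>

lemma fa_induct [case_names word add]:
  assumes "\<And>c w. Wd w \<in> Poly_Mapping.keys x \<Longrightarrow> P (sc c * gw w)"
    and "P 0" "\<And>x y. P x \<Longrightarrow> P y \<Longrightarrow> P (x + y)"
  shows "P x"
proof -
  have single: "P (Poly_Mapping.single k (Poly_Mapping.lookup x k))" if "k \<in> Poly_Mapping.keys x" for k
    using assms(1) that by (cases k) (simp add: sc_gw)
  have "P (\<Sum>k\<in>A. Poly_Mapping.single k (Poly_Mapping.lookup x k))"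
    if "finite A" "A \<subseteq> Poly_Mapping.keys x" for A
    using that by (induction A rule: finite_induct) (auto intro: assms single)
  from this[OF finite_keys order_refl] show ?thesis by (simp flip: fa_expand)
qed

lemma sc_commute: "sc c * x = x * sc c"
proof (induction x rule: fa_induct)
  case (word d w)
  show ?case by (simp add: sc_gw) (simp add: sc_def mult_single mult.commute flip: zero_word_def)
qed (simp_all add: algebra_simps)

lemma sc_left_commute: "x * (sc c * y) = sc c * (x * y)"
  by (metis mult.assoc sc_commute)


section \<open>Congruence modulo a two-sided ideal\<close>

definition icong :: "fa set \<Rightarrow> fa \<Rightarrow> fa \<Rightarrow> bool" where
  "icong S x y \<longleftrightarrow> x - y \<in> tideal S"

lemma tideal_mult_left: "x \<in> tideal S \<Longrightarrow> a * x \<in> tideal S"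
  using tideal.mult[of x S a 1] by simp

lemma tideal_mult_right: "x \<in> tideal S \<Longrightarrow> x * b \<in> tideal S"
  using tideal.mult[of x S 1 b] by simp

lemma tideal_uminus: "x \<in> tideal S \<Longrightarrow> - x \<in> tideal S"
  using tideal_mult_left[of x S "- 1"] by simp

lemma tideal_mono:
  assumes "S \<subseteq> S'" "x \<in> tideal S"
  shows "x \<in> tideal S'"
  using assms(2) by induction (use assms(1) in \<open>auto intro: tideal.intros\<close>)

lemma icong_refl [simp]: "icong S x x"
  by (simp add: icong_def tideal.zero)

lemma icong_sym: "icong S x y \<Longrightarrow> icong S y x"
  using tideal_uminus[of "x - y" S] by (simp add: icong_def)

lemma icong_trans [trans]: "icong S x y \<Longrightarrow> icong S y z \<Longrightarrow> icong S x z"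
  using tideal.add[of "x - y" S "y - z"] by (simp add: icong_def)

lemma icong_add: "icong S x x' \<Longrightarrow> icong S y y' \<Longrightarrow> icong S (x + y) (x' + y')"
  using tideal.add[of "x - x'" S "y - y'"] by (simp add: icong_def algebra_simps)

lemma icong_left: "icong S x y \<Longrightarrow> icong S (a * x) (a * y)"
  using tideal_mult_left[of "x - y" S a] by (simp add: icong_def algebra_simps)

lemma icong_right: "icong S x y \<Longrightarrow> icong S (x * b) (y * b)"
  using tideal_mult_right[of "x - y" S b] by (simp add: icong_def algebra_simps)

lemma icong_sum: "(\<And>a. a \<in> A \<Longrightarrow> icong S (f a) (g a)) \<Longrightarrow> icong S (sum f A) (sum g A)"
  by (induction A rule: infinite_finite_induct) (auto intro: icong_add)

lemma icong_mono: "S \<subseteq> S' \<Longrightarrow> icong S x y \<Longrightarrow> icong S' x y"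
  by (auto simp: icong_def intro: tideal_mono)

text \<open>Used with \<open>s\<close> a power of q for letters that q-commute, and with
  \<open>s = 1\<close> for elements that commute.\<close>

lemma icong_power_commute:
  assumes "icong S (a * b) (sc s * (b * a))"
  shows "icong S (a ^ m * b) (sc (s ^ m) * (b * a ^ m))"
proof (induction m)
  case (Suc m)
  have "icong S (a * (a ^ m * b)) (a * (sc (s ^ m) * (b * a ^ m)))"
    by (rule icong_left[OF Suc])
  also have "a * (sc (s ^ m) * (b * a ^ m)) = sc (s ^ m) * (a * b * a ^ m)"
    by (simp add: sc_left_commute[of a] mult.assoc)
  also have "icong S \<dots> (sc (s ^ m) * (sc s * (b * a) * a ^ m))"
    by (intro icong_left icong_right assms)
  also have "\<dots> = sc (s ^ m) * sc s * (b * a ^ Suc m)" by (simp add: mult.assoc)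
  also have "sc (s ^ m) * sc s = sc (s ^ Suc m)" by (simp only: power_Suc2 sc_mult)
  finally show ?case by (simp only: power_Suc mult.assoc)
qed simp

text \<open>Here a, b, c, d stand for t_ik, t_il, t_jk, t_jl with i < j and k < l, and the last
  relation is multiplied by q since the coefficients are Z[q]. Each further factor \<open>a\<close>
  multiplies the old correction by q^2 and adds q^2 - 1; this telescopes to q^(2(m+1)) - 1, which
  dies modulo \<open>cyclo ell\<close> when m + 1 = ell.\<close>

lemma icong_power_diag_left:
  assumes ab: "icong S (a * b) (qq * (b * a))" and ac: "icong S (a * c) (qq * (c * a))"
    and ad: "icong S (qq * (a * d)) (qq * (d * a) + sc ([:0, 1:] ^ 2 - 1) * (b * c))"
  shows "icong S (qq * (a ^ Suc m * d))
    (qq * (d * a ^ Suc m) + sc ([:0, 1:] ^ (2 * Suc m) - 1) * (b * c * a ^ m))"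
proof (induction m)
  case 0
  show ?case using ad by simp
next
  case (Suc m)
  let ?X = "[:0, 1:] :: int poly"
  let ?r = "sc (?X ^ (2 * Suc m) - 1)"
  have qq2: "sc (?X ^ 2) = qq * qq" by (simp only: power2_eq_square sc_mult)
  have abc: "icong S (a * (b * c)) (sc (?X ^ 2) * (b * c * a))"
  proof -
    have "icong S (a * b * c) (qq * (b * a) * c)" by (rule icong_right[OF ab])
    also have "qq * (b * a) * c = qq * b * (a * c)" by (simp add: mult.assoc)
    also have "icong S \<dots> (qq * b * (qq * (c * a)))" by (rule icong_left[OF ac])
    also have "\<dots> = sc (?X ^ 2) * (b * c * a)"
      unfolding qq2 by (simp add: mult.assoc sc_left_commute[of a] sc_left_commute[of b] sc_left_commute[of c] sc_mult)
    finally show ?thesis by (simp add: mult.assoc)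
  qed
  have "qq * (a ^ Suc (Suc m) * d) = a * (qq * (a ^ Suc m * d))"
    by (simp add: sc_left_commute[of a] sc_left_commute[of b] sc_left_commute[of c] sc_mult mult.assoc)
  also have "icong S \<dots> (a * (qq * (d * a ^ Suc m) + ?r * (b * c * a ^ m)))"
    by (rule icong_left[OF Suc])
  also have "\<dots> = qq * (a * d) * a ^ Suc m + ?r * (a * (b * c) * a ^ m)"
    by (simp add: distrib_left sc_left_commute[of a] sc_left_commute[of b] sc_left_commute[of c] sc_mult mult.assoc)
  also have "icong S \<dots> ((qq * (d * a) + sc (?X ^ 2 - 1) * (b * c)) * a ^ Suc m
      + ?r * (sc (?X ^ 2) * (b * c * a) * a ^ m))"
    by (intro icong_add icong_right icong_left ad abc)
  also have "\<dots> = qq * (d * a ^ Suc (Suc m)) + (sc (?X ^ 2 - 1) + ?r * sc (?X ^ 2)) * (b * c * a ^ Suc m)"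
    by (simp add: distrib_right mult.assoc)
  \<comment> \<open>(q^2 - 1) + q^2 (q^(2(m+1)) - 1) = q^(2(m+2)) - 1.\<close>
  also have "sc (?X ^ 2 - 1) + ?r * sc (?X ^ 2) = sc (?X ^ (2 * Suc (Suc m)) - 1)"
    unfolding sc_mult[symmetric] sc_add[symmetric]
    by (rule arg_cong[of _ _ sc]) (simp add: algebra_simps power_add power2_eq_square)
  finally show ?case .
qed

text \<open>The mirror image, with powers of the lower right entry \<open>d\<close>.\<close>

lemma icong_power_diag_right:
  assumes bd: "icong S (b * d) (qq * (d * b))" and cd: "icong S (c * d) (qq * (d * c))"
    and ad: "icong S (qq * (a * d)) (qq * (d * a) + sc ([:0, 1:] ^ 2 - 1) * (b * c))"
  shows "icong S (qq * (a * d ^ Suc m))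
    (qq * (d ^ Suc m * a) + sc ([:0, 1:] ^ (2 * Suc m) - 1) * (d ^ m * (b * c)))"
proof (induction m)
  case 0
  show ?case using ad by simp
next
  case (Suc m)
  let ?X = "[:0, 1:] :: int poly"
  let ?r = "sc (?X ^ (2 * Suc m) - 1)"
  have qq2: "sc (?X ^ 2) = qq * qq" by (simp only: power2_eq_square sc_mult)
  have bcd: "icong S (b * c * d) (sc (?X ^ 2) * (d * (b * c)))"
  proof -
    have "icong S (b * (c * d)) (b * (qq * (d * c)))" by (rule icong_left[OF cd])
    also have "b * (qq * (d * c)) = qq * ((b * d) * c)" by (simp add: mult.assoc sc_left_commute[of d] sc_left_commute[of b] sc_left_commute[of c] sc_left_commute[of "d ^ _"])
    also have "icong S \<dots> (qq * (qq * (d * b) * c))" by (intro icong_left icong_right bd)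
    also have "\<dots> = sc (?X ^ 2) * (d * (b * c))"
      unfolding qq2 by (simp add: mult.assoc sc_left_commute[of d] sc_left_commute[of b] sc_left_commute[of c] sc_left_commute[of "d ^ _"])
    finally show ?thesis by (simp add: mult.assoc)
  qed
  have "qq * (a * d ^ Suc (Suc m)) = (qq * (a * d ^ Suc m)) * d"
    by (simp add: mult.assoc power_commutes)
  also have "icong S \<dots> ((qq * (d ^ Suc m * a) + ?r * (d ^ m * (b * c))) * d)"
    by (rule icong_right[OF Suc])
  also have "\<dots> = d ^ Suc m * (qq * (a * d)) + ?r * (d ^ m * (b * c * d))"
    by (simp add: distrib_right sc_left_commute[of d] sc_left_commute[of b] sc_left_commute[of c] sc_left_commute[of "d ^ _"] mult.assoc)
  also have "icong S \<dots> (d ^ Suc m * (qq * (d * a) + sc (?X ^ 2 - 1) * (b * c))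
      + ?r * (d ^ m * (sc (?X ^ 2) * (d * (b * c)))))"
    by (intro icong_add icong_right icong_left ad bcd)
  also have "\<dots> = qq * (d ^ Suc (Suc m) * a) + (sc (?X ^ 2 - 1) + ?r * sc (?X ^ 2)) * (d ^ Suc m * (b * c))"
    by (simp add: distrib_right distrib_left sc_left_commute[of d] sc_left_commute[of b] sc_left_commute[of c] sc_left_commute[of "d ^ _"] mult.assoc power_commutes)
       (simp add: mult.assoc[symmetric] power_commutes)
  also have "sc (?X ^ 2 - 1) + ?r * sc (?X ^ 2) = sc (?X ^ (2 * Suc (Suc m)) - 1)"
    unfolding sc_mult[symmetric] sc_add[symmetric]
    by (rule arg_cong[of _ _ sc]) (simp add: algebra_simps power_add power2_eq_square)
  finally show ?case .
qed

section \<open>Straightening words of quantum matrices\<close>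

abbreviation letters :: "nat \<Rightarrow> gen set" where
  "letters n \<equiv> {T i j | i j. i \<in> {1..n} \<and> j \<in> {1..n}}"

text \<open>For i < j and k < l one has i l + j k < i k + j l.\<close>

fun wt :: "gen \<Rightarrow> nat" where
  "wt (T i j) = i * j"
| "wt Z = 0"

abbreviation mu :: "gen list \<Rightarrow> nat" where
  "mu w \<equiv> sum_list (map wt w)"

text \<open>The error terms of straightening: combinations of lighter words, together with the
  ideal. Multiplication by words raises the bound \<open>m\<close> accordingly, see
  \<open>lower_words\<close>.\<close>

inductive_set lower :: "nat \<Rightarrow> nat \<Rightarrow> nat \<Rightarrow> fa set" for ell n m :: nat where
  word: "set w \<subseteq> letters n \<Longrightarrow> mu w < m \<Longrightarrow> gw w \<in> lower ell n m"
| ideal: "x \<in> tideal (relsM ell n) \<Longrightarrow> x \<in> lower ell n m"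
| add: "x \<in> lower ell n m \<Longrightarrow> y \<in> lower ell n m \<Longrightarrow> x + y \<in> lower ell n m"
| scal: "x \<in> lower ell n m \<Longrightarrow> sc c * x \<in> lower ell n m"

lemma lower_words:
  assumes "x \<in> lower ell n m" "set u \<subseteq> letters n" "set v \<subseteq> letters n"
  shows "gw u * x * gw v \<in> lower ell n (mu u + m + mu v)"
  using assms(1)
proof induction
  case (word w)
  have "gw (u @ w @ v) \<in> lower ell n (mu u + m + mu v)"
    using word assms by (intro lower.word) auto
  thus ?case by (simp add: gw_mult)
next
  case (scal x c)
  have "sc c * (gw u * x * gw v) \<in> lower ell n (mu u + m + mu v)"
    by (rule lower.scal[OF scal.IH])
  thus ?case by (metis mult.assoc sc_left_commute)
next
  case (add x y)
  thus ?case by (simp add: distrib_left distrib_right lower.add)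
qed (auto intro: lower.ideal tideal.mult)

locale qmatrix =
  fixes ell n :: nat
  assumes ell_pos: "ell > 0"
begin

abbreviation cong (infix "\<approx>" 50) where
  "x \<approx> y \<equiv> icong (relsM ell n) x y"

lemma sc_cyclo: "cyclo ell dvd c - d \<Longrightarrow> sc c \<approx> sc d"
proof -
  assume "cyclo ell dvd c - d"
  then obtain r where "c - d = cyclo ell * r" ..
  hence "sc c - sc d = sc (cyclo ell) * sc r" by (metis sc_diff sc_mult)
  moreover have "sc (cyclo ell) \<in> tideal (relsM ell n)"
    by (rule tideal.gen) (simp add: relsM_def)
  ultimately show ?thesis by (simp add: icong_def tideal_mult_right)
qed

lemma sc_X_ell: "sc ([:0, 1:] ^ ell) \<approx> 1"
  using sc_cyclo[OF cyclo_dvd_X_power_minus_1[OF ell_pos]] by simp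

text \<open>The coefficients contain no negative powers of q, but q^ell = 1 modulo the
  relations.\<close>

abbreviation qinv :: fa where "qinv \<equiv> sc ([:0, 1:] ^ (ell - 1))"

lemma qinv_qq: "qinv * qq \<approx> 1"
  using sc_X_ell ell_pos by (metis Suc_pred' power_Suc2 sc_mult Suc_diff_1)

lemma qinv_cancel: "qinv * (qq * x) \<approx> x"
  using icong_right[OF qinv_qq, of x] by (simp add: mult.assoc)

lemma qq_cancel: "qq * x \<approx> qq * y \<Longrightarrow> x \<approx> y"
  by (meson icong_left icong_sym icong_trans qinv_cancel)

lemma relD: "x - y \<in> relsM ell n \<Longrightarrow> x \<approx> y"
  by (simp add: icong_def tideal.gen)

lemma row_rel:
  assumes "i \<in> {1..n}" "j \<in> {1..n}" "k \<in> {1..n}" "j < k"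
  shows "tt i j * tt i k \<approx> qq * (tt i k * tt i j)"
  by (rule relD) (use assms in \<open>unfold relsM_def mult.assoc[symmetric], blast\<close>)

lemma col_rel:
  assumes "i \<in> {1..n}" "h \<in> {1..n}" "k \<in> {1..n}" "i < h"
  shows "tt i k * tt h k \<approx> qq * (tt h k * tt i k)"
  by (rule relD) (use assms in \<open>unfold relsM_def mult.assoc[symmetric], blast\<close>)

lemma anti_rel:
  assumes "i \<in> {1..n}" "j \<in> {1..n}" "k \<in> {1..n}" "l \<in> {1..n}" "i < j" "k < l"
  shows "tt i l * tt j k \<approx> tt j k * tt i l"
  by (rule relD) (use assms in \<open>unfold relsM_def mult.assoc[symmetric], blast\<close>)

lemma diag_rel:
  assumes "i \<in> {1..n}" "j \<in> {1..n}" "k \<in> {1..n}" "l \<in> {1..n}" "i < j" "k < l"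
  shows "qq * (tt i k * tt j l) \<approx> qq * (tt j l * tt i k) + sc ([:0, 1:] ^ 2 - 1) * (tt i l * tt j k)"
proof (rule relD)
  have "qq * tt i k * tt j l - qq * tt j l * tt i k - (qq ^ 2 - 1) * tt i l * tt j k \<in> relsM ell n"
    using assms unfolding relsM_def by blast
  moreover have "sc ([:0, 1:] ^ 2 - 1) = qq ^ 2 - 1" by (simp only: sc_diff sc_power sc_1)
  ultimately show "qq * (tt i k * tt j l)
      - (qq * (tt j l * tt i k) + sc ([:0, 1:] ^ 2 - 1) * (tt i l * tt j k)) \<in> relsM ell n"
    by (simp only: mult.assoc diff_diff_eq)
qed

lemma qcomm_swap:
  assumes "x * y \<approx> qq * (y * x)"
  shows "y * x \<approx> qinv * (x * y)"
  by (meson assms icong_left icong_sym icong_trans qinv_cancel)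

text \<open>The only relative position of two letters, up to exchanging them, whose relation has a
  correction term.\<close>

definition diagonal :: "gen \<Rightarrow> gen \<Rightarrow> bool" where
  "diagonal x y \<longleftrightarrow> (\<exists>i j k l. x = T i k \<and> y = T j l \<and> i < j \<and> k < l)"

text \<open>The exponent is 0, 1 or ell - 1; the last one stands for -1 when a relation is read
  backwards.\<close>

lemma letters_commute:
  assumes "x \<in> letters n" "y \<in> letters n" "\<not> diagonal x y" "\<not> diagonal y x"
  shows "\<exists>a. gw [x] * gw [y] \<approx> sc ([:0, 1:] ^ a) * (gw [y] * gw [x])"
proof -
  obtain i k j l where xy: "x = T i k" "y = T j l"
    and ijkl: "i \<in> {1..n}" "j \<in> {1..n}" "k \<in> {1..n}" "l \<in> {1..n}"
    using assms by blast
  have one: "qq = sc ([:0, 1:] ^ 1)" "sc ([:0, 1:] ^ 0) = 1" by simp_all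
  consider "i = j" "k = l" | "i = j" "k < l" | "i = j" "k > l" | "k = l" "i < j" | "k = l" "i > j"
    | "i < j" "l < k" | "j < i" "k < l"
    using assms(3,4) by (auto simp: diagonal_def xy) (metis linorder_neqE_nat)+
  thus ?thesis
  proof cases
    case 1
    show ?thesis unfolding xy by (rule exI[of _ 0]) (simp add: 1)
  next
    case 2
    show ?thesis unfolding xy by (rule exI[of _ 1]) (use row_rel ijkl 2 in auto)
  next
    case 3
    show ?thesis unfolding xy by (rule exI[of _ "ell - 1"]) (use qcomm_swap[OF row_rel] ijkl 3 in auto)
  next
    case 4
    show ?thesis unfolding xy by (rule exI[of _ 1]) (use col_rel ijkl 4 in auto)
  next
    case 5
    show ?thesis unfolding xy by (rule exI[of _ "ell - 1"]) (use qcomm_swap[OF col_rel] ijkl 5 in auto)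
  next
    case 6
    show ?thesis unfolding xy by (rule exI[of _ 0]) (use anti_rel ijkl 6 in auto)
  next
    case 7
    show ?thesis unfolding xy by (rule exI[of _ 0]) (use anti_rel[THEN icong_sym] ijkl 7 in auto)
  qed
qed

text \<open>For q-commuting letters the ell-th power collects a factor q^(a ell), and for diagonal
  ones the correction carries q^(2 ell) - 1; modulo \<open>cyclo ell\<close> the first is 1 and the
  second 0.\<close>

lemma power_ell_central_letter:
  assumes "x \<in> letters n" "y \<in> letters n"
  shows "gw [x] ^ ell * gw [y] \<approx> gw [y] * gw [x] ^ ell"
proof -
  obtain m where m: "ell = Suc m" using ell_pos by (cases ell) auto
  let ?X = "[:0, 1:] :: int poly"
  have kill: "sc (?X ^ (2 * Suc m) - 1) * z \<approx> 0" for z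
  proof -
    have "?X ^ (2 * Suc m) - 1 = (?X ^ ell + 1) * (?X ^ ell - 1)"
      unfolding m mult_2 power_add by (rule square_diff_one_factored)
    hence "cyclo ell dvd ?X ^ (2 * Suc m) - 1 - 0"
      using cyclo_dvd_X_power_minus_1[OF ell_pos] by simp
    from icong_right[OF sc_cyclo[OF this], of z] show ?thesis by simp
  qed
  consider "diagonal x y" | "diagonal y x" | "\<not> diagonal x y" "\<not> diagonal y x" by blast
  thus ?thesis
  proof cases
    case 1
    then obtain i j k l where *: "x = T i k" "y = T j l" "i < j" "k < l" by (auto simp: diagonal_def)
    hence ijkl: "i \<in> {1..n}" "j \<in> {1..n}" "k \<in> {1..n}" "l \<in> {1..n}" using assms by auto
    have "qq * (tt i k ^ Suc m * tt j l) \<approx> qq * (tt j l * tt i k ^ Suc m)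
        + sc (?X ^ (2 * Suc m) - 1) * (tt i l * tt j k * tt i k ^ m)"
      by (rule icong_power_diag_left) (use row_rel col_rel diag_rel ijkl * in auto)
    also have "\<dots> \<approx> qq * (tt j l * tt i k ^ Suc m) + 0"
      by (intro icong_add icong_refl kill)
    finally have "tt i k ^ Suc m * tt j l \<approx> tt j l * tt i k ^ Suc m"
      unfolding add_0_right by (rule qq_cancel)
    thus ?thesis by (simp only: * flip: m)
  next
    case 2
    then obtain i j k l where *: "y = T i k" "x = T j l" "i < j" "k < l" by (auto simp: diagonal_def)
    hence ijkl: "i \<in> {1..n}" "j \<in> {1..n}" "k \<in> {1..n}" "l \<in> {1..n}" using assms by auto
    have "qq * (tt i k * tt j l ^ Suc m) \<approx> qq * (tt j l ^ Suc m * tt i k)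
        + sc (?X ^ (2 * Suc m) - 1) * (tt j l ^ m * (tt i l * tt j k))"
      by (rule icong_power_diag_right) (use row_rel col_rel diag_rel ijkl * in auto)
    also have "\<dots> \<approx> qq * (tt j l ^ Suc m * tt i k) + 0"
      by (intro icong_add icong_refl kill)
    finally have "tt i k * tt j l ^ Suc m \<approx> tt j l ^ Suc m * tt i k"
      unfolding add_0_right by (rule qq_cancel)
    thus ?thesis by (simp only: * icong_sym flip: m)
  next
    case 3
    from letters_commute[OF assms 3] obtain a
      where "gw [x] * gw [y] \<approx> sc (?X ^ a) * (gw [y] * gw [x])" by blast
    from icong_power_commute[OF this, of ell]
    have "gw [x] ^ ell * gw [y] \<approx> sc ((?X ^ a) ^ ell) * (gw [y] * gw [x] ^ ell)" .
    also have "\<dots> \<approx> 1 * (gw [y] * gw [x] ^ ell)"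
    proof (rule icong_right)
      \<comment> \<open>Taken at y = q^ell: the polynomial q^(a ell) - 1 is divisible by q^ell -
        1.\<close>
      have "y - 1 dvd y ^ a - 1" for y :: "int poly"
        by (subst power_diff_1_eq) (rule dvd_triv_left)
      hence "cyclo ell dvd (?X ^ ell) ^ a - 1"
        using cyclo_dvd_X_power_minus_1[OF ell_pos] dvd_trans by blast
      hence "cyclo ell dvd (?X ^ a) ^ ell - 1"
        by (simp only: power_mult[symmetric] mult.commute)
      from sc_cyclo[OF this] show "sc ((?X ^ a) ^ ell) \<approx> 1" by simp
    qed
    finally show ?thesis by simp
  qed
qed

lemma power_ell_central_word:
  assumes "x \<in> letters n" "set w \<subseteq> letters n"
  shows "gw [x] ^ ell * gw w \<approx> gw w * gw [x] ^ ell"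
  using assms(2)
proof (induction w)
  case (Cons y w)
  have "gw [x] ^ ell * gw (y # w) = gw [x] ^ ell * gw [y] * gw w"
    by (simp add: gw_Cons[of y w] mult.assoc)
  also have "\<dots> \<approx> gw [y] * gw [x] ^ ell * gw w"
    by (rule icong_right[OF power_ell_central_letter]) (use assms Cons in auto)
  also have "\<dots> = gw [y] * (gw [x] ^ ell * gw w)" by (simp add: mult.assoc)
  also have "\<dots> \<approx> gw [y] * (gw w * gw [x] ^ ell)"
    by (rule icong_left[OF Cons.IH]) (use Cons in auto)
  finally show ?case by (simp add: gw_Cons[of y w] mult.assoc)
qed simp

lemma power_ell_mult_central_word:
  assumes "x \<in> letters n" "set w \<subseteq> letters n"
  shows "gw [x] ^ (ell * k) * gw w \<approx> gw w * gw [x] ^ (ell * k)"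
  using icong_power_commute[of _ "gw [x] ^ ell" "gw w" 1 k] power_ell_central_word[OF assms]
  by (simp add: power_mult)

text \<open>Only a diagonal pair leaves a correction word, and this anti-diagonal word is
  lighter.\<close>

lemma swap_lower:
  assumes "x \<in> letters n" "y \<in> letters n"
  shows "\<exists>a. gw [x, y] - sc ([:0, 1:] ^ a) * gw [y, x] \<in> lower ell n (mu [x, y])"
proof -
  have diag: "tt i k * tt j l - tt j l * tt i k \<in> lower ell n (i * k + j * l)"
    if "i < j" "k < l" and ijkl: "i \<in> {1..n}" "j \<in> {1..n}" "k \<in> {1..n}" "l \<in> {1..n}" for i j k l
  proof -
    let ?s = "sc ([:0, 1:] ^ 2 - 1)"
    have "tt i k * tt j l \<approx> qinv * (qq * (tt i k * tt j l))"
      by (rule icong_sym[OF qinv_cancel])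
    also have "\<dots> \<approx> qinv * (qq * (tt j l * tt i k) + ?s * (tt i l * tt j k))"
      by (intro icong_left diag_rel that)
    also have "\<dots> = qinv * (qq * (tt j l * tt i k)) + qinv * ?s * (tt i l * tt j k)"
      by (simp only: distrib_left mult.assoc)
    also have "\<dots> \<approx> tt j l * tt i k + qinv * ?s * (tt i l * tt j k)"
      by (intro icong_add qinv_cancel icong_refl)
    finally have 1: "tt i k * tt j l - (tt j l * tt i k + qinv * ?s * (tt i l * tt j k)) \<in> lower ell n (i * k + j * l)"
      unfolding icong_def by (rule lower.ideal)
    \<comment> \<open>The two sides differ by (j - i)(l - k).\<close>
    have "i * l + j * k < i * k + j * l"
    proof -
      obtain d e where "j = i + Suc d" "l = k + Suc e" using \<open>i < j\<close> \<open>k < l\<close> by (metis less_imp_Suc_add add_Suc_right)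
      thus ?thesis by (simp add: algebra_simps)
    qed
    hence "gw [T i l, T j k] \<in> lower ell n (i * k + j * l)"
      using ijkl by (intro lower.word) auto
    hence "sc ([:0, 1:] ^ (ell - 1) * ([:0, 1:] ^ 2 - 1)) * gw [T i l, T j k] \<in> lower ell n (i * k + j * l)"
      by (rule lower.scal)
    hence "qinv * ?s * (tt i l * tt j k) \<in> lower ell n (i * k + j * l)"
      by (simp only: sc_mult gw_mult append.simps)
    from lower.add[OF 1 this] show ?thesis by simp
  qed
  \<comment> \<open>\<open>lower\<close> has no rule for negation, but -1 is a scalar.\<close>
  have neg: "u \<in> lower ell n m \<Longrightarrow> - u \<in> lower ell n m" for u m
    using lower.scal[of u ell n m "- 1"] sc_diff[of 0 1] by simp
  consider "diagonal x y" | "diagonal y x" | "\<not> diagonal x y" "\<not> diagonal y x" by blast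
  thus ?thesis
  proof cases
    case 1
    then obtain i j k l where "x = T i k" "y = T j l" "i < j" "k < l" by (auto simp: diagonal_def)
    with diag[of i j k l] assms show ?thesis by (intro exI[of _ 0]) (auto simp: gw_mult)
  next
    case 2
    then obtain i j k l where "y = T i k" "x = T j l" "i < j" "k < l" by (auto simp: diagonal_def)
    with neg[OF diag[of i j k l]] assms show ?thesis
      by (intro exI[of _ 0]) (auto simp: gw_mult add.commute)
  next
    case 3
    from letters_commute[OF assms 3] show ?thesis
      by (auto simp: gw_mult icong_def intro: lower.ideal)
  qed
qed

lemma lower_trans:
  assumes "x - sc ([:0, 1:] ^ a) * y \<in> lower ell n m" "y - sc ([:0, 1:] ^ b) * z \<in> lower ell n m"
  shows "x - sc ([:0, 1:] ^ (a + b)) * z \<in> lower ell n m"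
proof -
  have "x - sc ([:0, 1:] ^ a) * y + sc ([:0, 1:] ^ a) * (y - sc ([:0, 1:] ^ b) * z) \<in> lower ell n m"
    by (intro lower.add lower.scal assms)
  thus ?thesis by (simp add: right_diff_distrib power_add sc_mult mult.assoc)
qed

lemma lower_context:
  assumes "gw v - sc c * gw w \<in> lower ell n (mu v)" "set u \<subseteq> letters n" "set u' \<subseteq> letters n"
  shows "gw (u @ v @ u') - sc c * gw (u @ w @ u') \<in> lower ell n (mu (u @ v @ u'))"
proof -
  have "gw u * (gw v - sc c * gw w) * gw u' \<in> lower ell n (mu u + mu v + mu u')"
    by (rule lower_words[OF assms])
  thus ?thesis
    by (simp add: left_diff_distrib right_diff_distrib sc_left_commute[of "gw _"] gw_mult mult.assoc add.assoc)
qed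

text \<open>Exchanging letters does not change the weight of a word, so the errors of all swaps stay
  below the same bound.\<close>

lemma move_lower:
  assumes "x \<in> letters n" "set v \<subseteq> letters n"
  shows "\<exists>a. gw (x # v) - sc ([:0, 1:] ^ a) * gw (v @ [x]) \<in> lower ell n (mu (x # v))"
  using assms(2)
proof (induction v)
  case Nil
  show ?case by (rule exI[of _ 0]) (simp add: lower.ideal tideal.zero)
next
  case (Cons y v)
  from swap_lower[of x y] obtain a
    where "gw [x, y] - sc ([:0, 1:] ^ a) * gw [y, x] \<in> lower ell n (mu [x, y])"
    using assms(1) Cons by auto
  from lower_context[OF this, of "[]" v]
  have 1: "gw (x # y # v) - sc ([:0, 1:] ^ a) * gw (y # x # v) \<in> lower ell n (mu (x # y # v))"
    using Cons by (simp add: add.assoc)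
  from Cons obtain b where "gw (x # v) - sc ([:0, 1:] ^ b) * gw (v @ [x]) \<in> lower ell n (mu (x # v))"
    by auto
  from lower_context[OF this, of "[y]" "[]"]
  have "gw (y # x # v) - sc ([:0, 1:] ^ b) * gw (y # v @ [x]) \<in> lower ell n (mu (x # y # v))"
    using Cons by (simp add: add.left_commute)
  from lower_trans[OF 1 this] show ?case by auto
qed

text \<open>The first letter of \<open>u\<close> is located in \<open>v\<close> and moved there past
  the letters before it. As the arrangement \<open>v\<close> is arbitrary, this serves every total
  order of the generators.\<close>

lemma perm_lower:
  assumes "mset u = mset v" "set u \<subseteq> letters n"
  shows "\<exists>a. gw u - sc ([:0, 1:] ^ a) * gw v \<in> lower ell n (mu u)"
  using assms
proof (induction u arbitrary: v)
  case Nil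
  thus ?case by (intro exI[of _ 0]) (simp add: lower.ideal tideal.zero)
next
  case (Cons x u)
  have "x \<in> set v" using Cons.prems by (metis list.set_intros(1) mset_eq_setD)
  then obtain v1 v2 where v: "v = v1 @ x # v2" by (meson split_list)
  hence uv: "mset u = mset (v1 @ v2)" using Cons.prems by simp
  have sets: "set (v1 @ v2) \<subseteq> letters n" "x \<in> letters n"
    using Cons.prems mset_eq_setD[OF uv] by auto
  from Cons.IH[OF uv] obtain a where "gw u - sc ([:0, 1:] ^ a) * gw (v1 @ v2) \<in> lower ell n (mu u)"
    using Cons.prems by auto
  from lower_context[OF this, of "[x]" "[]"]
  have 1: "gw (x # u) - sc ([:0, 1:] ^ a) * gw (x # v1 @ v2) \<in> lower ell n (mu (x # u))"
    using sets by simp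
  have mu: "mu u = mu v1 + mu v2"
    using arg_cong[OF uv, of "\<lambda>M. sum_mset (image_mset wt M)"] by (simp add: sum_mset_sum_list flip: mset_map)
  from move_lower[of x v1] sets obtain b
    where "gw (x # v1) - sc ([:0, 1:] ^ b) * gw (v1 @ [x]) \<in> lower ell n (mu (x # v1))" by auto
  from lower_context[OF this, of "[]" v2]
  have "gw (x # v1 @ v2) - sc ([:0, 1:] ^ b) * gw v \<in> lower ell n (mu (x # u))"
    using sets by (simp add: v mu add.assoc)
  from lower_trans[OF 1 this] show ?case by blast
qed

end

section \<open>Spanning\<close>

lemma finite_expset: "finite (expset ell n)"
proof (rule finite_subset)
  show "expset ell n \<subseteq> {f. \<forall>p. (p \<in> {1..n} \<times> {1..n} \<longrightarrow> f p \<in> {..<ell}) \<and> (p \<notin> {1..n} \<times> {1..n} \<longrightarrow> f p = 0)}"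
    by (auto simp: expset_def)
  show "finite {f. \<forall>p. (p \<in> {1..n} \<times> {1..n} \<longrightarrow> f p \<in> {..<ell}) \<and> (p \<notin> {1..n} \<times> {1..n} \<longrightarrow> f p = (0::nat))}"
    by (rule finite_set_of_finite_funs) auto
qed

lemma card_expset:
  assumes "ell > 0"
  shows "card (expset ell n) = ell ^ (n ^ 2)"
proof -
  let ?A = "{1..n} \<times> {1..n}"
  have "bij_betw (\<lambda>f. restrict f ?A) (expset ell n) (?A \<rightarrow>\<^sub>E {..<ell})"
  proof (rule bij_betw_byWitness[where f' = "\<lambda>f p. if p \<in> ?A then f p else 0"])
    show "(\<lambda>f p. if p \<in> ?A then f p else 0) ` (?A \<rightarrow>\<^sub>E {..<ell}) \<subseteq> expset ell n"
      using assms by (auto simp: expset_def PiE_iff)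
  qed (auto simp: expset_def restrict_def fun_eq_iff PiE_iff extensional_def split: if_splits)
  from bij_betw_same_card[OF this] show ?thesis
    by (simp add: card_funcsetE card_cartesian_product power2_eq_square)
qed

section \<open>The Frobenius map on polynomial representatives\<close>

lemma frob_superset:
  assumes "finite A" "Poly_Mapping.keys c \<subseteq> A"
  shows "frob ell ps c = (\<Sum>m\<in>A. sc (Poly_Mapping.lookup c m) * omon ps (\<lambda>p. ell * Poly_Mapping.lookup m p))"
  unfolding frob_def by (rule sum.mono_neutral_left) (use assms in \<open>auto simp: in_keys_iff\<close>)

lemma frob_0 [simp]: "frob ell ps 0 = 0"
  by (simp add: frob_def)

lemma frob_add: "frob ell ps (c + d) = frob ell ps c + frob ell ps d"
proof -
  let ?A = "Poly_Mapping.keys c \<union> Poly_Mapping.keys d"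
  have "Poly_Mapping.keys (c + d) \<subseteq> ?A" by (rule keys_add)
  thus ?thesis
    by (simp add: frob_superset[of ?A] lookup_add sc_add distrib_right sum.distrib)
qed

lemma frob_scale: "frob ell ps (Poly_Mapping.map ((*) s) c) = sc s * frob ell ps c"
proof -
  have "Poly_Mapping.keys (Poly_Mapping.map ((*) s) c) \<subseteq> Poly_Mapping.keys c"
    by (auto simp: in_keys_iff Poly_Mapping.map.rep_eq)
  moreover have "Poly_Mapping.lookup (Poly_Mapping.map ((*) s) c) m = s * Poly_Mapping.lookup c m" for m
    by (simp add: Poly_Mapping.map.rep_eq when_def)
  ultimately show ?thesis
    by (simp add: frob_superset[of "Poly_Mapping.keys c"] sum_distrib_left sc_mult mult.assoc)
qed

lemma frob_single: "frob ell ps (Poly_Mapping.single m 1) = omon ps (\<lambda>p. ell * Poly_Mapping.lookup m p)"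
  by (simp add: frob_def)

lemma validM_0: "validM n 0"
  and validM_add: "validM n c \<Longrightarrow> validM n d \<Longrightarrow> validM n (c + d)"
  and validM_scale: "validM n c \<Longrightarrow> validM n (Poly_Mapping.map ((*) s) c)"
  unfolding validM_def using keys_add[of c d]
  by (auto simp: in_keys_iff Poly_Mapping.map.rep_eq)

lemma omon_Nil [simp]: "omon [] A = 1"
  by (simp add: omon_def)

lemma omon_Cons: "omon (p # ps) A = gw [case_prod T p] ^ A p * omon ps A"
  by (simp add: omon_def gw_replicate split_def flip: gw_mult)

lemma omon_cong: "(\<And>p. p \<in> set ps \<Longrightarrow> A p = B p) \<Longrightarrow> omon ps A = omon ps B"
  by (induction ps) (simp_all add: omon_Cons)

text \<open>Supplies the multiset hypothesis of \<open>perm_lower\<close>, with the letter counts of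
  \<open>u\<close> as exponents of the ordered monomial.\<close>

lemma mset_omon:
  assumes "distinct ps" "set u \<subseteq> (\<lambda>(i, j). T i j) ` set ps"
  shows "mset (concat (map (\<lambda>(i, j). replicate (count (mset u) (T i j)) (T i j)) ps)) = mset u"
proof (rule multiset_eqI)
  fix x
  let ?f = "\<lambda>(i, j). replicate (count (mset u) (T i j)) (T i j)"
  have "count (mset (concat (map ?f ps))) x = (\<Sum>p\<leftarrow>ps. count (mset (?f p)) x)"
    by (induction ps) simp_all
  also have "\<dots> = (\<Sum>p\<in>set ps. count (mset (?f p)) x)"
    using assms(1) by (simp add: sum_list_distinct_conv_sum_set)
  also have "\<dots> = (\<Sum>p\<in>set ps. if case_prod T p = x then count (mset u) x else 0)"
    by (intro sum.cong) auto
  also have "\<dots> = count (mset u) x"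
  proof (cases "x \<in> case_prod T ` set ps")
    case True
    then obtain p where p: "p \<in> set ps" "x = case_prod T p" by auto
    have "(\<Sum>p'\<in>set ps. if case_prod T p' = x then count (mset u) x else 0)
        = (\<Sum>p'\<in>set ps. if p' = p then count (mset u) x else 0)"
      by (intro sum.cong) (auto simp: p(2) split: prod.splits)
    thus ?thesis using p(1) by simp
  next
    case False
    hence "x \<notin> set u" using assms(2) by (auto simp: case_prod_unfold)
    hence "count (mset u) x = 0" by (simp add: count_eq_zero_iff)
    thus ?thesis by (simp only: if_cancel sum.neutral_const)
  qed
  finally show "count (mset (concat (map ?f ps))) x = count (mset u) x" .
qed

section \<open>The free subalgebra on the matrix entries\<close>

lemma in_freeM_0: "in_freeM n 0"
  by (simp add: in_freeM_def)

lemma in_freeM_add: "in_freeM n x \<Longrightarrow> in_freeM n y \<Longrightarrow> in_freeM n (x + y)"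
  unfolding in_freeM_def using keys_add[of x y] by blast

lemma in_freeM_sum: "(\<And>a. a \<in> A \<Longrightarrow> in_freeM n (f a)) \<Longrightarrow> in_freeM n (sum f A)"
  by (induction A rule: infinite_finite_induct) (auto intro: in_freeM_0 in_freeM_add)

lemma in_freeM_mult: 
  assumes "in_freeM n x" "in_freeM n y"
  shows "in_freeM n (x * y)"
  unfolding in_freeM_def
proof (intro allI impI)
  fix w assume "Wd w \<in> Poly_Mapping.keys (x * y)"
  then obtain a b where ab: "Wd w = a + b" "a \<in> Poly_Mapping.keys x" "b \<in> Poly_Mapping.keys y"
    using keys_mult[of x y] by blast
  obtain u v where uv: "a = Wd u" "b = Wd v" by (cases a, cases b) auto
  hence "set u \<subseteq> letters n" "set v \<subseteq> letters n" using ab assms unfolding in_freeM_def by blast+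
  moreover have "w = u @ v" using ab(1) uv by simp
  ultimately show "set w \<subseteq> letters n" by simp
qed

lemma in_freeM_gw: "set w \<subseteq> letters n \<Longrightarrow> in_freeM n (gw w)"
  by (auto simp: in_freeM_def gw_def)

lemma in_freeM_sc: "in_freeM n (sc c)"
  by (auto simp: in_freeM_def sc_def split: if_splits)

lemma in_freeM_1: "in_freeM n 1"
  using in_freeM_sc[of n 1] by simp

lemma in_freeM_power: "in_freeM n x \<Longrightarrow> in_freeM n (x ^ k)"
  by (induction k) (simp_all add: in_freeM_1 in_freeM_mult)

text \<open>Lets numerators be multiplied by powers of D without leaving the free algebra on the
  entries.\<close>

lemma in_freeM_qdet: "in_freeM n (qdet n)"
  unfolding qdet_def
proof (intro in_freeM_sum in_freeM_mult in_freeM_sc in_freeM_gw)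
  fix \<sigma> assume "\<sigma> \<in> {\<sigma>. \<sigma> permutes {1..n}}"
  hence \<sigma>: "\<sigma> permutes {1..n}" by simp
  show "set (map (\<lambda>i. T i (\<sigma> i)) [1..<n + 1]) \<subseteq> letters n"
  proof
    fix x assume "x \<in> set (map (\<lambda>i. T i (\<sigma> i)) [1..<n + 1])"
    then obtain i where i: "i \<in> {1..n}" "x = T i (\<sigma> i)" by auto
    from i(1) have "\<sigma> i \<in> {1..n}" by (simp only: permutes_in_image[OF \<sigma>])
    with i show "x \<in> letters n" by blast
  qed
qed

locale qmatrix_order = qmatrix +
  fixes ps :: "(nat \<times> nat) list"
  assumes ps: "distinct ps" "set ps = {1..n} \<times> {1..n}"
begin

lemma omon_word:
  assumes "set qs \<subseteq> set ps"
  shows "\<exists>w. omon qs A = gw w \<and> set w \<subseteq> letters n"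
proof (intro exI conjI)
  show "omon qs A = gw (concat (map (\<lambda>(i, j). replicate (A (i, j)) (T i j)) qs))"
    by (simp add: omon_def)
  show "set (concat (map (\<lambda>(i, j). replicate (A (i, j)) (T i j)) qs)) \<subseteq> letters n"
  proof
    fix x assume "x \<in> set (concat (map (\<lambda>(i, j). replicate (A (i, j)) (T i j)) qs))"
    then obtain i j where "(i, j) \<in> set qs" "x = T i j" by (auto simp: in_set_replicate)
    moreover from this assms ps(2) have "i \<in> {1..n}" "j \<in> {1..n}" by auto
    ultimately show "x \<in> letters n" by blast
  qed
qed

lemma omon_ell_central:
  assumes "set qs \<subseteq> set ps" "set u \<subseteq> letters n"
  shows "gw u * omon qs (\<lambda>p. ell * m p) \<approx> omon qs (\<lambda>p. ell * m p) * gw u"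
  using assms(1)
proof (induction qs)
  case (Cons r rs)
  let ?z = "gw [case_prod T r] ^ (ell * m r)"
  have "gw u * omon (r # rs) (\<lambda>p. ell * m p) = gw u * ?z * omon rs (\<lambda>p. ell * m p)"
    by (simp add: omon_Cons mult.assoc)
  also have "\<dots> \<approx> ?z * gw u * omon rs (\<lambda>p. ell * m p)"
    using Cons.prems ps(2) assms(2)
    by (intro icong_right icong_sym[OF power_ell_mult_central_word]) auto
  also have "\<dots> = ?z * (gw u * omon rs (\<lambda>p. ell * m p))" by (simp add: mult.assoc)
  also have "\<dots> \<approx> ?z * (omon rs (\<lambda>p. ell * m p) * gw u)"
    by (intro icong_left Cons.IH) (use Cons.prems in auto)
  finally show ?case by (simp add: omon_Cons mult.assoc)
qed simp

text \<open>By centrality the ell-th powers of later letters move left across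
  \<open>?x ^ N p\<close>.\<close>

lemma omon_split:
  assumes "set qs \<subseteq> set ps"
  shows "omon qs (\<lambda>p. ell * m p + N p) \<approx> omon qs (\<lambda>p. ell * m p) * omon qs N"
  using assms
proof (induction qs)
  case (Cons p qs)
  let ?x = "gw [case_prod T p]"
  let ?M = "omon qs (\<lambda>p. ell * m p)"
  have comm: "?x ^ N p * ?M \<approx> ?M * ?x ^ N p"
    unfolding gw_replicate[symmetric] using Cons.prems ps(2)
    by (intro omon_ell_central) (auto simp: set_replicate_conv_if)
  have "omon (p # qs) (\<lambda>p. ell * m p + N p) = ?x ^ (ell * m p) * ?x ^ N p * omon qs (\<lambda>p. ell * m p + N p)"
    by (simp add: omon_Cons power_add)
  also have "\<dots> \<approx> ?x ^ (ell * m p) * ?x ^ N p * (?M * omon qs N)"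
    using Cons by (intro icong_left) auto
  also have "\<dots> = ?x ^ (ell * m p) * (?x ^ N p * ?M) * omon qs N" by (simp add: mult.assoc)
  also have "\<dots> \<approx> ?x ^ (ell * m p) * (?M * ?x ^ N p) * omon qs N"
    by (intro icong_right icong_left comm)
  finally show ?case by (simp add: omon_Cons mult.assoc)
qed simp

definition spanned :: "fa set" where
  "spanned = {x. \<exists>c. (\<forall>N\<in>expset ell n. validM n (c N)) \<and>
      x \<approx> (\<Sum>N\<in>expset ell n. frob ell ps (c N) * omon ps N)}"

lemma spannedI:
  "(\<And>N. N \<in> expset ell n \<Longrightarrow> validM n (c N)) \<Longrightarrow> x \<approx> (\<Sum>N\<in>expset ell n. frob ell ps (c N) * omon ps N)
    \<Longrightarrow> x \<in> spanned"
  by (auto simp: spanned_def)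

lemma spanned_add:
  assumes "x \<in> spanned" "y \<in> spanned"
  shows "x + y \<in> spanned"
proof -
  obtain c where c: "\<forall>N\<in>expset ell n. validM n (c N)" "x \<approx> (\<Sum>N\<in>expset ell n. frob ell ps (c N) * omon ps N)"
    using assms by (auto simp: spanned_def)
  obtain d where d: "\<forall>N\<in>expset ell n. validM n (d N)" "y \<approx> (\<Sum>N\<in>expset ell n. frob ell ps (d N) * omon ps N)"
    using assms by (auto simp: spanned_def)
  from icong_add[OF c(2) d(2)] show ?thesis
    by (intro spannedI[of "\<lambda>N. c N + d N"])
       (use c d in \<open>auto simp: frob_add distrib_right sum.distrib intro: validM_add\<close>)
qed

lemma spanned_scale:
  assumes "x \<in> spanned"
  shows "sc s * x \<in> spanned"
proof -
  obtain c where c: "\<forall>N\<in>expset ell n. validM n (c N)" "x \<approx> (\<Sum>N\<in>expset ell n. frob ell ps (c N) * omon ps N)"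
    using assms by (auto simp: spanned_def)
  from icong_left[OF c(2), of "sc s"] show ?thesis
    by (intro spannedI[of "\<lambda>N. Poly_Mapping.map ((*) s) (c N)"])
       (use c in \<open>auto simp: frob_scale sum_distrib_left mult.assoc intro: validM_scale\<close>)
qed

lemma spanned_cong: "x \<approx> y \<Longrightarrow> y \<in> spanned \<Longrightarrow> x \<in> spanned"
  unfolding spanned_def by (blast intro: icong_trans)

lemma spanned_0: "0 \<in> spanned"
  by (rule spannedI[of "\<lambda>_. 0"]) (simp_all add: validM_0)

lemma spanned_omon: "omon ps A \<in> spanned"
proof -
  let ?S = "{1..n} \<times> {1..n}"
  \<comment> \<open>Division with remainder by ell: quotients go to the Frobenius image, remainders
    to the restricted monomial. Outside the index square both are 0, as \<open>validM\<close> and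
    \<open>expset\<close> demand.\<close>
  define N where "N = (\<lambda>p. if p \<in> ?S then A p mod ell else 0)"
  define m where "m = Abs_poly_mapping (\<lambda>p. if p \<in> ?S then A p div ell else 0)"
  have "finite {p. (if p \<in> ?S then A p div ell else 0) \<noteq> 0}"
    by (rule finite_subset[of _ ?S]) (auto split: if_splits)
  hence m: "Poly_Mapping.lookup m = (\<lambda>p. if p \<in> ?S then A p div ell else 0)"
    unfolding m_def by simp
  hence km: "Poly_Mapping.keys m \<subseteq> ?S" by (auto simp: in_keys_iff split: if_splits)
  have N: "N \<in> expset ell n" using ell_pos by (auto simp: expset_def N_def)
  have "omon ps A = omon ps (\<lambda>p. ell * Poly_Mapping.lookup m p + N p)"
    by (rule omon_cong) (auto simp: ps(2) m N_def)
  also have "\<dots> \<approx> omon ps (\<lambda>p. ell * Poly_Mapping.lookup m p) * omon ps N"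
    by (rule omon_split) simp
  also have "\<dots> = (\<Sum>N'\<in>expset ell n. if N' = N then frob ell ps (Poly_Mapping.single m 1) * omon ps N' else 0)"
    using N finite_expset by (simp add: frob_single)
  also have "\<dots> = (\<Sum>N'\<in>expset ell n. frob ell ps (if N' = N then Poly_Mapping.single m 1 else 0) * omon ps N')"
    by (rule sum.cong) auto
  finally show ?thesis
    by (rule spannedI[rotated]) (use km in \<open>auto simp: validM_def\<close>)
qed

text \<open>Strong induction on the weight: up to lighter words, \<open>w\<close> is a power of q
  times its ordered monomial.\<close>

lemma spanned_gw:
  assumes "set w \<subseteq> letters n"
  shows "gw w \<in> spanned"
  using assms
proof (induction "mu w" arbitrary: w rule: less_induct)
  case less
  have low: "x \<in> spanned" if "x \<in> lower ell n (mu w)" for x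
    using that
  proof induction
    case (word v)
    thus ?case using less.hyps by blast
  next
    case (ideal x)
    thus ?case using spanned_cong[OF _ spanned_0] by (simp add: icong_def)
  qed (auto intro: spanned_add spanned_scale)
  define A where "A = (\<lambda>(i, j). count (mset w) (T i j))"
  define v where "v = concat (map (\<lambda>(i, j). replicate (A (i, j)) (T i j)) ps)"
  have "set w \<subseteq> (\<lambda>(i, j). T i j) ` set ps"
    using less.prems by (force simp: ps(2))
  from mset_omon[OF ps(1) this] have "mset w = mset v" by (simp add: A_def v_def)
  from perm_lower[OF this less.prems] obtain a
    where a: "gw w - sc ([:0, 1:] ^ a) * gw v \<in> lower ell n (mu w)" by blast
  have "gw v = omon ps A" by (simp add: omon_def v_def)
  hence "gw v \<in> spanned" using spanned_omon by simp
  with low[OF a] have "(gw w - sc ([:0, 1:] ^ a) * gw v) + sc ([:0, 1:] ^ a) * gw v \<in> spanned"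
    by (intro spanned_add spanned_scale)
  thus ?case by simp
qed

lemma spanned_freeM: "in_freeM n x \<Longrightarrow> x \<in> spanned"
  by (rule fa_induct[of x])
     (unfold in_freeM_def, blast intro: spanned_scale spanned_gw, rule spanned_0, rule spanned_add)

section \<open>Fractions in O(GL_n)\<close>

abbreviation congGL (infix "\<approx>\<^sub>G" 50) where
  "x \<approx>\<^sub>G y \<equiv> icong (relsGL ell n) x y"

lemma cong_imp_congGL: "x \<approx> y \<Longrightarrow> x \<approx>\<^sub>G y"
  by (rule icong_mono) (auto simp: relsGL_def)

lemma relGLD: "x - y \<in> relsGL ell n \<Longrightarrow> x \<approx>\<^sub>G y"
  by (simp add: icong_def tideal.gen)

abbreviation zz :: fa where "zz \<equiv> gw [Z]"

lemma zz_commute_letter: "x \<in> letters n \<Longrightarrow> zz * gw [x] \<approx>\<^sub>G gw [x] * zz"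
  by (rule relGLD) (auto simp: relsGL_def)

lemma qdet_zz: "qdet n * zz \<approx>\<^sub>G 1"
  by (rule relGLD) (auto simp: relsGL_def)

lemma zz_commute_gw:
  assumes "set w \<subseteq> letters n"
  shows "zz * gw w \<approx>\<^sub>G gw w * zz"
  using assms
proof (induction w)
  case (Cons x w)
  have "zz * gw (x # w) = zz * gw [x] * gw w" by (simp add: gw_Cons[of x w] mult.assoc)
  also have "\<dots> \<approx>\<^sub>G gw [x] * zz * gw w"
    by (rule icong_right[OF zz_commute_letter]) (use Cons in auto)
  also have "\<dots> = gw [x] * (zz * gw w)" by (simp add: mult.assoc)
  also have "\<dots> \<approx>\<^sub>G gw [x] * (gw w * zz)" by (rule icong_left[OF Cons.IH]) (use Cons in auto)
  finally show ?case by (simp add: gw_Cons[of x w] mult.assoc)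
qed simp

lemma zz_commute:
  assumes "in_freeM n y"
  shows "zz * y \<approx>\<^sub>G y * zz"
proof (induction y rule: fa_induct)
  case (word c w)
  hence "sc c * (zz * gw w) \<approx>\<^sub>G sc c * (gw w * zz)"
    using assms by (intro icong_left zz_commute_gw) (auto simp: in_freeM_def)
  thus ?case by (simp add: sc_left_commute[of zz] mult.assoc)
qed (auto simp: distrib_left distrib_right intro: icong_add)

lemma zz_power_commute: "in_freeM n y \<Longrightarrow> zz ^ k * y \<approx>\<^sub>G y * zz ^ k"
  using icong_power_commute[of _ zz y 1 k] zz_commute[of y] by simp

lemma qdet_zz_power: "qdet n ^ j * zz ^ j \<approx>\<^sub>G 1"
proof (induction j)
  case (Suc j)
  have "qdet n ^ Suc j * zz ^ Suc j = qdet n * (qdet n ^ j * zz ^ j) * zz"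
    by (simp add: mult.assoc power_commutes)
  also have "\<dots> \<approx>\<^sub>G qdet n * 1 * zz" by (intro icong_right icong_left Suc)
  also have "\<dots> \<approx>\<^sub>G 1" using qdet_zz by simp
  finally show ?case .
qed simp

text \<open>Expanding a fraction by D^j, in order to reach a common exponent of \<open>Z\<close> or
  one divisible by ell.\<close>

lemma zz_power_expand: "y * zz ^ k \<approx>\<^sub>G y * qdet n ^ j * zz ^ (j + k)"
proof -
  have "y * (1 * zz ^ k) \<approx>\<^sub>G y * (qdet n ^ j * zz ^ j * zz ^ k)"
    by (intro icong_left icong_right icong_sym[OF qdet_zz_power])
  thus ?thesis by (simp add: power_add mult.assoc)
qed

definition fractions :: "fa set" where
  "fractions = {x. \<exists>y k. in_freeM n y \<and> x \<approx>\<^sub>G y * zz ^ (ell * k)}"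

lemma fractions_add:
  assumes "x \<in> fractions" "x' \<in> fractions"
  shows "x + x' \<in> fractions"
proof -
  obtain y k where y: "in_freeM n y" "x \<approx>\<^sub>G y * zz ^ (ell * k)" using assms by (auto simp: fractions_def)
  obtain y' k' where y': "in_freeM n y'" "x' \<approx>\<^sub>G y' * zz ^ (ell * k')" using assms by (auto simp: fractions_def)
  have "x + x' \<approx>\<^sub>G y * qdet n ^ (ell * k') * zz ^ (ell * k' + ell * k)
      + y' * qdet n ^ (ell * k) * zz ^ (ell * k + ell * k')"
    by (intro icong_add icong_trans[OF y(2)] icong_trans[OF y'(2)] zz_power_expand)
  hence "x + x' \<approx>\<^sub>G (y * qdet n ^ (ell * k') + y' * qdet n ^ (ell * k)) * zz ^ (ell * (k + k'))"
    by (simp add: distrib_right distrib_left add.commute)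
  moreover have "in_freeM n (y * qdet n ^ (ell * k') + y' * qdet n ^ (ell * k))"
    by (intro in_freeM_add in_freeM_mult in_freeM_power in_freeM_qdet y y')
  ultimately show ?thesis unfolding fractions_def by blast
qed

lemma fractions_0: "0 \<in> fractions"
  unfolding fractions_def using in_freeM_0 by (auto intro!: exI[of _ "0 :: fa"])

lemma fractions_mult:
  assumes "in_freeM n a" "x \<in> fractions"
  shows "a * x \<in> fractions"
proof -
  obtain y k where y: "in_freeM n y" "x \<approx>\<^sub>G y * zz ^ (ell * k)" using assms by (auto simp: fractions_def)
  have "a * x \<approx>\<^sub>G a * y * zz ^ (ell * k)" using icong_left[OF y(2)] by (simp add: mult.assoc)
  thus ?thesis using in_freeM_mult[OF assms(1) y(1)] by (auto simp: fractions_def)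
qed

lemma fractions_zz:
  assumes "x \<in> fractions"
  shows "zz * x \<in> fractions"
proof -
  obtain y k where y: "in_freeM n y" "x \<approx>\<^sub>G y * zz ^ (ell * k)" using assms by (auto simp: fractions_def)
  have "zz * x \<approx>\<^sub>G zz * y * zz ^ (ell * k)" using icong_left[OF y(2)] by (simp add: mult.assoc)
  also have "\<dots> \<approx>\<^sub>G y * zz * zz ^ (ell * k)" by (intro icong_right zz_commute y)
  also have "\<dots> = y * zz ^ (Suc (ell * k))" by (simp add: mult.assoc)
  \<comment> \<open>Expanding by D^(ell-1) raises the exponent 1 + ell k to ell (k + 1).\<close>
  also have "\<dots> \<approx>\<^sub>G y * qdet n ^ (ell - 1) * zz ^ (ell - 1 + Suc (ell * k))" by (rule zz_power_expand)
  also have "ell - 1 + Suc (ell * k) = ell * Suc k" using ell_pos by simp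
  finally show ?thesis
    using in_freeM_mult[OF y(1) in_freeM_power[OF in_freeM_qdet]] unfolding fractions_def by blast
qed

lemma fractions_freeGL:
  assumes "in_freeGL n x"
  shows "x \<in> fractions"
proof -
  have words: "gw w \<in> fractions" if "set w \<subseteq> insert Z (letters n)" for w
    using that
  proof (induction w)
    case Nil
    show ?case unfolding fractions_def using in_freeM_1[of n]
      by (auto intro!: exI[of _ "1 :: fa"] exI[of _ "0 :: nat"])
  next
    case (Cons y w)
    thus ?case unfolding gw_Cons[of y w]
      by (cases "y = Z") (auto intro!: fractions_zz fractions_mult in_freeM_gw)
  qed
  show ?thesis
  proof (rule fa_induct[of x])
    fix c w assume "Wd w \<in> Poly_Mapping.keys x"
    hence "set w \<subseteq> insert Z (letters n)" using assms unfolding in_freeGL_def by blast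
    thus "sc c * gw w \<in> fractions" by (intro fractions_mult in_freeM_sc words)
  qed (auto intro: fractions_0 fractions_add)
qed

lemma spanning_GL:
  assumes "in_freeGL n x"
  shows "\<exists>c k. (\<forall>N\<in>expset ell n. validM n (c N)) \<and>
     x \<approx>\<^sub>G (\<Sum>N\<in>expset ell n. frobGL ell ps (c N) (k N) * omon ps N)"
proof -
  from fractions_freeGL[OF assms] obtain y k
    where y: "in_freeM n y" "x \<approx>\<^sub>G y * zz ^ (ell * k)" by (auto simp: fractions_def)
  from spanned_freeM[OF y(1)] obtain c where c: "\<forall>N\<in>expset ell n. validM n (c N)"
    "y \<approx> (\<Sum>N\<in>expset ell n. frob ell ps (c N) * omon ps N)" by (auto simp: spanned_def)
  note y(2)
  also have "y * zz ^ (ell * k) \<approx>\<^sub>G (\<Sum>N\<in>expset ell n. frob ell ps (c N) * omon ps N) * zz ^ (ell * k)"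
    by (intro icong_right cong_imp_congGL c)
  also have "\<dots> = (\<Sum>N\<in>expset ell n. frob ell ps (c N) * (omon ps N * zz ^ (ell * k)))"
    by (simp add: sum_distrib_right mult.assoc)
  \<comment> \<open>In \<open>frobGL\<close> the power of \<open>Z\<close> belongs to the
    coefficient, so it has to stand to the left of the monomial.\<close>
  also have "\<dots> \<approx>\<^sub>G (\<Sum>N\<in>expset ell n. frob ell ps (c N) * (zz ^ (ell * k) * omon ps N))"
  proof (intro icong_sum icong_left icong_sym[OF zz_power_commute])
    fix N show "in_freeM n (omon ps N)" using omon_word[of ps N] in_freeM_gw by auto
  qed
  finally have "x \<approx>\<^sub>G (\<Sum>N\<in>expset ell n. frobGL ell ps (c N) k * omon ps N)"
    by (simp add: frobGL_def gw_replicate mult.assoc)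
  with c(1) show ?thesis by (intro exI[of _ c] exI[of _ "\<lambda>_. k"]) auto
qed

end

section \<open>Quantum determinants\<close>

text \<open>The transposition keeps the order of every pair of positions except (i, i+1), so it
  carries inversions to inversions and only this pair is new. The map \<open>f\<close> is arbitrary,
  since choices of rows have to be sorted and not only permutations.\<close>

lemma perm_length_transpose:
  assumes "1 \<le> i" "i < n" "f i < f (Suc i)"
  shows "perm_length n (f \<circ> transpose i (Suc i)) = Suc (perm_length n f)"
proof -
  let ?s = "transpose i (Suc i)"
  let ?I = "\<lambda>f. {(a, b). 1 \<le> a \<and> a < b \<and> b \<le> n \<and> f b < f a}"
  have fin: "finite (?I g)" for g :: "nat \<Rightarrow> nat"
    by (rule finite_subset[of _ "{1..n} \<times> {1..n}"]) auto
  have mono: "?s a < ?s b" "1 \<le> ?s a" "?s b \<le> n" if "1 \<le> a" "a < b" "b \<le> n" "(a, b) \<noteq> (i, Suc i)" for a b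
    using that assms by (auto simp: transpose_def)
  have "?I (f \<circ> ?s) = insert (i, Suc i) (map_prod ?s ?s ` ?I f)"
  proof (intro equalityI subsetI)
    fix x assume x: "x \<in> ?I (f \<circ> ?s)"
    obtain a b where ab: "x = (a, b)" by fastforce
    show "x \<in> insert (i, Suc i) (map_prod ?s ?s ` ?I f)"
    proof (cases "x = (i, Suc i)")
      case False
      hence "(?s a, ?s b) \<in> ?I f" using x mono[of a b] by (simp add: ab)
      hence "map_prod ?s ?s (?s a, ?s b) \<in> map_prod ?s ?s ` ?I f" by (rule imageI)
      thus ?thesis by (simp add: ab)
    qed simp
  next
    fix x assume "x \<in> insert (i, Suc i) (map_prod ?s ?s ` ?I f)"
    then consider "x = (i, Suc i)" | a b where "x = (?s a, ?s b)" "(a, b) \<in> ?I f" by auto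
    thus "x \<in> ?I (f \<circ> ?s)"
    proof cases
      case 1
      thus ?thesis using assms by simp
    next
      case 2
      moreover from this assms have "(a, b) \<noteq> (i, Suc i)" by auto
      ultimately show ?thesis using mono[of a b] by simp
    qed
  qed
  moreover have "(i, Suc i) \<notin> map_prod ?s ?s ` ?I f"
  proof
    assume "(i, Suc i) \<in> map_prod ?s ?s ` ?I f"
    then obtain a b where "(a, b) \<in> ?I f" "?s a = i" "?s b = Suc i" by auto
    hence "a = Suc i" "b = i" "a < b" by (auto simp: transpose_eq_iff)
    thus False by simp
  qed
  moreover have "inj_on (map_prod ?s ?s) (?I f)"
    by (rule inj_on_subset[OF prod.inj_map]) auto
  ultimately show ?thesis
    unfolding perm_length_def using fin by (simp add: card_image)
qed

text \<open>Growth from 1 upwards gives \<open>j \<le> f j\<close>, descent from n gives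
  \<open>f j \<le> j\<close>. This is the end point of the sorting in \<open>qdf_eq\<close>.\<close>

lemma strictly_increasing_le:
  fixes f :: "nat \<Rightarrow> nat"
  assumes "\<And>i. 1 \<le> i \<Longrightarrow> i < n \<Longrightarrow> f i < f (Suc i)" "f ` {1..n} \<subseteq> {1..n}" "i \<in> {1..n}"
  shows "f i = i"
proof -
  have lower: "j \<le> f j" if "j \<in> {1..n}" for j
    using that
  proof (induction j)
    case (Suc j)
    show ?case
    proof (cases "j = 0")
      case True
      thus ?thesis using Suc.prems assms(2) by force
    next
      case False
      thus ?thesis using Suc assms(1)[of j] by auto
    qed
  qed simp
  have "f (n - d) \<le> n - d" if "d < n" for d
    using that
  proof (induction d)
    case 0
    thus ?case using assms(2) by (auto simp: image_subset_iff)
  next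
    case (Suc d)
    hence "f (n - Suc d) < f (Suc (n - Suc d))" by (intro assms(1)) auto
    also have "Suc (n - Suc d) = n - d" using Suc by simp
    also have "f (n - d) \<le> n - d" using Suc by simp
    finally show ?case by simp
  qed
  from this[of "n - i"] lower[of i] assms(3) show ?thesis by auto
qed

text \<open>The ring is noncommutative, so the expansion keeps the factors in list order.\<close>

lemma prod_list_sum_distrib:
  fixes g :: "'b \<Rightarrow> 'c \<Rightarrow> 'a::ring_1"
  assumes "distinct xs" "finite S"
  shows "prod_list (map (\<lambda>i. \<Sum>k\<in>S. g i k) xs) = (\<Sum>f\<in>set xs \<rightarrow>\<^sub>E S. prod_list (map (\<lambda>i. g i (f i)) xs))"
  using assms(1)
proof (induction xs)
  case (Cons x xs)
  let ?P = "set xs \<rightarrow>\<^sub>E S"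
  have "(\<Sum>f\<in>set (x # xs) \<rightarrow>\<^sub>E S. prod_list (map (\<lambda>i. g i (f i)) (x # xs)))
      = (\<Sum>f\<in>(\<lambda>(y, h). h(x := y)) ` (S \<times> ?P). prod_list (map (\<lambda>i. g i (f i)) (x # xs)))"
    by (simp add: PiE_insert_eq)
  also have "\<dots> = (\<Sum>(y, h)\<in>S \<times> ?P. g x y * prod_list (map (\<lambda>i. g i (h i)) xs))"
  proof (subst sum.reindex)
    show "inj_on (\<lambda>(y, h). h(x := y)) (S \<times> ?P)"
      using Cons.prems by (intro inj_combinator) auto
    have "map (\<lambda>i. g i ((h(x := y)) i)) xs = map (\<lambda>i. g i (h i)) xs" for h y
      using Cons.prems by (intro map_cong) auto
    hence "prod_list (map (\<lambda>i. g i ((h(x := y)) i)) (x # xs)) = g x y * prod_list (map (\<lambda>i. g i (h i)) xs)" for h y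
      by (simp only: list.map prod_list.Cons fun_upd_same)
    thus "sum ((\<lambda>f. prod_list (map (\<lambda>i. g i (f i)) (x # xs))) \<circ> (\<lambda>(y, h). h(x := y))) (S \<times> ?P)
        = (\<Sum>(y, h)\<in>S \<times> ?P. g x y * prod_list (map (\<lambda>i. g i (h i)) xs))"
      by (simp only: o_def case_prod_unfold)
  qed
  also have "\<dots> = (\<Sum>k\<in>S. g x k) * (\<Sum>h\<in>?P. prod_list (map (\<lambda>i. g i (h i)) xs))"
    by (simp add: sum_product sum.cartesian_product)
  finally show ?case using Cons by simp
qed simp

lemma commute_prod_list:
  fixes x :: "'a::ring_1"
  shows "(\<And>y. y \<in> set ys \<Longrightarrow> x * y = y * x) \<Longrightarrow> x * prod_list ys = prod_list ys * x"
proof (induction ys)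
  case (Cons y ys)
  have "x * (y * prod_list ys) = y * (x * prod_list ys)"
    using Cons.prems by (simp flip: mult.assoc)
  also have "\<dots> = y * prod_list ys * x" using Cons by (simp add: mult.assoc)
  finally show ?case by simp
qed simp

lemma prod_list_mult_commuting:
  fixes a b :: "'b \<Rightarrow> 'a::ring_1"
  assumes "\<And>i j. i \<in> set xs \<Longrightarrow> j \<in> set xs \<Longrightarrow> a i * b j = b j * a i"
  shows "prod_list (map (\<lambda>i. a i * b i) xs) = prod_list (map a xs) * prod_list (map b xs)"
  using assms
proof (induction xs)
  case (Cons x xs)
  have "b x * prod_list (map a xs) = prod_list (map a xs) * b x"
    by (rule commute_prod_list) (use Cons.prems in auto)
  moreover have "prod_list (map (\<lambda>i. a i * b i) xs) = prod_list (map a xs) * prod_list (map b xs)"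
    using Cons by auto
  ultimately show ?case by simp (metis mult.assoc)
qed simp

lemma prod_list_eq_0: "0 \<in> set xs \<Longrightarrow> prod_list xs = (0 :: 'a::ring_1)"
  by (induction xs) auto

lemma upt_split_pair: "1 \<le> i \<Longrightarrow> i < n \<Longrightarrow> [1..<n + 1] = [1..<i] @ [i, Suc i] @ [i + 2..<n + 1]"
proof -
  assume "1 \<le> i" "i < n"
  hence "[1..<n + 1] = [1..<i] @ [i..<n + 1]"
    using upt_add_eq_append[of 1 i "n + 1 - i"] by simp
  also have "[i..<n + 1] = [i, Suc i] @ [i + 2..<n + 1]" using \<open>i < n\<close> by (simp add: upt_conv_Cons)
  finally show ?thesis .
qed

text \<open>Composition with the transposition is a bijection between the permutations that ascend
  at i and those that descend there.\<close>

lemma sum_permutes_transpose: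
  fixes g :: "(nat \<Rightarrow> nat) \<Rightarrow> 'a::comm_monoid_add"
  assumes "1 \<le> i" "i < n"
  shows "(\<Sum>\<sigma>\<in>{\<sigma>. \<sigma> permutes {1..n}}. g \<sigma>)
    = (\<Sum>\<sigma>\<in>{\<sigma>. \<sigma> permutes {1..n} \<and> \<sigma> i < \<sigma> (Suc i)}. g \<sigma> + g (\<sigma> \<circ> transpose i (Suc i)))"
proof -
  let ?s = "transpose i (Suc i)"
  let ?P = "{\<sigma>. \<sigma> permutes {1..n}}"
  let ?A = "{\<sigma>. \<sigma> permutes {1..n} \<and> \<sigma> i < \<sigma> (Suc i)}" and ?B = "{\<sigma>. \<sigma> permutes {1..n} \<and> \<sigma> (Suc i) < \<sigma> i}"
  have s: "?s permutes {1..n}" using assms by (intro permutes_swap_id) auto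
  have fin: "finite ?P" by (simp add: finite_permutations)
  have "\<sigma> i \<noteq> \<sigma> (Suc i)" if "\<sigma> permutes {1..n}" for \<sigma>
    using permutes_inj[OF that] by (simp add: inj_eq)
  hence "?P = ?A \<union> ?B" by (auto simp: neq_iff)
  hence "sum g ?P = sum g (?A \<union> ?B)" by (rule arg_cong)
  also have "\<dots> = sum g ?A + sum g ?B"
    by (rule sum.union_disjoint) (rule finite_subset[OF _ fin], blast, rule finite_subset[OF _ fin], blast, auto)
  also have "sum g ?B = (\<Sum>\<sigma>\<in>?A. g (\<sigma> \<circ> ?s))"
    by (rule sum.reindex_bij_witness[of _ "\<lambda>\<sigma>. \<sigma> \<circ> ?s" "\<lambda>\<sigma>. \<sigma> \<circ> ?s"])
       (auto simp: o_assoc[symmetric] permutes_compose[OF s[unfolded One_nat_def]])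
  finally show ?thesis by (simp add: sum.distrib)
qed

section \<open>Quantum matrices over a ring with a central unit\<close>

locale central_unit =
  fixes q p :: "'a::ring_1"
  assumes q_central: "q * x = x * q" and pq: "p * q = 1"
begin

lemma qp: "q * p = 1"
  using q_central[of p] pq by simp

lemma p_central: "p * x = x * p"
proof -
  have "p * x = p * x * (q * p)" by (simp add: qp)
  also have "\<dots> = p * (x * q) * p" by (simp add: mult.assoc)
  also have "x * q = q * x" by (rule q_central[symmetric])
  also have "p * (q * x) * p = p * q * x * p" by (simp add: mult.assoc)
  finally show ?thesis by (simp add: pq)
qed

lemma q_left: "x * (q * y) = q * (x * y)"
  by (simp add: q_central[of x] flip: mult.assoc)

lemma q_cancel: "q * (p * x) = x" "p * (q * x) = x"
  by (simp_all add: pq qp flip: mult.assoc)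

definition qmat :: "nat \<Rightarrow> (nat \<Rightarrow> nat \<Rightarrow> 'a) \<Rightarrow> bool" where
  "qmat n t \<longleftrightarrow>
    (\<forall>i\<in>{1..n}. \<forall>j\<in>{1..n}. \<forall>k\<in>{1..n}. j < k \<longrightarrow>
      t i j * t i k = q * (t i k * t i j) \<and> t j i * t k i = q * (t k i * t j i)) \<and>
    (\<forall>i\<in>{1..n}. \<forall>j\<in>{1..n}. \<forall>k\<in>{1..n}. \<forall>l\<in>{1..n}. i < j \<longrightarrow> k < l \<longrightarrow>
      t i l * t j k = t j k * t i l \<and> t i k * t j l = t j l * t i k + (q - p) * (t i l * t j k))"

lemma qmatD:
  assumes "qmat n t" "i \<in> {1..n}" "j \<in> {1..n}" "k \<in> {1..n}"
  shows "j < k \<Longrightarrow> t i j * t i k = q * (t i k * t i j)"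
    and "j < k \<Longrightarrow> t j i * t k i = q * (t k i * t j i)"
    and "l \<in> {1..n} \<Longrightarrow> i < j \<Longrightarrow> k < l \<Longrightarrow> t i l * t j k = t j k * t i l"
    and "l \<in> {1..n} \<Longrightarrow> i < j \<Longrightarrow> k < l \<Longrightarrow> t i k * t j l = t j l * t i k + (q - p) * (t i l * t j k)"
  using assms unfolding qmat_def by blast+

lemma qmat_transpose: "qmat n t \<Longrightarrow> qmat n (\<lambda>i j. t j i)"
  unfolding qmat_def by metis

text \<open>The uniform shape R T1 T2 = T2 T1 R of the relations is visibly stable under products
  of matrices with commuting entries.\<close>

definition rr :: "nat \<Rightarrow> nat \<Rightarrow> 'a" where "rr i j = (if i = j then q else 1)"
definition ss :: "bool \<Rightarrow> 'a" where "ss b = (if b then q - p else 0)"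

lemma rr_central: "rr i j * x = x * rr i j" and ss_central: "ss b * x = x * ss b"
  by (simp_all add: rr_def ss_def q_central p_central algebra_simps)

lemma rr_left: "x * (rr i j * y) = rr i j * (x * y)" and ss_left: "x * (ss b * y) = ss b * (x * y)"
  by (simp_all add: rr_central[of _ _ x] ss_central[of _ x] flip: mult.assoc)

text \<open>\<open>rr\<close> and \<open>ss\<close> are the entries of the R-matrix. The nine
  relative positions of i, j and of k, l give the defining relations, read forwards or backwards,
  and one trivial equation.\<close>

lemma qmat_iff_RTT:
  "qmat n t \<longleftrightarrow> (\<forall>i\<in>{1..n}. \<forall>j\<in>{1..n}. \<forall>k\<in>{1..n}. \<forall>l\<in>{1..n}.
    rr i j * (t i k * t j l) + ss (j < i) * (t j k * t i l)
    = rr k l * (t j l * t i k) + ss (k < l) * (t j k * t i l))"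
  (is "_ \<longleftrightarrow> ?R")
proof
  assume t: "qmat n t"
  have qq: "x = q * y \<Longrightarrow> y = p * x" for x y by (simp add: q_cancel)
  show ?R
  proof (intro ballI)
    fix i j k l assume *: "i \<in> {1..n}" "j \<in> {1..n}" "k \<in> {1..n}" "l \<in> {1..n}"
    consider "i = j" "k = l" | "i = j" "k < l" | "i = j" "l < k" | "i < j" "k = l" | "j < i" "k = l"
      | "i < j" "k < l" | "i < j" "l < k" | "j < i" "k < l" | "j < i" "l < k"
      by (metis linorder_neqE_nat)
    thus "rr i j * (t i k * t j l) + ss (j < i) * (t j k * t i l)
        = rr k l * (t j l * t i k) + ss (k < l) * (t j k * t i l)"
    proof cases
      case 2
      have "t i l * t i k = p * (t i k * t i l)" by (rule qq[OF qmatD(1)[OF t]]) (use * 2 in auto)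
      thus ?thesis using 2 by (simp add: rr_def ss_def left_diff_distrib)
    next
      case 5
      have "t i k * t j k = p * (t j k * t i k)" by (rule qq[OF qmatD(2)[OF t]]) (use * 5 in auto)
      thus ?thesis using 5 by (simp add: rr_def ss_def left_diff_distrib)
    next
      case 8
      have "t j l * t i k = t i k * t j l" using qmatD(3)[OF t, of j i k l] * 8 by simp
      thus ?thesis using 8 by (simp add: rr_def ss_def)
    next
      case 9
      have "t j l * t i k = t i k * t j l + (q - p) * (t j k * t i l)"
        using qmatD(4)[OF t, of j i l k] * 9 by simp
      thus ?thesis using 9 by (simp add: rr_def ss_def)
    next
      case 1
      thus ?thesis by (simp add: rr_def ss_def)
    next
      case 3
      have "t i l * t i k = q * (t i k * t i l)" using qmatD(1)[OF t, of i l k] * 3 by simp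
      thus ?thesis using 3 by (simp add: rr_def ss_def)
    next
      case 4
      have "t i k * t j k = q * (t j k * t i k)" using qmatD(2)[OF t, of k i j] * 4 by simp
      thus ?thesis using 4 by (simp add: rr_def ss_def)
    next
      case 6
      have "t i k * t j l = t j l * t i k + (q - p) * (t i l * t j k)"
        using qmatD(4)[OF t, of i j k l] * 6 by simp
      moreover have "t i l * t j k = t j k * t i l" using qmatD(3)[OF t, of i j k l] * 6 by simp
      ultimately show ?thesis using 6 by (simp add: rr_def ss_def)
    next
      case 7
      have "t i k * t j l = t j l * t i k" using qmatD(3)[OF t, of i j l k] * 7 by simp
      thus ?thesis using 7 by (simp add: rr_def ss_def)
    qed
  qed
next
  assume R: ?R
  have rel: "rr i j * (t i k * t j l) + ss (j < i) * (t j k * t i l)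
    = rr k l * (t j l * t i k) + ss (k < l) * (t j k * t i l)"
    if "i \<in> {1..n}" "j \<in> {1..n}" "k \<in> {1..n}" "l \<in> {1..n}" for i j k l
    using R that by blast
  show "qmat n t"
    unfolding qmat_def
  proof (intro conjI ballI impI)
    fix i j k assume *: "i \<in> {1..n}" "j \<in> {1..n}" "k \<in> {1..n}" "j < k"
    show "t i j * t i k = q * (t i k * t i j)"
      using rel[of i i k j] * by (simp add: rr_def ss_def)
    show "t j i * t k i = q * (t k i * t j i)"
      using rel[of j k i i] * by (simp add: rr_def ss_def)
  next
    fix i j k l assume *: "i \<in> {1..n}" "j \<in> {1..n}" "k \<in> {1..n}" "l \<in> {1..n}" "i < j" "k < l"
    show 1: "t i l * t j k = t j k * t i l"
      using rel[of i j l k] * by (simp add: rr_def ss_def)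
    show "t i k * t j l = t j l * t i k + (q - p) * (t i l * t j k)"
      using rel[of i j k l] * by (simp add: rr_def ss_def 1)
  qed
qed

definition mm :: "nat \<Rightarrow> (nat \<Rightarrow> nat \<Rightarrow> 'a) \<Rightarrow> (nat \<Rightarrow> nat \<Rightarrow> 'a) \<Rightarrow> nat \<Rightarrow> nat \<Rightarrow> 'a" where
  "mm n a b i j = (\<Sum>k\<in>{1..n}. a i k * b k j)"

definition commuting :: "nat \<Rightarrow> (nat \<Rightarrow> nat \<Rightarrow> 'a) \<Rightarrow> (nat \<Rightarrow> nat \<Rightarrow> 'a) \<Rightarrow> bool" where
  "commuting n a b \<longleftrightarrow> (\<forall>i\<in>{1..n}. \<forall>j\<in>{1..n}. \<forall>k\<in>{1..n}. \<forall>l\<in>{1..n}. a i j * b k l = b k l * a i j)"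

text \<open>R passes first through the entries of \<open>a\<close>, then through those of
  \<open>b\<close>: R A1 A2 B1 B2 = A2 A1 R B1 B2 = A2 A1 B2 B1 R. Commutation between the two
  matrices permits this grouping.\<close>

lemma qmat_mm:
  assumes a: "qmat n a" and b: "qmat n b" and ab: "commuting n a b"
  shows "qmat n (mm n a b)"
  unfolding qmat_iff_RTT
proof (intro ballI)
  fix i j k l assume *: "i \<in> {1..n}" "j \<in> {1..n}" "k \<in> {1..n}" "l \<in> {1..n}"
  let ?S = "{1..n}"
  have E: "mm n a b i k * mm n a b j l = (\<Sum>x\<in>?S. \<Sum>y\<in>?S. (a i x * a j y) * (b x k * b y l))"
    if "i \<in> ?S" "j \<in> ?S" "k \<in> ?S" "l \<in> ?S" for i j k l
    unfolding mm_def sum_product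
  proof (intro sum.cong refl)
    fix x y assume "x \<in> ?S" "y \<in> ?S"
    hence "b x k * a j y = a j y * b x k" using ab that by (auto simp: commuting_def)
    thus "a i x * b x k * (a j y * b y l) = (a i x * a j y) * (b x k * b y l)"
      by (metis mult.assoc)
  qed
  have A: "rr i j * (a i x * a j y) + ss (j < i) * (a j x * a i y)
      = rr x y * (a j y * a i x) + ss (x < y) * (a j x * a i y)" if "x \<in> ?S" "y \<in> ?S" for x y
    using a that * unfolding qmat_iff_RTT by blast
  have B: "rr x y * (b x k * b y l) + ss (y < x) * (b y k * b x l)
      = rr k l * (b y l * b x k) + ss (k < l) * (b y k * b x l)" if "x \<in> ?S" "y \<in> ?S" for x y
    using b that * unfolding qmat_iff_RTT by blast
  have "rr i j * (mm n a b i k * mm n a b j l) + ss (j < i) * (mm n a b j k * mm n a b i l)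
      = (\<Sum>x\<in>?S. \<Sum>y\<in>?S. (rr i j * (a i x * a j y) + ss (j < i) * (a j x * a i y)) * (b x k * b y l))"
    using * by (simp add: E sum_distrib_left sum.distrib distrib_right mult.assoc)
  also have "\<dots> = (\<Sum>x\<in>?S. \<Sum>y\<in>?S. (rr x y * (a j y * a i x) + ss (x < y) * (a j x * a i y)) * (b x k * b y l))"
    by (intro sum.cong refl arg_cong2[where f = "(*)"] A)
  also have "\<dots> = (\<Sum>x\<in>?S. \<Sum>y\<in>?S. rr x y * ((a j y * a i x) * (b x k * b y l)))
      + (\<Sum>x\<in>?S. \<Sum>y\<in>?S. ss (x < y) * ((a j x * a i y) * (b x k * b y l)))"
    by (simp add: sum.distrib distrib_right mult.assoc)
  \<comment> \<open>Exchanging the summation indices gives both sums the common left factor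
    \<open>a j y * a i x\<close>.\<close>
  also have "(\<Sum>x\<in>?S. \<Sum>y\<in>?S. ss (x < y) * ((a j x * a i y) * (b x k * b y l)))
      = (\<Sum>x\<in>?S. \<Sum>y\<in>?S. ss (y < x) * ((a j y * a i x) * (b y k * b x l)))"
    by (rule sum.swap)
  also have "(\<Sum>x\<in>?S. \<Sum>y\<in>?S. rr x y * ((a j y * a i x) * (b x k * b y l)))
      + (\<Sum>x\<in>?S. \<Sum>y\<in>?S. ss (y < x) * ((a j y * a i x) * (b y k * b x l)))
      = (\<Sum>x\<in>?S. \<Sum>y\<in>?S. (a j y * a i x) * (rr x y * (b x k * b y l) + ss (y < x) * (b y k * b x l)))"
    by (simp only: sum.distrib distrib_left rr_left ss_left)
  also have "\<dots> = (\<Sum>x\<in>?S. \<Sum>y\<in>?S. (a j y * a i x) * (rr k l * (b y l * b x k) + ss (k < l) * (b y k * b x l)))"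
    by (intro sum.cong refl arg_cong2[where f = "(*)"] B)
  also have "\<dots> = rr k l * (\<Sum>x\<in>?S. \<Sum>y\<in>?S. (a j y * a i x) * (b y l * b x k))
      + ss (k < l) * (\<Sum>x\<in>?S. \<Sum>y\<in>?S. (a j y * a i x) * (b y k * b x l))"
    by (simp only: sum.distrib distrib_left sum_distrib_left rr_left ss_left)
  also have "(\<Sum>x\<in>?S. \<Sum>y\<in>?S. (a j y * a i x) * (b y l * b x k)) = mm n a b j l * mm n a b i k"
    using * by (subst sum.swap) (simp add: E)
  also have "(\<Sum>x\<in>?S. \<Sum>y\<in>?S. (a j y * a i x) * (b y k * b x l)) = mm n a b j k * mm n a b i l"
    using * by (subst sum.swap) (simp add: E)
  finally show "rr i j * (mm n a b i k * mm n a b j l) + ss (j < i) * (mm n a b j k * mm n a b i l)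
      = rr k l * (mm n a b j l * mm n a b i k) + ss (k < l) * (mm n a b j k * mm n a b i l)" .
qed

text \<open>How this depends on the choice f of rows is what makes the quantum determinant multiplicative.\<close>

definition qdf :: "nat \<Rightarrow> (nat \<Rightarrow> nat \<Rightarrow> 'a) \<Rightarrow> (nat \<Rightarrow> nat) \<Rightarrow> 'a" where
  "qdf n t f = (\<Sum>\<sigma>\<in>{\<sigma>. \<sigma> permutes {1..n}}.
     (- q) ^ perm_length n \<sigma> * prod_list (map (\<lambda>i. t (f i) (\<sigma> i)) [1..<n + 1]))"

abbreviation qd :: "nat \<Rightarrow> (nat \<Rightarrow> nat \<Rightarrow> 'a) \<Rightarrow> 'a" where
  "qd n t \<equiv> qdf n t (\<lambda>i. i)"

lemma mq_central: "(- q) ^ k * x = x * (- q) ^ k"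
  by (rule power_commuting_commutes) (simp add: q_central[of x])

lemma mq_power_left: "x * ((- q) ^ k * y) = (- q) ^ k * (x * y)"
  using arg_cong[OF mq_central[of k x], of "\<lambda>z. z * y"] by (simp only: mult.assoc)

lemma mq_left: "x * (- q * y) = - q * (x * y)"
  using q_left[of x y] by simp

lemma mq_factor: "c * (l * (- q * y) * r) = - q * (c * (l * y * r))"
  by (simp only: mq_left[of l] mult.assoc[of "- q"] mq_left[of c])

text \<open>The terms of a permutation and of its composition with an adjacent transposition combine
  to a 2x2 quantum minor between unchanged outer factors.\<close>

lemma swap_pair: "c * (l * x * r) + (- q) ^ Suc k * (l * y * r) = c * (l * (x - q * y) * r)"
  if "c = (- q) ^ k"
proof -
  have "(- q) ^ Suc k * (l * y * r) = - q * (c * (l * y * r))" by (simp add: that mult.assoc)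
  thus ?thesis unfolding mq_factor[symmetric] by (simp add: algebra_simps)
qed

text \<open>With u = t_rk t_sl, v = t_sl t_rk and w = t_rl t_sk for r < s, k < l: the 2x2 quantum
  minor with rows in the wrong order is -q times the one in the right order.\<close>

lemma diag_swap: "u = v + (q - p) * w \<Longrightarrow> w - q * v = - q * (u - q * w)"
  by (erule ssubst) (simp add: algebra_simps q_cancel)

lemma qdf_cong: "(\<And>i. i \<in> {1..n} \<Longrightarrow> f i = g i) \<Longrightarrow> qdf n t f = qdf n t g"
  unfolding qdf_def by (intro sum.cong refl arg_cong2[where f = "(*)"] arg_cong[where f = prod_list] map_cong) auto

text \<open>After pairing permutations only the 2x2 minors of the rows \<open>f i\<close> and
  \<open>f (Suc i)\<close> matter: they vanish for equal rows, and a wrong order of the rows yields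
  the factor -q.\<close>

lemma qdf_transpose:
  assumes t: "qmat n t" and i: "1 \<le> i" "i < n" and f: "f ` {1..n} \<subseteq> {1..n}"
  shows "f i = f (Suc i) \<Longrightarrow> qdf n t f = 0"
    and "f (Suc i) < f i \<Longrightarrow> qdf n t f = - q * qdf n t (f \<circ> transpose i (Suc i))"
proof -
  let ?s = "transpose i (Suc i)"
  let ?A = "{\<sigma>. \<sigma> permutes {1..n} \<and> \<sigma> i < \<sigma> (Suc i)}"
  let ?L = "\<lambda>\<sigma>. prod_list (map (\<lambda>i. t (f i) (\<sigma> i)) [1..<i])"
  let ?R = "\<lambda>\<sigma>. prod_list (map (\<lambda>i. t (f i) (\<sigma> i)) [i + 2..<n + 1])"
  \<comment> \<open>Stated for every \<open>g\<close> that agrees with \<open>f\<close> away from i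
    and i+1, since it serves both \<open>f\<close> and \<open>f \<circ> ?s\<close>.\<close>
  have split: "qdf n t g = (\<Sum>\<sigma>\<in>?A. (- q) ^ perm_length n \<sigma> * (?L \<sigma> *
      (t (g i) (\<sigma> i) * t (g (Suc i)) (\<sigma> (Suc i)) - q * (t (g i) (\<sigma> (Suc i)) * t (g (Suc i)) (\<sigma> i))) * ?R \<sigma>))"
    if g: "\<And>j. j \<noteq> i \<Longrightarrow> j \<noteq> Suc i \<Longrightarrow> g j = f j" for g
    unfolding qdf_def sum_permutes_transpose[OF i]
  proof (rule sum.cong[OF refl])
    fix \<sigma> assume "\<sigma> \<in> ?A"
    hence len: "perm_length n (\<sigma> \<circ> ?s) = Suc (perm_length n \<sigma>)"
      using i by (intro perm_length_transpose) auto
    have L: "prod_list (map (\<lambda>i. t (g i) (\<tau> i)) [1..<i]) = ?L \<sigma>"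
      and R: "prod_list (map (\<lambda>i. t (g i) (\<tau> i)) [i + 2..<n + 1]) = ?R \<sigma>"
      if "\<And>j. j \<noteq> i \<Longrightarrow> j \<noteq> Suc i \<Longrightarrow> \<tau> j = \<sigma> j" for \<tau>
      by (intro arg_cong[where f = prod_list] map_cong refl arg_cong2[where f = t] g that; auto)+
    have P: "prod_list (map (\<lambda>i. t (g i) (\<tau> i)) [1..<n + 1])
        = ?L \<sigma> * (t (g i) (\<tau> i) * t (g (Suc i)) (\<tau> (Suc i))) * ?R \<sigma>"
      if "\<And>j. j \<noteq> i \<Longrightarrow> j \<noteq> Suc i \<Longrightarrow> \<tau> j = \<sigma> j" for \<tau>
    proof -
      have "prod_list (map (\<lambda>i. t (g i) (\<tau> i)) [1..<i]) = ?L \<sigma>"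
        "prod_list (map (\<lambda>i. t (g i) (\<tau> i)) [i + 2..<n + 1]) = ?R \<sigma>"
        by (rule L, erule that, assumption, rule R, erule that, assumption)
      thus ?thesis
        by (simp only: upt_split_pair[OF i] map_append prod_list.append list.map prod_list.Cons
            prod_list.Nil mult_1_right mult.assoc)
    qed
    have "?s j = j" if "j \<noteq> i" "j \<noteq> Suc i" for j using that by (simp add: transpose_def)
    hence 2: "prod_list (map (\<lambda>i. t (g i) ((\<sigma> \<circ> ?s) i)) [1..<n + 1])
        = ?L \<sigma> * (t (g i) (\<sigma> (Suc i)) * t (g (Suc i)) (\<sigma> i)) * ?R \<sigma>"
      by (subst P) simp_all
    show "(- q) ^ perm_length n \<sigma> * prod_list (map (\<lambda>i. t (g i) (\<sigma> i)) [1..<n + 1]) +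
       (- q) ^ perm_length n (\<sigma> \<circ> ?s) * prod_list (map (\<lambda>i. t (g i) ((\<sigma> \<circ> ?s) i)) [1..<n + 1])
      = (- q) ^ perm_length n \<sigma> * (?L \<sigma> * (t (g i) (\<sigma> i) * t (g (Suc i)) (\<sigma> (Suc i))
          - q * (t (g i) (\<sigma> (Suc i)) * t (g (Suc i)) (\<sigma> i))) * ?R \<sigma>)"
      unfolding len 2 P[OF refl] by (rule swap_pair) (rule refl)
  qed
  have range: "\<sigma> i \<in> {1..n}" "\<sigma> (Suc i) \<in> {1..n}" "\<sigma> i < \<sigma> (Suc i)" if "\<sigma> \<in> ?A" for \<sigma>
  proof -
    have \<sigma>: "\<sigma> permutes {1..n}" and less: "\<sigma> i < \<sigma> (Suc i)" using that by auto
    show "\<sigma> i \<in> {1..n}" "\<sigma> (Suc i) \<in> {1..n}"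
      unfolding permutes_in_image[OF \<sigma>] using i by auto
    show "\<sigma> i < \<sigma> (Suc i)" by (rule less)
  qed
  have fi: "f i \<in> {1..n}" "f (Suc i) \<in> {1..n}" using f i by (auto simp: image_subset_iff)
  {
    assume eq: "f i = f (Suc i)"
    have zero: "t (f i) (\<sigma> i) * t (f (Suc i)) (\<sigma> (Suc i)) - q * (t (f i) (\<sigma> (Suc i)) * t (f (Suc i)) (\<sigma> i)) = 0"
      if "\<sigma> \<in> ?A" for \<sigma>
      using qmatD(1)[OF t fi(1) range(1,2)[OF that] range(3)[OF that]] by (simp add: eq)
    have "qdf n t f = (\<Sum>\<sigma>\<in>?A. (- q) ^ perm_length n \<sigma> * (?L \<sigma> * 0 * ?R \<sigma>))"
      unfolding split[OF refl] by (rule sum.cong[OF refl]) (simp only: zero)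
    thus "qdf n t f = 0" by simp
  }
  {
    assume less: "f (Suc i) < f i"
    have swap: "t (f i) (\<sigma> i) * t (f (Suc i)) (\<sigma> (Suc i)) - q * (t (f i) (\<sigma> (Suc i)) * t (f (Suc i)) (\<sigma> i))
        = - q * (t (f (Suc i)) (\<sigma> i) * t (f i) (\<sigma> (Suc i)) - q * (t (f (Suc i)) (\<sigma> (Suc i)) * t (f i) (\<sigma> i)))"
      if "\<sigma> \<in> ?A" for \<sigma>
    proof -
      note r = range[OF that]
      show ?thesis
        using diag_swap[OF qmatD(4)[OF t fi(2) fi(1) r(1) r(2) less r(3)]]
        unfolding qmatD(3)[OF t fi(2) fi(1) r(1) r(2) less r(3)] .
    qed
    have "qdf n t f = (\<Sum>\<sigma>\<in>?A. (- q) ^ perm_length n \<sigma> * (?L \<sigma> * (- q *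
       (t (f (Suc i)) (\<sigma> i) * t (f i) (\<sigma> (Suc i)) - q * (t (f (Suc i)) (\<sigma> (Suc i)) * t (f i) (\<sigma> i)))) * ?R \<sigma>))"
      unfolding split[OF refl] by (rule sum.cong[OF refl]) (simp only: swap)
    also have "\<dots> = - q * qdf n t (f \<circ> ?s)"
      unfolding sum_distrib_left
    proof (subst split)
      show "(\<Sum>\<sigma>\<in>?A. (- q) ^ perm_length n \<sigma> * (?L \<sigma> * (- q * (t (f (Suc i)) (\<sigma> i) * t (f i) (\<sigma> (Suc i))
          - q * (t (f (Suc i)) (\<sigma> (Suc i)) * t (f i) (\<sigma> i)))) * ?R \<sigma>))
        = - q * (\<Sum>\<sigma>\<in>?A. (- q) ^ perm_length n \<sigma> * (?L \<sigma> * (t ((f \<circ> ?s) i) (\<sigma> i) * t ((f \<circ> ?s) (Suc i)) (\<sigma> (Suc i))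
          - q * (t ((f \<circ> ?s) i) (\<sigma> (Suc i)) * t ((f \<circ> ?s) (Suc i)) (\<sigma> i))) * ?R \<sigma>))"
        unfolding sum_distrib_left mq_factor by simp
    qed (simp add: transpose_def)
    finally show "qdf n t f = - q * qdf n t (f \<circ> ?s)" .
  }
qed

text \<open>Bubble sort on the number of inversions: a descent costs one factor -q, equal neighbours
  give 0, and a choice of rows with neither is the identity. A non-injective choice eventually meets
  equal neighbours.\<close>

lemma qdf_eq:
  assumes t: "qmat n t" and "f ` {1..n} \<subseteq> {1..n}"
  shows "qdf n t f = (if inj_on f {1..n} then (- q) ^ perm_length n f * qd n t else 0)"
  using assms(2)
proof (induction "perm_length n f" arbitrary: f rule: less_induct)
  case less
  consider i where "1 \<le> i" "i < n" "f (Suc i) < f i" | i where "1 \<le> i" "i < n" "f (Suc i) = f i"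
    | "\<And>i. 1 \<le> i \<Longrightarrow> i < n \<Longrightarrow> f i < f (Suc i)"
    by (metis linorder_neqE_nat)
  thus ?case
  proof cases
    case 1
    let ?s = "transpose i (Suc i)"
    have s: "?s permutes {1..n}" using 1 by (intro permutes_swap_id) auto
    have len: "perm_length n f = Suc (perm_length n (f \<circ> ?s))"
      using perm_length_transpose[of i n "f \<circ> ?s"] 1 by (simp add: o_assoc[symmetric])
    have inj: "inj_on (f \<circ> ?s) {1..n} \<longleftrightarrow> inj_on f {1..n}"
      using comp_inj_on_iff[of ?s "{1..n}" f] permutes_inj_on[OF s] permutes_image[OF s] by simp
    have "(f \<circ> ?s) ` {1..n} \<subseteq> {1..n}"
      unfolding image_comp[symmetric] permutes_image[OF s] by (rule less.prems)
    hence "qdf n t (f \<circ> ?s) = (if inj_on f {1..n} then (- q) ^ perm_length n (f \<circ> ?s) * qd n t else 0)"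
      using less.hyps[of "f \<circ> ?s"] len inj by simp
    thus ?thesis using qdf_transpose(2)[OF t 1(1,2) less.prems 1(3)]
      by (simp add: len mult.assoc)
  next
    case 2
    hence "\<not> inj_on f {1..n}" using inj_onD[of f "{1..n}" i "Suc i"] by auto
    thus ?thesis using qdf_transpose(1)[OF t 2(1,2) less.prems] 2 by simp
  next
    case 3
    have id: "f i = i" if "i \<in> {1..n}" for i
      using strictly_increasing_le[OF 3 less.prems that] by simp
    have "{(i, j). 1 \<le> i \<and> i < j \<and> j \<le> n \<and> f j < f i} = {}" using id by fastforce
    hence "perm_length n f = 0" unfolding perm_length_def by (simp only: card.empty)
    moreover have "inj_on f {1..n}" using id by (auto simp: inj_on_def)
    moreover have "qdf n t f = qd n t" by (rule qdf_cong) (rule id)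
    ultimately show ?thesis by simp
  qed
qed

text \<open>Expanding the entries gives a sum over choices \<open>f\<close> of intermediate indices
  with \<open>qdf n b f\<close> as right factor; \<open>qdf_eq\<close> leaves only the permutations
  and produces the powers of -q that belong to \<open>qd n a\<close>.\<close>

lemma qd_mm:
  assumes b: "qmat n b" and ab: "commuting n a b"
  shows "qd n (mm n a b) = qd n a * qd n b"
proof -
  let ?S = "{1..n}" and ?P = "{\<sigma>. \<sigma> permutes {1..n}}" and ?xs = "[1..<n + 1]"
  have xs: "set ?xs = ?S" "distinct ?xs" by auto
  have fin: "finite (?S \<rightarrow>\<^sub>E ?S)" by (intro finite_PiE) auto
  have expand: "prod_list (map (\<lambda>i. mm n a b i (\<sigma> i)) ?xs)
      = (\<Sum>f\<in>?S \<rightarrow>\<^sub>E ?S. prod_list (map (\<lambda>i. a i (f i)) ?xs) * prod_list (map (\<lambda>i. b (f i) (\<sigma> i)) ?xs))"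
    if "\<sigma> permutes ?S" for \<sigma>
  proof -
    have "prod_list (map (\<lambda>i. mm n a b i (\<sigma> i)) ?xs)
        = (\<Sum>f\<in>?S \<rightarrow>\<^sub>E ?S. prod_list (map (\<lambda>i. a i (f i) * b (f i) (\<sigma> i)) ?xs))"
      by (simp only: mm_def prod_list_sum_distrib[OF xs(2) finite_atLeastAtMost] xs(1))
    also have "\<dots> = (\<Sum>f\<in>?S \<rightarrow>\<^sub>E ?S. prod_list (map (\<lambda>i. a i (f i)) ?xs) * prod_list (map (\<lambda>i. b (f i) (\<sigma> i)) ?xs))"
    proof (intro sum.cong refl prod_list_mult_commuting)
      fix f i j assume "f \<in> ?S \<rightarrow>\<^sub>E ?S" "i \<in> set ?xs" "j \<in> set ?xs"
      moreover from this have "\<sigma> j \<in> ?S" unfolding xs(1) by (simp only: permutes_in_image[OF that])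
      ultimately show "a i (f i) * b (f j) (\<sigma> j) = b (f j) (\<sigma> j) * a i (f i)"
        using ab unfolding commuting_def xs(1) by (metis PiE_mem)
    qed
    finally show ?thesis .
  qed
  have "qd n (mm n a b) = (\<Sum>\<sigma>\<in>?P. \<Sum>f\<in>?S \<rightarrow>\<^sub>E ?S.
      prod_list (map (\<lambda>i. a i (f i)) ?xs) * ((- q) ^ perm_length n \<sigma> * prod_list (map (\<lambda>i. b (f i) (\<sigma> i)) ?xs)))"
    unfolding qdf_def
  proof (intro sum.cong refl)
    fix \<sigma> assume "\<sigma> \<in> ?P"
    hence "\<sigma> permutes ?S" by simp
    show "(- q) ^ perm_length n \<sigma> * prod_list (map (\<lambda>i. mm n a b i (\<sigma> i)) ?xs)
      = (\<Sum>f\<in>?S \<rightarrow>\<^sub>E ?S. prod_list (map (\<lambda>i. a i (f i)) ?xs)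
          * ((- q) ^ perm_length n \<sigma> * prod_list (map (\<lambda>i. b (f i) (\<sigma> i)) ?xs)))"
      unfolding expand[OF \<open>\<sigma> permutes ?S\<close>] sum_distrib_left mq_power_left ..
  qed
  also have "\<dots> = (\<Sum>f\<in>?S \<rightarrow>\<^sub>E ?S. prod_list (map (\<lambda>i. a i (f i)) ?xs) * qdf n b f)"
    unfolding qdf_def sum_distrib_left by (rule sum.swap)
  also have "\<dots> = (\<Sum>f\<in>{f \<in> ?S \<rightarrow>\<^sub>E ?S. inj_on f ?S}.
      prod_list (map (\<lambda>i. a i (f i)) ?xs) * ((- q) ^ perm_length n f * qd n b))"
  proof (rule sum.mono_neutral_cong_right[OF fin])
    fix f assume "f \<in> {f \<in> ?S \<rightarrow>\<^sub>E ?S. inj_on f ?S}"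
    thus "prod_list (map (\<lambda>i. a i (f i)) ?xs) * qdf n b f
        = prod_list (map (\<lambda>i. a i (f i)) ?xs) * ((- q) ^ perm_length n f * qd n b)"
      by (subst qdf_eq[OF b]) auto
  next
    show "\<forall>f\<in>(?S \<rightarrow>\<^sub>E ?S) - {f \<in> ?S \<rightarrow>\<^sub>E ?S. inj_on f ?S}. prod_list (map (\<lambda>i. a i (f i)) ?xs) * qdf n b f = 0"
      by (intro ballI, subst qdf_eq[OF b]) auto
  qed auto
  \<comment> \<open>Injective extensional self-maps correspond to permutations, which are the
    identity outside the index range.\<close>
  also have "\<dots> = (\<Sum>\<sigma>\<in>?P. prod_list (map (\<lambda>i. a i (\<sigma> i)) ?xs) * ((- q) ^ perm_length n \<sigma> * qd n b))"
  proof (rule sum.reindex_bij_witness[of _ "\<lambda>\<sigma>. restrict \<sigma> ?S" "\<lambda>f i. if i \<in> ?S then f i else i"])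
    fix f assume f: "f \<in> {f \<in> ?S \<rightarrow>\<^sub>E ?S. inj_on f ?S}"
    let ?g = "\<lambda>i. if i \<in> ?S then f i else i"
    show "restrict ?g ?S = f" using f by (auto simp: fun_eq_iff PiE_def extensional_def)
    have "f ` ?S = ?S" using f by (intro endo_inj_surj) auto
    hence "bij_betw f ?S ?S" using f by (simp add: bij_betw_def)
    hence "bij_betw ?g ?S ?S" by (rule bij_betw_cong[THEN iffD1, rotated]) simp
    thus "?g \<in> ?P" by (auto intro: bij_imp_permutes)
    have "perm_length n ?g = perm_length n f"
      unfolding perm_length_def by (rule arg_cong[of _ _ card]) auto
    moreover have "map (\<lambda>i. a i (?g i)) ?xs = map (\<lambda>i. a i (f i)) ?xs" by (rule map_cong) auto
    ultimately show "prod_list (map (\<lambda>i. a i (?g i)) ?xs) * ((- q) ^ perm_length n ?g * qd n b)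
      = prod_list (map (\<lambda>i. a i (f i)) ?xs) * ((- q) ^ perm_length n f * qd n b)" by (simp only:)
  next
    fix \<sigma> assume "\<sigma> \<in> ?P"
    hence \<sigma>: "\<sigma> permutes ?S" by simp
    show "(\<lambda>i. if i \<in> ?S then restrict \<sigma> ?S i else i) = \<sigma>"
      using permutes_not_in[OF \<sigma>] by (auto simp: fun_eq_iff)
    show "restrict \<sigma> ?S \<in> {f \<in> ?S \<rightarrow>\<^sub>E ?S. inj_on f ?S}"
      using permutes_in_image[OF \<sigma>] permutes_inj_on[OF \<sigma>] by (auto simp: inj_on_restrict_eq)
  qed
  also have "\<dots> = qd n a * qd n b"
    unfolding qdf_def[of n a] sum_distrib_right
    by (simp only: mq_power_left mult.assoc)
  finally show ?thesis .
qed

text \<open>A permutation other than the identity meets an entry below the diagonal and one above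
  it.\<close>

lemma qd_triangular:
  assumes "(\<forall>i\<in>{1..n}. \<forall>j\<in>{1..n}. j < i \<longrightarrow> a i j = 0) \<or> (\<forall>i\<in>{1..n}. \<forall>j\<in>{1..n}. i < j \<longrightarrow> a i j = 0)"
  shows "qd n a = prod_list (map (\<lambda>i. a i i) [1..<n + 1])"
proof -
  let ?P = "{\<sigma>. \<sigma> permutes {1..n}}"
  have "prod_list (map (\<lambda>i. a i (\<sigma> i)) [1..<n + 1]) = 0" if \<sigma>: "\<sigma> permutes {1..n}" "\<sigma> \<noteq> id" for \<sigma>
  proof (rule prod_list_eq_0)
    obtain i where i: "i \<in> {1..n}" "\<sigma> i < i"
      using permutes_natset_ge[OF \<sigma>(1)] \<sigma>(2) by (metis not_less)
    obtain j where j: "j \<in> {1..n}" "j < \<sigma> j"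
      using permutes_natset_le[OF \<sigma>(1)] \<sigma>(2) by (metis not_less)
    have "\<sigma> i \<in> {1..n}" "\<sigma> j \<in> {1..n}"
      using i(1) j(1) by (simp_all only: permutes_in_image[OF \<sigma>(1)])
    hence "a i (\<sigma> i) = 0 \<or> a j (\<sigma> j) = 0" using assms i j by blast
    hence "0 \<in> (\<lambda>i. a i (\<sigma> i)) ` {1..n}" using i(1) j(1) by (metis image_eqI)
    moreover have "set [1..<n + 1] = {1..n}" by auto
    ultimately show "0 \<in> set (map (\<lambda>i. a i (\<sigma> i)) [1..<n + 1])" by (simp only: set_map)
  qed
  moreover have "{(i, j). 1 \<le> i \<and> i < j \<and> j \<le> n \<and> id j < id i} = {}" by auto
  hence "perm_length n id = 0" unfolding perm_length_def by (simp only: card.empty)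
  ultimately have "qd n a = (\<Sum>\<sigma>\<in>?P. if \<sigma> = id then prod_list (map (\<lambda>i. a i i) [1..<n + 1]) else 0)"
    unfolding qdf_def by (intro sum.cong) (simp_all del: upt_Suc)
  thus ?thesis by (simp add: finite_permutations permutes_id)
qed

end

section \<open>Monomial operators and leading terms\<close>

text \<open>The linear endomorphisms of the complex functions on \<open>'l\<close>, as a type of
  their own so that composition is the product of a \<open>ring_1\<close> and
  \<open>central_unit\<close> can be interpreted.\<close>

typedef 'l oper = "{F :: ('l \<Rightarrow> complex) \<Rightarrow> 'l \<Rightarrow> complex.
    (\<forall>x y. F (\<lambda>u. x u + y u) = (\<lambda>u. F x u + F y u)) \<and> (\<forall>c x. F (\<lambda>u. c * x u) = (\<lambda>u. c * F x u))}"
  morphisms app Oper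
  by (rule exI[of _ "\<lambda>x. x"]) simp

setup_lifting type_definition_oper

instantiation oper :: (type) ring_1
begin

lift_definition zero_oper :: "'a oper" is "\<lambda>x u. 0" by simp
lift_definition one_oper :: "'a oper" is "\<lambda>x. x" by simp
lift_definition plus_oper :: "'a oper \<Rightarrow> 'a oper \<Rightarrow> 'a oper" is "\<lambda>F G x u. F x u + G x u"
  by (simp add: algebra_simps)
lift_definition uminus_oper :: "'a oper \<Rightarrow> 'a oper" is "\<lambda>F x u. - F x u"
  by simp
lift_definition minus_oper :: "'a oper \<Rightarrow> 'a oper \<Rightarrow> 'a oper" is "\<lambda>F G x u. F x u - G x u"
  by (simp add: algebra_simps)
lift_definition times_oper :: "'a oper \<Rightarrow> 'a oper \<Rightarrow> 'a oper" is "\<lambda>F G x. F (G x)"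
  by simp

instance
proof
  show "(0 :: 'a oper) \<noteq> 1"
    by transfer (metis zero_neq_one)
qed (transfer; simp add: algebra_simps fun_eq_iff)+

end

lemmas app_simps = zero_oper.rep_eq one_oper.rep_eq plus_oper.rep_eq uminus_oper.rep_eq
  minus_oper.rep_eq times_oper.rep_eq

lift_definition scal :: "complex \<Rightarrow> 'l oper" is "\<lambda>c x u. c * x u"
  by (simp add: algebra_simps)

lemma scal_0 [simp]: "scal 0 = 0" and scal_1 [simp]: "scal 1 = 1"
  and scal_add: "scal (c + d) = scal c + scal d" and scal_mult: "scal (c * d) = scal c * scal d"
  and scal_uminus: "scal (- c) = - scal c"
  by (transfer; simp add: algebra_simps)+

lemma scal_power: "scal (c ^ k) = scal c ^ k"
  by (induction k) (simp_all add: scal_mult)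

lemma scal_central: "scal c * F = F * scal c"
  by transfer simp

text \<open>Shift by \<open>v\<close>, then multiplication with \<open>\<chi>\<close>: the point
  function at w goes to \<open>\<chi> (w + v)\<close> times the one at w + v.\<close>

lift_definition mon :: "('l::ab_group_add \<Rightarrow> complex) \<Rightarrow> 'l \<Rightarrow> 'l oper" is
  "\<lambda>\<chi> v x u. \<chi> u * x (u - v)"
  by (simp add: algebra_simps)

lemma mon_mult: "mon \<chi> v * mon \<chi>' v' = mon (\<lambda>u. \<chi> u * \<chi>' (u - v)) (v + v')"
  by transfer (simp add: algebra_simps fun_eq_iff)

lemma mon_one: "mon (\<lambda>_. 1) 0 = 1"
  by transfer simp

lemma mon_const: "mon (\<lambda>_. c) 0 = scal c"
  by transfer simp

lemma scal_mon: "scal c * mon \<chi> v = mon (\<lambda>u. c * \<chi> u) v"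
  by (simp add: mon_mult flip: mon_const)

lemma mon_commute_scal:
  assumes "\<And>u. \<chi> u * \<chi>' (u - v) = c * (\<chi>' u * \<chi> (u - v'))"
  shows "mon \<chi> v * mon \<chi>' v' = scal c * (mon \<chi>' v' * mon \<chi> v)"
  by (simp add: mon_mult scal_mon assms add.commute)

type_synonym lat = "(nat \<times> nat) \<Rightarrow>\<^sub>0 int"

text \<open>Operators that involve only the coordinates in S; disjoint sets of coordinates give commuting
  operators.\<close>

inductive_set loc :: "(nat \<times> nat) set \<Rightarrow> lat oper set" for S where
  mon: "Poly_Mapping.keys v \<subseteq> S \<Longrightarrow>
    (\<And>u u'. (\<And>p. p \<in> S \<Longrightarrow> Poly_Mapping.lookup u p = Poly_Mapping.lookup u' p) \<Longrightarrow> \<chi> u = \<chi> u')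
    \<Longrightarrow> mon \<chi> v \<in> loc S"
| zero: "0 \<in> loc S"
| add: "F \<in> loc S \<Longrightarrow> G \<in> loc S \<Longrightarrow> F + G \<in> loc S"
| mult: "F \<in> loc S \<Longrightarrow> G \<in> loc S \<Longrightarrow> F * G \<in> loc S"

lemma loc_one: "1 \<in> loc S"
  unfolding mon_one[symmetric] by (rule loc.mon) auto

lemma loc_mono:
  assumes "F \<in> loc S" "S \<subseteq> S'"
  shows "F \<in> loc S'"
  using assms(1)
proof induction
  case (mon v \<chi>)
  show ?case
  proof (rule loc.mon)
    show "Poly_Mapping.keys v \<subseteq> S'" using mon(1) assms(2) by blast
    show "\<chi> u = \<chi> u'" if "\<And>p. p \<in> S' \<Longrightarrow> Poly_Mapping.lookup u p = Poly_Mapping.lookup u' p" for u u'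
      using that assms(2) by (intro mon(2)) blast
  qed
qed (auto intro: loc.zero loc.add loc.mult)

lemma loc_sum: "(\<And>k. k \<in> A \<Longrightarrow> f k \<in> loc S) \<Longrightarrow> sum f A \<in> loc S"
  by (induction A rule: infinite_finite_induct) (auto intro: loc.zero loc.add)

lemma commute_mult:
  fixes a b x :: "'a::ring_1"
  assumes "a * x = x * a" "b * x = x * b"
  shows "a * b * x = x * (a * b)"
proof -
  have "a * b * x = a * (x * b)" by (simp add: mult.assoc assms(2))
  also have "\<dots> = x * (a * b)" by (simp add: assms(1) flip: mult.assoc)
  finally show ?thesis .
qed

text \<open>For monomial operators: the shift of one changes no coordinate that the coefficient
  function of the other reads. Sums and products follow.\<close>

lemma loc_commute:
  assumes "F \<in> loc S" "G \<in> loc S'" "S \<inter> S' = {}"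
  shows "F * G = G * F"
  using assms(1)
proof induction
  case outer: (mon v \<chi>)
  show ?case
    using assms(2)
  proof induction
    case (mon v' \<chi>')
    have "\<chi> (u - v') = \<chi> u" for u
    proof (rule outer(2))
      fix p assume "p \<in> S"
      hence "p \<notin> Poly_Mapping.keys v'" using mon.hyps(1) assms(3) by blast
      thus "Poly_Mapping.lookup (u - v') p = Poly_Mapping.lookup u p"
        by (simp add: lookup_minus in_keys_iff)
    qed
    moreover have "\<chi>' (u - v) = \<chi>' u" for u
    proof (rule mon.hyps(2))
      fix p assume "p \<in> S'"
      hence "p \<notin> Poly_Mapping.keys v" using outer(1) assms(3) by blast
      thus "Poly_Mapping.lookup (u - v) p = Poly_Mapping.lookup u p"
        by (simp add: lookup_minus in_keys_iff)
    qed
    ultimately show ?case by (simp add: mon_mult mult.commute add.commute)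
  next
    case (mult F G)
    show ?case by (rule commute_mult[symmetric]) (rule mult.IH[symmetric])+
  qed (simp_all add: algebra_simps)
next
  case (mult F' G')
  show ?case by (rule commute_mult) (rule mult.IH)+
qed (simp_all add: algebra_simps)

abbreviation eps :: "nat \<times> nat \<Rightarrow> lat" where
  "eps p \<equiv> Poly_Mapping.single p 1"

text \<open>Chosen such that among all lattice paths from i to j exactly one has maximal weight.\<close>

definition weight :: "nat \<Rightarrow> lat \<Rightarrow> int" where
  "weight n u = (\<Sum>(a, b)\<in>{1..n} \<times> {1..n}.
     Poly_Mapping.lookup u (a, b) * (if a = b then 0 else 1 - int (max a b)))"

lemma weight_add: "weight n (u + v) = weight n u + weight n v"
  by (simp add: weight_def lookup_add distrib_right case_prod_unfold sum.distrib)

lemma weight_0 [simp]: "weight n 0 = 0"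
  by (simp add: weight_def)

lemma weight_sum: "weight n (sum f A) = (\<Sum>k\<in>A. weight n (f k))"
  by (induction A rule: infinite_finite_induct) (simp_all add: weight_add)

lemma weight_eps:
  assumes "a \<in> {1..n}" "b \<in> {1..n}"
  shows "weight n (eps (a, b)) = (if a = b then 0 else 1 - int (max a b))"
proof -
  have "weight n (eps (a, b)) = (\<Sum>p\<in>{1..n} \<times> {1..n}.
      if p = (a, b) then (if a = b then 0 else 1 - int (max a b)) else 0)"
    unfolding weight_def by (intro sum.cong) (auto simp: lookup_single when_def split: if_splits)
  also have "\<dots> = (if a = b then 0 else 1 - int (max a b))" using assms by (subst sum.delta) auto
  finally show ?thesis .
qed

text \<open>\<open>weight\<close> is not injective, so strictness is demanded: the top weight occurs
  at one point of the support only.\<close>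

definition lead :: "nat \<Rightarrow> lat \<Rightarrow> (lat \<Rightarrow> complex) \<Rightarrow> bool" where
  "lead n v x \<longleftrightarrow> x v \<noteq> 0 \<and> (\<forall>u. x u \<noteq> 0 \<longrightarrow> u = v \<or> weight n u < weight n v)"

definition raises :: "nat \<Rightarrow> lat \<Rightarrow> lat oper \<Rightarrow> bool" where
  "raises n w F \<longleftrightarrow> (\<forall>v x. lead n v x \<longrightarrow> lead n (v + w) (app F x))"

text \<open>Exponents live in an abelian group, so reordering a word does not change its leading
  exponent.\<close>

lemma raises_mult: "raises n v F \<Longrightarrow> raises n w G \<Longrightarrow> raises n (v + w) (F * G)"
  unfolding raises_def app_simps by (simp add: add.commute[of v w] flip: add.assoc)

lemma raises_one: "raises n 0 1"
  by (simp add: raises_def app_simps)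

lemma raises_mon:
  assumes "\<And>u. \<chi> u \<noteq> 0"
  shows "raises n v (mon \<chi> v)"
proof -
  have w: "weight n u < weight n (v' + v)" if "weight n (u - v) < weight n v'" for u v'
    using that weight_add[of n "u - v" v] weight_add[of n v' v] by simp
  show ?thesis
    unfolding raises_def lead_def mon.rep_eq using assms w by (auto simp: algebra_simps)
qed

lemma app_sum: "app (sum F A) x = (\<lambda>u. \<Sum>k\<in>A. app (F k) x u)"
  by (induction A rule: infinite_finite_induct) (simp_all add: app_simps)

text \<open>At the leading point of the heaviest summand all others vanish, so nothing cancels
  there.\<close>

lemma raises_sum:
  assumes "finite A" "k \<in> A" "raises n (w k) (F k)"
    and "\<And>j. j \<in> A \<Longrightarrow> j \<noteq> k \<Longrightarrow> F j = 0 \<or> (raises n (w j) (F j) \<and> weight n (w j) < weight n (w k))"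
  shows "raises n (w k) (sum F A)"
  unfolding raises_def
proof (intro allI impI)
  fix v x assume x: "lead n v x"
  have k: "lead n (v + w k) (app (F k) x)" using assms(3) x by (simp add: raises_def)
  have small: "weight n u < weight n (v + w k)" if "j \<in> A" "j \<noteq> k" "app (F j) x u \<noteq> 0" for j u
  proof -
    have j: "lead n (v + w j) (app (F j) x)" "weight n (w j) < weight n (w k)"
      using assms(4)[OF that(1,2)] that(3) x by (auto simp: raises_def app_simps)
    hence "weight n u \<le> weight n (v + w j)" using that(3) by (auto simp: lead_def)
    thus ?thesis using j(2) by (simp add: weight_add)
  qed
  have "(\<Sum>j\<in>A. app (F j) x (v + w k)) = app (F k) x (v + w k)"
  proof -
    have "(\<Sum>j\<in>A. app (F j) x (v + w k)) = (\<Sum>j\<in>A. if j = k then app (F k) x (v + w k) else 0)"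
      using small by (intro sum.cong) force+
    thus ?thesis using assms(1,2) by simp
  qed
  moreover have "u = v + w k \<or> weight n u < weight n (v + w k)"
    if "(\<Sum>j\<in>A. app (F j) x u) \<noteq> 0" for u
  proof -
    obtain j where "j \<in> A" "app (F j) x u \<noteq> 0" using \<open>(\<Sum>j\<in>A. _ j) \<noteq> 0\<close> by (meson sum.neutral)
    thus ?thesis using small[of j u] k by (cases "j = k") (auto simp: lead_def)
  qed
  ultimately show "lead n (v + w k) (app (sum F A) x)"
    using k unfolding lead_def app_sum by auto
qed

text \<open>Among the indices with nonzero coefficient choose one of maximal weight; at its leading
  point every other such vector vanishes, being lighter or leading elsewhere with the same
  weight.\<close>

lemma lead_independent:
  assumes "finite A" "\<And>k. k \<in> A \<Longrightarrow> lead n (w k) (X k)" "inj_on w A"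
    and sum0: "\<And>u. (\<Sum>k\<in>A. c k * X k u) = 0"
    and "k \<in> A"
  shows "c k = 0"
proof (rule ccontr)
  assume "c k \<noteq> 0"
  define B where "B = {k\<in>A. c k \<noteq> 0}"
  have B: "finite B" "B \<noteq> {}" using assms(1,5) \<open>c k \<noteq> 0\<close> by (auto simp: B_def)
  let ?M = "Max ((\<lambda>k. weight n (w k)) ` B)"
  have "?M \<in> (\<lambda>k. weight n (w k)) ` B" using B by (intro Max_in) auto
  then obtain m where m1: "m \<in> B" "?M = weight n (w m)" by auto
  have "weight n (w j) \<le> ?M" if "j \<in> B" for j using B that by (intro Max_ge) auto
  with m1 have m: "m \<in> B" "\<And>j. j \<in> B \<Longrightarrow> weight n (w j) \<le> weight n (w m)" by simp_all
  have "(\<Sum>k\<in>A. c k * X k (w m)) = (\<Sum>k\<in>A. if k = m then c m * X m (w m) else 0)"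
  proof (rule sum.cong[OF refl])
    fix j assume j: "j \<in> A"
    show "c j * X j (w m) = (if j = m then c m * X m (w m) else 0)"
    proof (cases "j = m \<or> c j = 0")
      case False
      hence "j \<in> B" "w j \<noteq> w m" using j m(1) assms(3) by (auto simp: B_def inj_on_def)
      hence "X j (w m) = 0" using assms(2)[OF j] m(2)[of j] unfolding lead_def by fastforce
      thus ?thesis using False by simp
    qed auto
  qed
  also have "\<dots> = c m * X m (w m)" using assms(1) m(1) by (simp add: B_def)
  finally show False using sum0 m(1) assms(2)[of m] by (auto simp: B_def lead_def)
qed

section \<open>Unitriangular quantum matrices\<close>

lemma prod_list_one:
  fixes f :: "'b \<Rightarrow> 'a::ring_1"
  shows "(\<And>x. x \<in> set xs \<Longrightarrow> f x = 1) \<Longrightarrow> prod_list (map f xs) = 1"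
  by (induction xs) auto

context central_unit
begin

definition one_mat :: "nat \<Rightarrow> nat \<Rightarrow> 'a" where
  "one_mat i j = (if i = j then 1 else 0)"

text \<open>In the application a b = q b a and d is the inverse of a.\<close>

definition elem :: "nat \<Rightarrow> 'a \<Rightarrow> 'a \<Rightarrow> 'a \<Rightarrow> nat \<Rightarrow> nat \<Rightarrow> 'a" where
  "elem s a b d i j = (if i = j then if i = s then a else if i = Suc s then d else 1
     else if i = s \<and> j = Suc s then b else 0)"

definition diag :: "(nat \<Rightarrow> 'a) \<Rightarrow> nat \<Rightarrow> nat \<Rightarrow> 'a" where
  "diag x i j = (if i = j then x i else 0)"

lemma qmat_diag:
  assumes "\<And>i j. x i * x j = x j * x i"
  shows "qmat n (diag x)"
  unfolding qmat_def diag_def using assms by auto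

lemma one_mat_diag: "one_mat = diag (\<lambda>_. 1)"
  by (simp add: fun_eq_iff one_mat_def diag_def)

lemma qmat_one: "qmat n one_mat"
  unfolding one_mat_diag by (rule qmat_diag) simp

lemma qmat_elem:
  assumes "a * b = q * (b * a)" "b * d = q * (d * b)" "a * d = d * a"
  shows "qmat n (elem s a b d)"
  unfolding qmat_def
proof (intro conjI ballI impI)
  let ?t = "elem s a b d"
  fix i j k :: nat assume "j < k"
  show "?t i j * ?t i k = q * (?t i k * ?t i j)"
    using \<open>j < k\<close> assms(1) by (auto simp: elem_def)
  show "?t j i * ?t k i = q * (?t k i * ?t j i)"
    using \<open>j < k\<close> assms(2) by (auto simp: elem_def)
next
  let ?t = "elem s a b d"
  fix i j k l :: nat assume "i < j" "k < l"
  \<comment> \<open>In this upper bidiagonal matrix the second factor needs k \<ge> j > i and the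
    first l \<le> i + 1, against k < l.\<close>
  have 0: "?t i l = 0 \<or> ?t j k = 0" using \<open>i < j\<close> \<open>k < l\<close> by (auto simp: elem_def)
  thus "?t i l * ?t j k = ?t j k * ?t i l" by auto
  have "?t i k * ?t j l = ?t j l * ?t i k"
    using \<open>i < j\<close> \<open>k < l\<close> assms(3) by (auto simp: elem_def)
  thus "?t i k * ?t j l = ?t j l * ?t i k + (q - p) * (?t i l * ?t j k)" using 0 by auto
qed

lemma mm_elem:
  assumes "s \<in> {1..n}" "k \<in> {1..n}"
  shows "mm n t (elem s a b d) i k
    = t i k * (if k = s then a else if k = Suc s then d else 1) + (if k = Suc s then t i s * b else 0)"
proof -
  have "t i l * elem s a b d l k = (if l = k then t i k * (if k = s then a else if k = Suc s then d else 1) else 0)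
      + (if l = s then if k = Suc s then t i s * b else 0 else 0)" for l
    by (auto simp: elem_def)
  thus ?thesis using assms unfolding mm_def by (simp add: sum.distrib)
qed

lemma mm_diag:
  assumes "i \<in> {1..n}"
  shows "mm n (diag x) t i k = x i * t i k"
proof -
  have "mm n (diag x) t i k = (\<Sum>l\<in>{1..n}. if l = i then x i * t i k else 0)"
    unfolding mm_def diag_def by (intro sum.cong) auto
  thus ?thesis using assms by simp
qed

lemma qd_diag: "qd n (diag x) = prod_list (map x [1..<n + 1])"
  by (subst qd_triangular) (simp_all add: diag_def)

lemma qd_one: "qd n one_mat = 1"
  unfolding one_mat_diag qd_diag by (rule prod_list_one) simp

lemma qd_elem:
  assumes "1 \<le> s" "s < n" "a * d = 1"
  shows "qd n (elem s a b d) = 1"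
proof -
  have 1: "prod_list (map (\<lambda>i. elem s a b d i i) xs) = 1" if "s \<notin> set xs" "Suc s \<notin> set xs" for xs
    by (rule prod_list_one) (use that in \<open>auto simp: elem_def\<close>)
  have "qd n (elem s a b d) = prod_list (map (\<lambda>i. elem s a b d i i) [1..<n + 1])"
    by (rule qd_triangular) (simp add: elem_def)
  also have "\<dots> = elem s a b d s s * elem s a b d (Suc s) (Suc s)"
    using 1[of "[1..<s]"] 1[of "[s + 2..<n + 1]"]
    unfolding upt_split_pair[OF assms(1,2)] map_append prod_list.append list.map
    by (simp del: upt_Suc)
  finally show ?thesis using assms(3) by (simp add: elem_def)
qed

end

locale qrep =
  fixes z :: complex and n :: nat
  assumes z: "z \<noteq> 0"
begin

sublocale central_unit "scal z :: lat oper" "scal (inverse z)"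
  by unfold_locales (rule scal_central, simp add: z flip: scal_mult)

text \<open>The Weyl pair of coordinate \<open>p\<close>: multiplication by z to the power of this
  coordinate, and the unit shift in it. Factors with different coordinates commute.\<close>

definition E :: "nat \<times> nat \<Rightarrow> nat \<Rightarrow> nat \<Rightarrow> nat \<Rightarrow> lat oper" where
  "E p s = elem s (mon (\<lambda>u. z powi Poly_Mapping.lookup u p) 0) (mon (\<lambda>_. 1) (eps p))
     (mon (\<lambda>u. z powi (- Poly_Mapping.lookup u p)) 0)"

lemma qmat_E: "qmat n (E p s)"
  unfolding E_def
proof (rule qmat_elem)
  show "mon (\<lambda>u. z powi Poly_Mapping.lookup u p) 0 * mon (\<lambda>_. 1) (eps p) =
    scal z * (mon (\<lambda>_. 1) (eps p) * mon (\<lambda>u. z powi Poly_Mapping.lookup u p) 0)"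
    by (rule mon_commute_scal) (simp add: lookup_minus z power_int_diff)
  show "mon (\<lambda>_. 1) (eps p) * mon (\<lambda>u. z powi (- Poly_Mapping.lookup u p)) 0 =
    scal z * (mon (\<lambda>u. z powi (- Poly_Mapping.lookup u p)) 0 * mon (\<lambda>_. 1) (eps p))"
    by (rule mon_commute_scal) (simp add: lookup_minus z power_int_diff power_int_add power_int_minus field_simps)
  show "mon (\<lambda>u. z powi Poly_Mapping.lookup u p) 0 * mon (\<lambda>u. z powi (- Poly_Mapping.lookup u p)) 0 =
    mon (\<lambda>u. z powi (- Poly_Mapping.lookup u p)) 0 * mon (\<lambda>u. z powi Poly_Mapping.lookup u p) 0"
    by (simp add: mon_mult mult.commute)
qed

lemma qd_E: "1 \<le> s \<Longrightarrow> s < n \<Longrightarrow> qd n (E p s) = 1"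
  unfolding E_def
  by (rule qd_elem) (simp_all add: mon_mult z power_int_minus mon_one)

lemma loc_E: "E p s i j \<in> loc {p}"
proof -
  have "mon (\<lambda>u. z powi Poly_Mapping.lookup u p) 0 \<in> loc {p}"
    "mon (\<lambda>u. z powi (- Poly_Mapping.lookup u p)) 0 \<in> loc {p}" "mon (\<lambda>_. 1) (eps p) \<in> loc {p}"
    by (rule loc.mon; simp)+
  thus ?thesis by (simp add: E_def elem_def loc_one loc.zero)
qed

lemma loc_mm:
  assumes "\<And>i j. a i j \<in> loc S" "\<And>i j. b i j \<in> loc S'"
  shows "mm n a b i j \<in> loc (S \<union> S')"
  unfolding mm_def by (intro loc_sum loc.mult loc_mono[OF assms(1)] loc_mono[OF assms(2)]) auto

lemma loc_commuting:
  assumes "\<And>i j. a i j \<in> loc S" "\<And>i j. b i j \<in> loc S'" "S \<inter> S' = {}"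
  shows "commuting n a b"
  unfolding commuting_def by (intro ballI loc_commute[OF assms])

section \<open>Staircase products and their leading paths\<close>

primrec stair :: "(nat \<Rightarrow> nat \<times> nat) \<Rightarrow> nat \<Rightarrow> nat \<Rightarrow> nat \<Rightarrow> lat oper" where
  "stair c 0 = one_mat"
| "stair c (Suc s) = mm n (stair c s) (E (c (Suc s)) (Suc s))"

lemma loc_one_mat: "one_mat i j \<in> loc S"
  by (simp add: one_mat_def loc_one loc.zero)

lemma loc_stair: "stair c s i j \<in> loc (c ` {1..s})"
proof (induction s arbitrary: i j)
  case (Suc s)
  have "{1..Suc s} = {1..s} \<union> {Suc s}" by auto
  thus ?case using loc_mm[OF Suc loc_E[of "c (Suc s)" "Suc s"]] by (simp add: image_Un)
qed (simp add: loc_one_mat)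

lemma stair_qmat:
  assumes "inj_on c {1..s}" "s < n \<or> s = 0"
  shows "qmat n (stair c s) \<and> qd n (stair c s) = 1"
  using assms
proof (induction s)
  case (Suc s)
  have "c ` {1..s} \<inter> {c (Suc s)} = {}"
    using inj_onD[OF Suc.prems(1), of _ "Suc s"] by fastforce
  hence comm: "commuting n (stair c s) (E (c (Suc s)) (Suc s))"
    by (rule loc_commuting[OF loc_stair loc_E])
  have "inj_on c {1..s}" using Suc.prems(1) by (rule inj_on_subset) auto
  with Suc show ?case
    by (simp add: qmat_mm[OF _ qmat_E comm] qd_mm[OF qmat_E comm] qd_E)
qed (simp add: qmat_one qd_one)

lemma stair_zero:
  assumes "s < n" "i \<in> {1..n}" "j \<in> {1..n}" "j < i \<or> (i < j \<and> Suc s < j)"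
  shows "stair c s i j = 0"
  using assms
proof (induction s arbitrary: j)
  case 0
  thus ?case by (auto simp: one_mat_def)
next
  case (Suc s)
  have 1: "stair c s i j = 0" by (rule Suc.IH) (use Suc.prems in auto)
  have 2: "stair c s i (Suc s) = 0" if "j = Suc (Suc s)" 
    by (rule Suc.IH) (use Suc.prems that in auto)
  show ?case using Suc.prems 1 2 by (simp add: E_def mm_elem)
qed

text \<open>Only one path leads from i to j through the elementary factors 1, ..., s: one step in
  each of the factors i, ..., j-1. The diagonal entries met on the way shift nothing.\<close>

lemma stair_raises:
  assumes "s < n" "i \<in> {1..n}" "j \<in> {1..n}" "i \<le> j" "i = j \<or> j \<le> Suc s"
  shows "raises n (\<Sum>t\<in>{i..<j}. eps (c t)) (stair c s i j)"
  using assms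
proof (induction s arbitrary: j)
  case 0
  thus ?case by (auto simp: one_mat_def raises_one)
next
  case (Suc s)
  let ?p = "c (Suc s)"
  have diag: "raises n 0 (if j = Suc s then mon (\<lambda>u. z powi Poly_Mapping.lookup u ?p) 0
      else if j = Suc (Suc s) then mon (\<lambda>u. z powi (- Poly_Mapping.lookup u ?p)) 0 else 1)"
    using z by (simp add: raises_mon raises_one)
  have eq: "stair c (Suc s) i j = stair c s i j * (if j = Suc s then mon (\<lambda>u. z powi Poly_Mapping.lookup u ?p) 0
      else if j = Suc (Suc s) then mon (\<lambda>u. z powi (- Poly_Mapping.lookup u ?p)) 0 else 1)
      + (if j = Suc (Suc s) then stair c s i (Suc s) * mon (\<lambda>_. 1) (eps ?p) else 0)"
    using Suc.prems by (simp only: stair.simps E_def) (rule mm_elem, auto)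
  show ?case
  proof (cases "j = Suc (Suc s) \<and> i < j")
    case False
    have "raises n (\<Sum>t\<in>{i..<j}. eps (c t)) (stair c s i j)"
      by (rule Suc.IH) (use Suc.prems False in auto)
    moreover have "j = Suc (Suc s) \<Longrightarrow> stair c s i (Suc s) = 0"
      by (rule stair_zero) (use Suc.prems False in auto)
    ultimately show ?thesis unfolding eq using raises_mult[OF _ diag] by fastforce
  next
    case True
    have "stair c s i j = 0" by (rule stair_zero) (use Suc.prems True in auto)
    moreover have "raises n (\<Sum>t\<in>{i..<Suc s}. eps (c t)) (stair c s i (Suc s))"
      by (rule Suc.IH) (use Suc.prems True in auto)
    hence "raises n ((\<Sum>t\<in>{i..<Suc s}. eps (c t)) + eps ?p) (stair c s i (Suc s) * mon (\<lambda>_. 1) (eps ?p))"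
      by (intro raises_mult raises_mon) auto
    ultimately show ?thesis unfolding eq using True by simp
  qed
qed

text \<open>The factorisation along the reduced word of the longest permutation; c k s is the coordinate
  carrying the Weyl pair of the s-th elementary factor of the k-th staircase.\<close>

primrec W :: "(nat \<Rightarrow> nat \<Rightarrow> nat \<times> nat) \<Rightarrow> nat \<Rightarrow> nat \<Rightarrow> nat \<Rightarrow> lat oper" where
  "W c 0 = one_mat"
| "W c (Suc m) = mm n (stair (c (Suc m)) (Suc m)) (W c m)"

definition coords :: "(nat \<Rightarrow> nat \<Rightarrow> nat \<times> nat) \<Rightarrow> nat \<Rightarrow> (nat \<times> nat) set" where
  "coords c m = {c k s | k s. 1 \<le> s \<and> s \<le> k \<and> k \<le> m}"

lemma coords_Suc: "coords c (Suc m) = c (Suc m) ` {1..Suc m} \<union> coords c m"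
  by (force simp: coords_def le_Suc_eq)

lemma loc_W: "W c m i j \<in> loc (coords c m)"
proof (induction m arbitrary: i j)
  case (Suc m)
  show ?case unfolding coords_Suc W.simps by (rule loc_mm) (rule loc_stair, rule Suc)
qed (simp add: loc_one_mat)

lemma W_qmat:
  assumes inj: "\<And>k s k' s'. 1 \<le> s \<Longrightarrow> s \<le> k \<Longrightarrow> 1 \<le> s' \<Longrightarrow> s' \<le> k' \<Longrightarrow> c k s = c k' s' \<Longrightarrow> k = k' \<and> s = s'"
    and "m < n \<or> m = 0"
  shows "qmat n (W c m) \<and> qd n (W c m) = 1"
  using assms(2)
proof (induction m)
  case (Suc m)
  have "c (Suc m) ` {1..Suc m} \<inter> coords c m = {}"
    using inj[of _ "Suc m"] by (fastforce simp: coords_def)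
  hence comm: "commuting n (stair (c (Suc m)) (Suc m)) (W c m)"
    by (rule loc_commuting[OF loc_stair loc_W])
  have "inj_on (c (Suc m)) {1..Suc m}" using inj by (auto simp: inj_on_def)
  from stair_qmat[OF this] have "qmat n (stair (c (Suc m)) (Suc m))" "qd n (stair (c (Suc m)) (Suc m)) = 1"
    using Suc.prems by auto
  moreover have "qmat n (W c m)" "qd n (W c m) = 1" using Suc by auto
  ultimately show ?case by (simp only: W.simps qmat_mm[OF _ _ comm] qd_mm[OF _ comm] mult_1_left)
qed (simp add: qmat_one qd_one)

lemma W_zero:
  assumes "m < n" "i \<in> {1..n}" "j \<in> {1..n}" "j < i \<or> (i < j \<and> Suc m < j)"
  shows "W c m i j = 0"
  using assms
proof (induction m arbitrary: i)
  case 0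
  thus ?case by (auto simp: one_mat_def)
next
  case (Suc m)
  have "stair (c (Suc m)) (Suc m) i k * W c m k j = 0" if k: "k \<in> {1..n}" for k
  proof (cases "k < i \<or> (i < k \<and> Suc (Suc m) < k)")
    case True
    hence "stair (c (Suc m)) (Suc m) i k = 0" using Suc.prems k by (intro stair_zero) auto
    thus ?thesis by simp
  next
    case False
    hence "W c m k j = 0" using Suc.prems k by (intro Suc.IH) auto
    thus ?thesis by simp
  qed
  thus ?case by (simp add: mm_def del: stair.simps)
qed

text \<open>All steps are made in the staircase j-1, the smallest one that reaches column j.\<close>

definition path :: "(nat \<Rightarrow> nat \<Rightarrow> nat \<times> nat) \<Rightarrow> nat \<Rightarrow> nat \<Rightarrow> lat" where
  "path c i j = (\<Sum>t\<in>{i..<j}. eps (c (j - 1) t))"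

lemma path_self [simp]: "path c i i = 0"
  by (simp add: path_def)

lemma weight_path:
  assumes wt: "\<And>k s. 1 \<le> s \<Longrightarrow> s \<le> k \<Longrightarrow> k < n \<Longrightarrow> weight n (eps (c k s)) = - int k"
    and "1 \<le> k" "k \<le> j" "j \<le> n"
  shows "weight n (path c k j) = - int (j - 1) * int (j - k)"
proof -
  have "(\<Sum>t\<in>{k..<j}. weight n (eps (c (j - 1) t))) = (\<Sum>t\<in>{k..<j}. - int (j - 1))"
    by (intro sum.cong refl wt) (use assms in auto)
  thus ?thesis unfolding path_def weight_sum by (simp only: sum_constant card_atLeastLessThan mult.commute)
qed

text \<open>A step in the staircase k weighs -k and j - i steps are needed, so the heaviest path
  makes them as late as possible in the product, where the staircases are small.\<close>

lemma W_raises: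
  assumes wt: "\<And>k s. 1 \<le> s \<Longrightarrow> s \<le> k \<Longrightarrow> k < n \<Longrightarrow> weight n (eps (c k s)) = - int k"
    and "m < n" "i \<in> {1..n}" "j \<in> {1..n}" "i \<le> j" "i = j \<or> j \<le> Suc m"
  shows "raises n (path c i j) (W c m i j)"
  using assms(2-)
proof (induction m arbitrary: i)
  case 0
  thus ?case by (auto simp: one_mat_def raises_one)
next
  case (Suc m)
  let ?s = "stair (c (Suc m)) (Suc m)"
  let ?v = "\<lambda>k. (\<Sum>t\<in>{i..<k}. eps (c (Suc m) t)) + path c k j"
  \<comment> \<open>The position after the largest staircase on the heaviest path: column m+2 can be
    reached only there, while any other j is left to the smaller staircases.\<close>
  define k0 where "k0 = (if j = Suc (Suc m) then j else i)"
  have k0: "k0 \<in> {1..n}" "i \<le> k0" "k0 \<le> j" "i = k0 \<or> k0 \<le> Suc (Suc m)" "k0 = j \<or> j \<le> Suc m"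
    using Suc.prems by (auto simp: k0_def)
  have main: "raises n (?v k) (?s i k * W c m k j)"
    if "k \<in> {1..n}" "i \<le> k" "k \<le> j" "i = k \<or> k \<le> Suc (Suc m)" "k = j \<or> j \<le> Suc m" for k
    using that Suc.prems by (intro raises_mult stair_raises Suc.IH) auto
  have "raises n (?v k0) (\<Sum>k\<in>{1..n}. ?s i k * W c m k j)"
  proof (rule raises_sum[where w = ?v and k = k0])
    show "raises n (?v k0) (?s i k0 * W c m k0 j)" by (rule main) (use k0 in auto)
    fix k assume k: "k \<in> {1..n}" "k \<noteq> k0"
    show "?s i k * W c m k j = 0 \<or> raises n (?v k) (?s i k * W c m k j) \<and> weight n (?v k) < weight n (?v k0)"
    proof (cases "(k < i \<or> (i < k \<and> Suc (Suc m) < k)) \<or> j < k \<or> (k < j \<and> Suc m < j)")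
      case True
      thus ?thesis
        using stair_zero[of "Suc m" i k "c (Suc m)"] W_zero[of m k j c] Suc.prems k by auto
    next
      case False
      hence kj: "i < k" "k \<le> j" "k \<le> Suc (Suc m)" "j \<le> Suc m" "k0 = i"
        using k Suc.prems by (auto simp: k0_def split: if_splits)
      have W1: "weight n (\<Sum>t\<in>{i..<k}. eps (c (Suc m) t)) = - int (Suc m) * int (k - i)"
      proof -
        have "(\<Sum>t\<in>{i..<k}. weight n (eps (c (Suc m) t))) = (\<Sum>t\<in>{i..<k}. - int (Suc m))"
          by (intro sum.cong refl wt) (use Suc.prems kj in auto)
        thus ?thesis unfolding weight_sum by (simp only: sum_constant card_atLeastLessThan mult.commute)
      qed
      have W2: "weight n (path c k' j) = - int (j - 1) * int (j - k')" if "k' \<in> {1..j}" for k'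
        by (rule weight_path[OF wt]) (use that Suc.prems in auto)
      have "weight n (?v k) = - int (Suc m) * int (k - i) - int (j - 1) * int (j - k)"
      proof -
        have "k \<in> {1..j}" using kj by simp
        show ?thesis unfolding weight_add W1 W2[OF \<open>k \<in> {1..j}\<close>] by simp
      qed
      \<comment> \<open>A step in the staircase m+1 weighs -(m+1), less than the -(j-1) of a
        postponed one.\<close>
      also have "\<dots> < - int (j - 1) * int (k - i) - int (j - 1) * int (j - k)"
        using kj Suc.prems by (simp add: mult_strict_right_mono)
      also have "\<dots> = - int (j - 1) * int (j - i)"
        using kj by (simp add: of_nat_diff algebra_simps)
      also have "\<dots> = weight n (?v k0)" using W2[of i] Suc.prems by (simp add: kj(5))
      finally show ?thesis using main[of k] k kj by auto
    qed
  qed (use k0 in auto)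
  moreover have "?v k0 = path c i j" by (auto simp: k0_def path_def)
  ultimately show ?case by (simp add: mm_def del: stair.simps)
qed

end

section \<open>A representation of the quantum general linear group\<close>

context qrep
begin

text \<open>Column m+1 above the diagonal for \<open>U\<close>, row m+1 below it for
  \<open>Lo\<close>; with the diagonal for \<open>X\<close> each of the n^2 coordinates is used
  once.\<close>

abbreviation cU :: "nat \<Rightarrow> nat \<Rightarrow> nat \<times> nat" where "cU m s \<equiv> (s, Suc m)"
abbreviation cL :: "nat \<Rightarrow> nat \<Rightarrow> nat \<times> nat" where "cL m s \<equiv> (Suc m, s)"

definition U :: "nat \<Rightarrow> nat \<Rightarrow> lat oper" where "U = W cU (n - 1)"
definition Lo :: "nat \<Rightarrow> nat \<Rightarrow> lat oper" where "Lo i j = W cL (n - 1) j i"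
definition X :: "nat \<Rightarrow> nat \<Rightarrow> lat oper" where "X = diag (\<lambda>i. mon (\<lambda>_. 1) (eps (i, i)))"
definition TT :: "nat \<Rightarrow> nat \<Rightarrow> lat oper" where "TT = mm n Lo (mm n X U)"
definition delta :: lat where "delta = (\<Sum>i\<in>{1..n}. eps (i, i))"
definition Zop :: "lat oper" where "Zop = mon (\<lambda>_. 1) (- delta)"

lemma loc_U: "U i j \<in> loc {(a, b). a < b}"
proof -
  have "coords cU (n - 1) \<subseteq> {(a, b). a < b}" by (auto simp: coords_def)
  thus ?thesis unfolding U_def using loc_mono[OF loc_W] by blast
qed

lemma loc_Lo: "Lo i j \<in> loc {(a, b). b < a}"
proof -
  have "coords cL (n - 1) \<subseteq> {(a, b). b < a}" by (auto simp: coords_def)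
  thus ?thesis unfolding Lo_def using loc_mono[OF loc_W] by blast
qed

lemma loc_X: "X i j \<in> loc {(a, b). a = b}"
  unfolding X_def diag_def by (auto intro!: loc.mon loc.zero)

lemma lookup_delta:
  "Poly_Mapping.lookup delta (a, b) = (if a = b \<and> a \<in> {1..n} then 1 else 0)"
proof -
  have "Poly_Mapping.lookup delta (a, b) = (\<Sum>i\<in>{1..n}. if i = a then if a = b then 1 else 0 else 0)"
    unfolding delta_def lookup_sum by (intro sum.cong) (auto simp: lookup_single when_def)
  thus ?thesis by auto
qed

lemma loc_Zop: "Zop \<in> loc {(a, b). a = b}"
  unfolding Zop_def
proof (rule loc.mon)
  show "Poly_Mapping.keys (- delta) \<subseteq> {(a, b). a = b}"
    by (auto simp: in_keys_iff lookup_delta split: if_splits)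
qed simp

lemma loc_XU: "mm n X U i j \<in> loc ({(a, b). a = b} \<union> {(a, b). a < b})"
  by (rule loc_mm) (rule loc_X, rule loc_U)

lemma U_facts: "qmat n U" "qd n U = 1"
  unfolding U_def by (rule W_qmat[THEN conjunct1] W_qmat[THEN conjunct2]; auto)+

lemma Lo_qmat: "qmat n Lo"
  unfolding Lo_def by (rule qmat_transpose, rule W_qmat[THEN conjunct1]) auto

text \<open>For a triangular matrix the quantum determinant is the product of the diagonal entries,
  which transposition does not change.\<close>

lemma Lo_qd: "qd n Lo = 1"
proof -
  let ?W = "W cL (n - 1)"
  have zero: "?W i j = 0" if "i \<in> {1..n}" "j \<in> {1..n}" "j < i" for i j
    by (rule W_zero) (use that in auto)
  have "qd n Lo = prod_list (map (\<lambda>i. ?W i i) [1..<n + 1])"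
    unfolding Lo_def by (rule qd_triangular) (use zero in blast)
  also have "\<dots> = qd n ?W" by (rule qd_triangular[symmetric]) (use zero in blast)
  also have "\<dots> = 1" by (rule W_qmat[THEN conjunct2]) auto
  finally show ?thesis .
qed

lemma X_qmat: "qmat n X"
  unfolding X_def by (rule qmat_diag) (simp add: mon_mult add.commute)

lemma prod_list_mon_one: "prod_list (map (\<lambda>i. mon (\<lambda>_. 1) (f i)) xs) = mon (\<lambda>_. 1) (sum_list (map f xs))"
  by (induction xs) (simp_all add: mon_one mon_mult)

lemma X_qd: "qd n X = mon (\<lambda>_. 1) delta"
proof -
  have "sum_list (map (\<lambda>i. eps (i, i)) [1..<n + 1]) = (\<Sum>i\<in>set [1..<n + 1]. eps (i, i))"
    by (rule sum_list_distinct_conv_sum_set) simp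
  also have "set [1..<n + 1] = {1..n}" by auto
  finally show ?thesis unfolding X_def qd_diag prod_list_mon_one delta_def by (simp only:)
qed

lemma comm_XU: "commuting n X U"
  by (rule loc_commuting[OF loc_X loc_U]) auto

lemma comm_L_XU: "commuting n Lo (mm n X U)"
  by (rule loc_commuting[OF loc_Lo loc_XU]) auto

lemma TT_qmat: "qmat n TT"
  unfolding TT_def by (intro qmat_mm Lo_qmat X_qmat U_facts comm_XU comm_L_XU)

lemma TT_qd: "qd n TT = mon (\<lambda>_. 1) delta"
  unfolding TT_def
  by (simp only: qd_mm[OF qmat_mm[OF X_qmat U_facts(1) comm_XU] comm_L_XU] qd_mm[OF U_facts(1) comm_XU]
      Lo_qd X_qd U_facts(2) mult_1_left mult_1_right)

lemma Zop_qd: "Zop * qd n TT = 1" "qd n TT * Zop = 1"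
  unfolding TT_qd Zop_def mon_mult by (simp_all add: mon_one)

lemma commute_mm:
  assumes "\<And>i j. x * a i j = a i j * x" "\<And>i j. x * b i j = b i j * x"
  shows "x * mm n a b i j = mm n a b i j * x"
proof -
  have "x * (a i k * b k j) = a i k * b k j * x" for k
    by (rule commute_mult[symmetric]) (simp_all only: assms)
  thus ?thesis by (simp add: mm_def sum_distrib_left sum_distrib_right)
qed

lemma Zop_commute: "Zop * TT i j = TT i j * Zop"
  unfolding TT_def
proof (intro commute_mm)
  fix i j
  show "Zop * Lo i j = Lo i j * Zop" by (rule loc_commute[OF loc_Zop loc_Lo]) auto
  show "Zop * U i j = U i j * Zop" by (rule loc_commute[OF loc_Zop loc_U]) auto
  show "Zop * X i j = X i j * Zop" by (simp add: Zop_def X_def diag_def mon_mult)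
qed

text \<open>The exponent of the term k = \<open>min i j\<close> in the sum of Lo(i,k) X(k,k)
  U(k,j).\<close>

definition tv :: "nat \<Rightarrow> nat \<Rightarrow> lat" where
  "tv i j = path cL (min i j) i + (eps (min i j, min i j) + path cU (min i j) j)"

lemma weight_cU: "1 \<le> s \<Longrightarrow> s \<le> k \<Longrightarrow> k < n \<Longrightarrow> weight n (eps (cU k s)) = - int k"
  and weight_cL: "1 \<le> s \<Longrightarrow> s \<le> k \<Longrightarrow> k < n \<Longrightarrow> weight n (eps (cL k s)) = - int k"
  by (subst weight_eps; simp)+

text \<open>By triangularity only k \<le> min i j contributes, and the largest such k makes both
  paths shortest.\<close>

lemma TT_raises:
  assumes ij: "i \<in> {1..n}" "j \<in> {1..n}"
  shows "raises n (tv i j) (TT i j)"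
proof -
  let ?v = "\<lambda>k. path cL k i + (eps (k, k) + path cU k j)"
  let ?F = "\<lambda>k. Lo i k * (mon (\<lambda>_. 1) (eps (k, k)) * U k j)"
  have TT: "TT i j = (\<Sum>k\<in>{1..n}. ?F k)"
    unfolding TT_def mm_def[of n Lo] by (rule sum.cong[OF refl]) (simp only: X_def mm_diag)
  have main: "raises n (?v k) (?F k)" if "1 \<le> k" "k \<le> i" "k \<le> j" for k
    unfolding Lo_def U_def
    by (intro raises_mult raises_mon W_raises weight_cL weight_cU) (use that ij in auto)
  have wt: "weight n (?v k) = - (int (i - 1) * int (i - k)) - int (j - 1) * int (j - k)"
    if "1 \<le> k" "k \<le> i" "k \<le> j" for k
  proof -
    have "weight n (eps (k, k)) = 0" using that ij by (subst weight_eps) auto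
    moreover have "weight n (path cL k i) = - int (i - 1) * int (i - k)"
      by (rule weight_path[OF weight_cL]) (use that ij in auto)
    moreover have "weight n (path cU k j) = - int (j - 1) * int (j - k)"
      by (rule weight_path[OF weight_cU]) (use that ij in auto)
    ultimately show ?thesis unfolding weight_add by simp
  qed
  have "raises n (?v (min i j)) (\<Sum>k\<in>{1..n}. ?F k)"
  proof (rule raises_sum[where w = ?v and k = "min i j"])
    show "raises n (?v (min i j)) (?F (min i j))" by (rule main) (use ij in auto)
    fix k assume k: "k \<in> {1..n}" "k \<noteq> min i j"
    show "?F k = 0 \<or> raises n (?v k) (?F k) \<and> weight n (?v k) < weight n (?v (min i j))"
    proof (cases "k < min i j")
      case True
      \<comment> \<open>Strict because 1 \<le> k < i makes i - 1 positive.\<close>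
      have "int (i - 1) * int (i - min i j) < int (i - 1) * int (i - k)"
        using True k by (intro mult_strict_left_mono) auto
      moreover have "int (j - 1) * int (j - min i j) \<le> int (j - 1) * int (j - k)"
        using True by (intro mult_left_mono) auto
      moreover have "weight n (?v k) = - (int (i - 1) * int (i - k)) - int (j - 1) * int (j - k)"
        by (rule wt) (use True k in auto)
      moreover have "weight n (?v (min i j))
          = - (int (i - 1) * int (i - min i j)) - int (j - 1) * int (j - min i j)"
        by (rule wt) (use ij in auto)
      ultimately have "weight n (?v k) < weight n (?v (min i j))" by linarith
      thus ?thesis using main[of k] True k by auto
    next
      case False
      hence "Lo i k = 0 \<or> U k j = 0"
        unfolding Lo_def U_def using W_zero[of "n - 1" k i cL] W_zero[of "n - 1" k j cU] k ij
        by (auto simp: min_def split: if_splits)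
      thus ?thesis by auto
    qed
  qed (use ij in auto)
  thus ?thesis unfolding TT tv_def .
qed

lemma Zop_raises: "raises n (- delta) Zop"
  unfolding Zop_def by (rule raises_mon) simp

section \<open>The representation of the free algebra\<close>

fun gop :: "gen \<Rightarrow> lat oper" where
  "gop (T i j) = TT i j"
| "gop Z = Zop"

definition wop :: "gen list \<Rightarrow> lat oper" where
  "wop w = prod_list (map gop w)"

lemma wop_append: "wop (u @ v) = wop u * wop v"
  by (simp add: wop_def)

definition Phi :: "fa \<Rightarrow> lat oper" where
  "Phi x = (\<Sum>k\<in>Poly_Mapping.keys x. scal (ev z (Poly_Mapping.lookup x k)) * (case k of Wd w \<Rightarrow> wop w))"

lemma Phi_superset:
  assumes "finite A" "Poly_Mapping.keys x \<subseteq> A"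
  shows "Phi x = (\<Sum>k\<in>A. scal (ev z (Poly_Mapping.lookup x k)) * (case k of Wd w \<Rightarrow> wop w))"
  unfolding Phi_def by (rule sum.mono_neutral_left) (use assms in \<open>auto simp: in_keys_iff\<close>)

lemma Phi_0 [simp]: "Phi 0 = 0"
  by (simp add: Phi_def)

lemma Phi_add: "Phi (x + y) = Phi x + Phi y"
proof -
  let ?A = "Poly_Mapping.keys x \<union> Poly_Mapping.keys y"
  have "Poly_Mapping.keys (x + y) \<subseteq> ?A" by (rule keys_add)
  thus ?thesis
    by (simp add: Phi_superset[of ?A] lookup_add ev_add scal_add distrib_right sum.distrib)
qed

lemma Phi_diff: "Phi (x - y) = Phi x - Phi y"
  using Phi_add[of "x - y" y] by simp

lemma Phi_sum: "Phi (sum f A) = (\<Sum>k\<in>A. Phi (f k))"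
  by (induction A rule: infinite_finite_induct) (simp_all add: Phi_add)

lemma Phi_word: "Phi (sc c * gw w) = scal (ev z c) * wop w"
  by (cases "c = 0") (simp_all add: sc_gw Phi_def)

lemma Phi_sc: "Phi (sc c) = scal (ev z c)"
  using Phi_word[of c "[]"] by (simp add: wop_def)

lemma Phi_gw: "Phi (gw w) = wop w"
  using Phi_word[of 1 w] by simp

lemma Phi_1 [simp]: "Phi 1 = 1"
  using Phi_gw[of "[]"] by (simp add: wop_def)

lemma Phi_mult: "Phi (x * y) = Phi x * Phi y"
proof (induction x rule: fa_induct)
  case (word c w)
  show ?case
  proof (induction y rule: fa_induct)
    case (word d v)
    have "sc c * gw w * (sc d * gw v) = sc (c * d) * gw (w @ v)"
      by (simp only: sc_mult mult.assoc sc_left_commute[of "gw w"] flip: gw_mult)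
    moreover have "scal a * wop w * (scal b * wop v) = scal (a * b) * (wop w * wop v)" for a b
      using scal_central[of b "wop w"] by (simp add: scal_mult mult.assoc) (simp flip: mult.assoc)
    ultimately show ?case by (simp only: Phi_word ev_mult wop_append)
  qed (simp_all add: distrib_left Phi_add)
qed (simp_all add: distrib_right Phi_add)

lemma Phi_power: "Phi (x ^ k) = Phi x ^ k"
  by (induction k) (simp_all add: Phi_mult)

lemma Phi_tt: "Phi (tt i j) = TT i j"
  by (simp add: Phi_gw wop_def)

lemma Phi_Z: "Phi (gw [Z]) = Zop"
  by (simp add: Phi_gw wop_def)

lemma Phi_qq: "Phi qq = scal z"
  by (simp add: Phi_sc)

lemma Phi_qdet: "Phi (qdet n) = qd n TT"
  unfolding qdet_def qdf_def Phi_sum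
proof (rule sum.cong[OF refl])
  fix \<sigma>
  have "scal (ev z ((- [:0, 1:]) ^ k)) = (- scal z :: lat oper) ^ k" for k
    by (simp only: ev_power ev_uminus ev_X scal_power scal_uminus)
  thus "Phi (sc ((- [:0, 1:]) ^ perm_length n \<sigma>) * gw (map (\<lambda>i. T i (\<sigma> i)) [1..<n + 1]))
     = (- scal z) ^ perm_length n \<sigma> * prod_list (map (\<lambda>i. TT i (\<sigma> i)) [1..<n + 1])"
    unfolding Phi_word wop_def map_map o_def gop.simps by (simp only:)
qed

text \<open>Matches the correction coefficient q^2 - 1 of \<open>relsM\<close> with the q - q^(-1)
  of \<open>qmat\<close>.\<close>

lemma scal_square_minus_1: "(scal z :: lat oper) ^ 2 - 1 = scal z * (scal z - scal (inverse z))"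
  using qp by (simp add: power2_eq_square right_diff_distrib)

lemma Phi_relsM:
  assumes "ev z (cyclo ell) = 0" "r \<in> relsM ell n"
  shows "Phi r = 0"
proof -
  note D = qmatD[OF TT_qmat]
  note P = Phi_diff Phi_mult Phi_tt Phi_qq Phi_power Phi_1
  show ?thesis
    using assms(2) unfolding relsM_def
  proof (elim UnE CollectE exE conjE)
    fix i j k assume r: "r = tt i j * tt i k - qq * tt i k * tt i j"
      and *: "i \<in> {1..n}" "j \<in> {1..n}" "k \<in> {1..n}" "j < k"
    show ?thesis unfolding r P using D(1)[OF *] by (simp add: mult.assoc)
  next
    fix i h k assume r: "r = tt i k * tt h k - qq * tt h k * tt i k"
      and *: "i \<in> {1..n}" "h \<in> {1..n}" "k \<in> {1..n}" "i < h"
    show ?thesis unfolding r P using D(2)[OF *(3,1,2,4)] by (simp add: mult.assoc)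
  next
    fix i j k l assume r: "r = tt i l * tt j k - tt j k * tt i l"
      and *: "i \<in> {1..n}" "j \<in> {1..n}" "k \<in> {1..n}" "l \<in> {1..n}" "i < j" "k < l"
    show ?thesis unfolding r P using D(3)[OF *] by simp
  next
    fix i j k l
    assume r: "r = qq * tt i k * tt j l - qq * tt j l * tt i k - (qq ^ 2 - 1) * tt i l * tt j k"
      and *: "i \<in> {1..n}" "j \<in> {1..n}" "k \<in> {1..n}" "l \<in> {1..n}" "i < j" "k < l"
    show ?thesis unfolding r P scal_square_minus_1 mult.assoc D(4)[OF *] distrib_left by simp
  next
    assume "r \<in> {sc (cyclo ell)}"
    thus ?thesis using assms(1) by (simp add: Phi_sc)
  qed
qed

lemma Phi_relsGL:
  assumes "ev z (cyclo ell) = 0" "r \<in> relsGL ell n"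
  shows "Phi r = 0"
proof -
  note P = Phi_diff Phi_mult Phi_tt Phi_Z Phi_qdet Phi_1
  show ?thesis
    using assms(2) unfolding relsGL_def
  proof (elim UnE CollectE exE conjE)
    assume "r \<in> relsM ell n"
    thus ?thesis by (rule Phi_relsM[OF assms(1)])
  next
    fix i j assume r: "r = gw [Z] * tt i j - tt i j * gw [Z]"
    show ?thesis unfolding r P Zop_commute by simp
  next
    assume "r \<in> {gw [Z] * qdet n - 1, qdet n * gw [Z] - 1}"
    hence "r = gw [Z] * qdet n - 1 \<or> r = qdet n * gw [Z] - 1" by blast
    thus ?thesis by (elim disjE) (simp_all only: P Zop_qd diff_self)
  qed
qed

text \<open>\<open>Phi\<close> is multiplicative and kills the relations, so it factors through the
  quotient algebra.\<close>

lemma Phi_tideal: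
  assumes "ev z (cyclo ell) = 0" "x \<in> tideal (relsGL ell n)"
  shows "Phi x = 0"
  using assms(2) by induction (simp_all add: Phi_relsGL[OF assms(1)] Phi_add Phi_mult)

fun gexp :: "gen \<Rightarrow> lat" where
  "gexp (T i j) = tv i j"
| "gexp Z = - delta"

definition wexp :: "gen list \<Rightarrow> lat" where
  "wexp w = sum_list (map gexp w)"

lemma wexp_append: "wexp (u @ v) = wexp u + wexp v"
  by (simp add: wexp_def)

lemma wop_raises: "set w \<subseteq> insert Z (letters n) \<Longrightarrow> raises n (wexp w) (wop w)"
proof (induction w)
  case Nil
  show ?case by (simp add: wexp_def wop_def raises_one)
next
  case (Cons x w)
  have "raises n (gexp x) (gop x)"
    using Cons.prems by (cases x) (auto simp: Zop_raises TT_raises)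
  with Cons show ?case by (auto simp: wexp_def wop_def intro: raises_mult)
qed

lemma lookup_cU: "1 \<le> j \<Longrightarrow> Poly_Mapping.lookup (path cU k j) (a, b) = (if b = j \<and> k \<le> a \<and> a < j then 1 else 0)"
proof -
  assume "1 \<le> j"
  have "Poly_Mapping.lookup (path cU k j) (a, b) = (\<Sum>t\<in>{k..<j}. if t = a then if b = j then 1 else 0 else 0)"
    unfolding path_def lookup_sum
    by (intro sum.cong) (use \<open>1 \<le> j\<close> in \<open>auto simp: lookup_single when_def\<close>)
  thus ?thesis by auto
qed

lemma lookup_cL: "1 \<le> i \<Longrightarrow> Poly_Mapping.lookup (path cL k i) (a, b) = (if a = i \<and> k \<le> b \<and> b < i then 1 else 0)"
proof -
  assume "1 \<le> i"
  have "Poly_Mapping.lookup (path cL k i) (a, b) = (\<Sum>t\<in>{k..<i}. if t = b then if a = i then 1 else 0 else 0)"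
    unfolding path_def lookup_sum
    by (intro sum.cong) (use \<open>1 \<le> i\<close> in \<open>auto simp: lookup_single when_def\<close>)
  thus ?thesis by auto
qed

text \<open>Off the diagonal these are indicators of initial segments of a column or of a row, so
  the coordinates of a word's exponent become partial sums of letter counts.\<close>

lemma lookup_tv:
  assumes "1 \<le> i" "1 \<le> j"
  shows "Poly_Mapping.lookup (tv i j) (a, b) =
    (if a < b then if j = b \<and> i \<le> a then 1 else 0
     else if b < a then if i = a \<and> j \<le> b then 1 else 0
     else if min i j = a then 1 else 0)"
  unfolding tv_def lookup_add lookup_cU[OF assms(2)] lookup_cL[OF assms(1)] lookup_single when_def
  by (auto simp: min_def)

end

section \<open>Linear independence\<close>

lemma sum_initial_eqD:
  fixes f g :: "nat \<Rightarrow> int"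
  assumes "\<And>t. t \<le> s \<Longrightarrow> (\<Sum>i\<in>{1..t}. f i) = (\<Sum>i\<in>{1..t}. g i)" "1 \<le> s"
  shows "f s = g s"
proof -
  obtain t where t: "s = Suc t" using assms(2) by (cases s) auto
  show ?thesis using assms(1)[of s] assms(1)[of t] by (simp add: t)
qed

locale qmatrix_rep = qmatrix_order ell n ps + qrep z n for ell n ps z +
  assumes root: "z \<in> primroots ell"
begin

definition owd :: "(nat \<times> nat \<Rightarrow> nat) \<Rightarrow> gen list" where
  "owd A = concat (map (\<lambda>(i, j). replicate (A (i, j)) (T i j)) ps)"

lemma omon_owd: "omon ps A = gw (owd A)"
  by (simp add: omon_def owd_def)

lemma set_owd: "set (owd A) \<subseteq> letters n"
proof
  fix x assume "x \<in> set (owd A)"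
  then obtain i j where "(i, j) \<in> set ps" "x = T i j" by (auto simp: owd_def in_set_replicate)
  moreover from this ps(2) have "i \<in> {1..n}" "j \<in> {1..n}" by auto
  ultimately show "x \<in> letters n" by blast
qed

lemma lookup_wexp_replicate:
  "Poly_Mapping.lookup (wexp (replicate k x)) p = int k * Poly_Mapping.lookup (gexp x) p"
  by (induction k) (simp_all add: wexp_def lookup_add algebra_simps)

lemma lookup_wexp_owd:
  "Poly_Mapping.lookup (wexp (owd A)) p
    = (\<Sum>i\<in>{1..n}. \<Sum>j\<in>{1..n}. int (A (i, j)) * Poly_Mapping.lookup (tv i j) p)"
proof -
  have "Poly_Mapping.lookup (wexp (concat (map (\<lambda>(i, j). replicate (A (i, j)) (T i j)) qs))) p
      = (\<Sum>(i, j)\<leftarrow>qs. int (A (i, j)) * Poly_Mapping.lookup (tv i j) p)" for qs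
  proof (induction qs)
    case (Cons r qs)
    obtain i j where "r = (i, j)" by fastforce
    with Cons show ?case by (simp add: wexp_append lookup_add lookup_wexp_replicate)
  qed (simp add: wexp_def)
  hence "Poly_Mapping.lookup (wexp (owd A)) p
      = (\<Sum>(i, j)\<in>set ps. int (A (i, j)) * Poly_Mapping.lookup (tv i j) p)"
    unfolding owd_def using ps(1) by (simp add: sum_list_distinct_conv_sum_set)
  thus ?thesis by (simp add: ps(2) sum.cartesian_product)
qed

definition expo :: "(nat \<times> nat \<Rightarrow> nat) \<Rightarrow> nat \<Rightarrow> lat" where
  "expo A k = wexp (owd A) + wexp (replicate k Z)"

lemma lookup_expo:
  assumes "a \<in> {1..n}" "b \<in> {1..n}"
  shows "Poly_Mapping.lookup (expo A k) (a, b) =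
    (if a < b then \<Sum>i\<in>{1..a}. int (A (i, b))
     else if b < a then \<Sum>j\<in>{1..b}. int (A (a, j))
     else (\<Sum>i\<in>{1..n}. \<Sum>j\<in>{1..n}. if min i j = a then int (A (i, j)) else 0) - int k)"
proof -
  have restrict: "(\<Sum>i\<in>{1..n}. if i \<le> c then f i else 0) = (\<Sum>i\<in>{1..c}. f i)" if "c \<in> {1..n}"
    for c and f :: "nat \<Rightarrow> int"
    using that by (intro sum.mono_neutral_cong_right) auto
  have "Poly_Mapping.lookup (wexp (owd A)) (a, b)
      = (\<Sum>i\<in>{1..n}. \<Sum>j\<in>{1..n}. int (A (i, j)) * (if a < b then if j = b \<and> i \<le> a then 1 else 0
         else if b < a then if i = a \<and> j \<le> b then 1 else 0 else if min i j = a then 1 else 0))"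
    unfolding lookup_wexp_owd by (intro sum.cong refl) (simp add: lookup_tv)
  also have "\<dots> = (if a < b then \<Sum>i\<in>{1..a}. int (A (i, b))
     else if b < a then \<Sum>j\<in>{1..b}. int (A (a, j))
     else (\<Sum>i\<in>{1..n}. \<Sum>j\<in>{1..n}. if min i j = a then int (A (i, j)) else 0))"
  proof -
    have 1: "(\<Sum>i\<in>{1..n}. \<Sum>j\<in>{1..n}. int (A (i, j)) * (if j = b \<and> i \<le> a then 1 else 0))
        = (\<Sum>i\<in>{1..a}. int (A (i, b)))"
    proof -
      have "(\<Sum>j\<in>{1..n}. int (A (i, j)) * (if j = b \<and> i \<le> a then 1 else 0))
          = (\<Sum>j\<in>{1..n}. if j = b then if i \<le> a then int (A (i, b)) else 0 else 0)" for i
        by (intro sum.cong) auto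
      thus ?thesis using assms restrict[OF assms(1), of "\<lambda>i. int (A (i, b))"] by simp
    qed
    have 2: "(\<Sum>i\<in>{1..n}. \<Sum>j\<in>{1..n}. int (A (i, j)) * (if i = a \<and> j \<le> b then 1 else 0))
        = (\<Sum>j\<in>{1..b}. int (A (a, j)))"
    proof -
      have "(\<Sum>j\<in>{1..n}. int (A (i, j)) * (if i = a \<and> j \<le> b then 1 else 0))
          = (if i = a then \<Sum>j\<in>{1..n}. if j \<le> b then int (A (a, j)) else 0 else 0)" for i
        by (auto intro!: sum.cong)
      thus ?thesis using assms restrict[OF assms(2), of "\<lambda>j. int (A (a, j))"] by simp
    qed
    have 3: "int (A (i, j)) * (if min i j = a then 1 else 0) = (if min i j = a then int (A (i, j)) else 0)" for i j
      by simp
    consider "a < b" | "\<not> a < b" "b < a" | "\<not> a < b" "\<not> b < a" by linarith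
    thus ?thesis by cases (simp_all only: 1 2 3 if_True if_False)
  qed
  finally show ?thesis
    using assms by (simp add: expo_def lookup_add lookup_wexp_replicate lookup_delta)
qed

text \<open>Consecutive partial sums in a column above the diagonal, or in a row below it, give the
  off-diagonal exponents. The diagonal ones are then known up to the contribution of
  \<open>Z\<close>.\<close>

lemma expo_eqD:
  assumes eq: "expo A (ell * k) = expo B (ell * l)"
  shows "a \<in> {1..n} \<Longrightarrow> b \<in> {1..n} \<Longrightarrow> a \<noteq> b \<Longrightarrow> A (a, b) = B (a, b)"
    and "a \<in> {1..n} \<Longrightarrow> int (A (a, a)) - int (ell * k) = int (B (a, a)) - int (ell * l)"
proof -
  have off: "A (a, b) = B (a, b)" if ab: "a \<in> {1..n}" "b \<in> {1..n}" "a \<noteq> b" for a b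
  proof (cases "a < b")
    case True
    have "int (A (a, b)) = int (B (a, b))"
    proof (rule sum_initial_eqD[of a "\<lambda>i. int (A (i, b))" "\<lambda>i. int (B (i, b))"])
      fix t assume t: "t \<le> a"
      show "(\<Sum>i\<in>{1..t}. int (A (i, b))) = (\<Sum>i\<in>{1..t}. int (B (i, b)))"
      proof (cases "t = 0")
        case False
        hence "t \<in> {1..n}" "t < b" using t ab True by auto
        thus ?thesis using arg_cong[OF eq, of "\<lambda>u. Poly_Mapping.lookup u (t, b)"] ab
          by (simp only: lookup_expo if_True)
      qed simp
    qed (use ab in auto)
    thus ?thesis by simp
  next
    case False
    have "int (A (a, b)) = int (B (a, b))"
    proof (rule sum_initial_eqD[of b "\<lambda>j. int (A (a, j))" "\<lambda>j. int (B (a, j))"])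
      fix t assume t: "t \<le> b"
      show "(\<Sum>j\<in>{1..t}. int (A (a, j))) = (\<Sum>j\<in>{1..t}. int (B (a, j)))"
      proof (cases "t = 0")
        case nz: False
        hence "t \<in> {1..n}" "t < a" "\<not> a < t" using t ab False by auto
        thus ?thesis using arg_cong[OF eq, of "\<lambda>u. Poly_Mapping.lookup u (a, t)"] ab
          by (simp only: lookup_expo if_True if_False)
      qed simp
    qed (use ab in auto)
    thus ?thesis by simp
  qed
  thus "a \<in> {1..n} \<Longrightarrow> b \<in> {1..n} \<Longrightarrow> a \<noteq> b \<Longrightarrow> A (a, b) = B (a, b)" .
  assume a: "a \<in> {1..n}"
  let ?s = "\<lambda>A. (\<Sum>i\<in>{1..n}. \<Sum>j\<in>{1..n}. if min i j = a then int (A (i, j)) else 0)"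
  \<comment> \<open>The diagonal coordinate a also counts off-diagonal letters with min i j = a;
    these already agree and are split off.\<close>
  have split: "?s C = (\<Sum>i\<in>{1..n}. \<Sum>j\<in>{1..n}. if min i j = a \<and> i \<noteq> j then int (C (i, j)) else 0)
      + int (C (a, a))" for C :: "nat \<times> nat \<Rightarrow> nat"
  proof -
    have "(if min i j = a then int (C (i, j)) else 0)
        = (if min i j = a \<and> i \<noteq> j then int (C (i, j)) else 0)
          + (if j = a then if i = a then int (C (a, a)) else 0 else 0)" for i j
      by (auto simp: min_def)
    thus ?thesis using a by (simp only: sum.distrib) simp
  qed
  have "(\<Sum>i\<in>{1..n}. \<Sum>j\<in>{1..n}. if min i j = a \<and> i \<noteq> j then int (A (i, j)) else 0)
      = (\<Sum>i\<in>{1..n}. \<Sum>j\<in>{1..n}. if min i j = a \<and> i \<noteq> j then int (B (i, j)) else 0)"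
    by (intro sum.cong refl) (simp add: off)
  moreover have "?s A - int (ell * k) = ?s B - int (ell * l)"
    using arg_cong[OF eq, of "\<lambda>u. Poly_Mapping.lookup u (a, a)"] a
    by (simp only: lookup_expo less_irrefl if_False)
  ultimately show "int (A (a, a)) - int (ell * k) = int (B (a, a)) - int (ell * l)"
    by (simp only: split)
qed

text \<open>Modulo ell only the restricted exponents remain, also on the diagonal, where the
  exponent of \<open>Z\<close> is a multiple of ell. Once \<open>N = N'\<close> the powers of
  \<open>Z\<close> coincide, because \<open>k\<close> depends on \<open>N\<close> alone, and
  \<open>m = m'\<close> follows.\<close>

lemma expo_inj:
  assumes N: "N \<in> expset ell n" "N' \<in> expset ell n"
    and m: "Poly_Mapping.keys m \<subseteq> {1..n} \<times> {1..n}" "Poly_Mapping.keys m' \<subseteq> {1..n} \<times> {1..n}"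
    and eq: "expo (\<lambda>p. ell * Poly_Mapping.lookup m p + N p) (ell * k N)
      = expo (\<lambda>p. ell * Poly_Mapping.lookup m' p + N' p) (ell * k N')"
  shows "N = N' \<and> m = m'"
proof -
  note off = expo_eqD(1)[OF eq] and on = expo_eqD(2)[OF eq]
  have less: "N p < ell" "N' p < ell" for p using N unfolding expset_def by blast+
  have "N (a, b) = N' (a, b)" if ab: "a \<in> {1..n}" "b \<in> {1..n}" for a b
  proof (cases "a = b")
    case False
    from off[OF ab False] have "(ell * Poly_Mapping.lookup m (a, b) + N (a, b)) mod ell
        = (ell * Poly_Mapping.lookup m' (a, b) + N' (a, b)) mod ell" by simp
    thus ?thesis using less by simp
  next
    case True
    have "int (N (a, a)) = int (N' (a, a))
        + int ell * (int (k N) + int (Poly_Mapping.lookup m' (a, a)) - int (Poly_Mapping.lookup m (a, a)) - int (k N'))"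
      using on[OF ab(1)] by (simp add: algebra_simps)
    hence "int (N (a, a)) mod int ell = int (N' (a, a)) mod int ell" by simp
    thus ?thesis using less True by simp
  qed
  moreover have "N p = N' p" if "p \<notin> {1..n} \<times> {1..n}" for p
  proof -
    have "N p = 0" "N' p = 0" using N that unfolding expset_def by blast+
    thus ?thesis by simp
  qed
  ultimately have NN: "N = N'" by (intro ext) (metis SigmaE)
  have "Poly_Mapping.lookup m p = Poly_Mapping.lookup m' p" for p
  proof (cases "p \<in> {1..n} \<times> {1..n}")
    case True
    then obtain a b where ab: "p = (a, b)" "a \<in> {1..n}" "b \<in> {1..n}" by auto
    have "ell * Poly_Mapping.lookup m (a, b) = ell * Poly_Mapping.lookup m' (a, b)"
    proof (cases "a = b")
      case True
      thus ?thesis using on[OF ab(2)] by (simp only: NN)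
    next
      case False
      thus ?thesis using off[OF ab(2,3) False] by (simp add: NN)
    qed
    thus ?thesis using ell_pos ab by simp
  next
    case False
    thus ?thesis using m by (metis in_keys_iff subsetD)
  qed
  thus ?thesis using NN by (auto intro: poly_mapping_eqI)
qed

text \<open>Applied to the point function at 0, a relation in the ideal becomes a linear relation
  between vectors with pairwise different leading points.\<close>

lemma independent:
  assumes valid: "\<forall>N\<in>expset ell n. validM n (c N)"
    and zero: "(\<Sum>N\<in>expset ell n. frobGL ell ps (c N) (k N) * omon ps N) \<in> tideal (relsGL ell n)"
    and N: "N \<in> expset ell n"
  shows "ev z (Poly_Mapping.lookup (c N) m) = 0"
proof (cases "m \<in> Poly_Mapping.keys (c N)")
  case False
  thus ?thesis by (simp add: in_keys_iff)
next
  case True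
  define A where "A = (SIGMA N:expset ell n. Poly_Mapping.keys (c N))"
  define word where "word = (\<lambda>(N, m). owd (\<lambda>p. ell * Poly_Mapping.lookup m p) @ replicate (ell * k N) Z @ owd N)"
  define coef where "coef = (\<lambda>(N, m). ev z (Poly_Mapping.lookup (c N) m))"
  define x0 :: "lat \<Rightarrow> complex" where "x0 = (\<lambda>u. if u = 0 then 1 else 0)"
  have fin: "finite A" unfolding A_def by (intro finite_SigmaI finite_expset finite_keys)
  have lead0: "lead n 0 x0" by (simp add: lead_def x0_def)
  have "(\<Sum>N\<in>expset ell n. frobGL ell ps (c N) (k N) * omon ps N)
      = (\<Sum>N\<in>expset ell n. \<Sum>m\<in>Poly_Mapping.keys (c N). sc (Poly_Mapping.lookup (c N) m) * gw (word (N, m)))"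
    unfolding frobGL_def frob_def sum_distrib_right omon_owd word_def
    by (simp add: mult.assoc gw_mult)
  also have "\<dots> = (\<Sum>x\<in>A. sc (Poly_Mapping.lookup (c (fst x)) (snd x)) * gw (word x))"
    unfolding A_def by (subst sum.Sigma) (simp_all add: finite_expset case_prod_unfold)
  finally have total: "(\<Sum>N\<in>expset ell n. frobGL ell ps (c N) (k N) * omon ps N)
      = (\<Sum>x\<in>A. sc (Poly_Mapping.lookup (c (fst x)) (snd x)) * gw (word x))" .
  have "ev z (cyclo ell) = 0" by (rule ev_cyclo[OF ell_pos root])
  from Phi_tideal[OF this zero] have Phi0: "(\<Sum>x\<in>A. scal (coef x) * wop (word x)) = 0"
    unfolding total Phi_sum Phi_word coef_def by (simp add: case_prod_unfold)
  have "coef (N, m) = 0"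
  proof (rule lead_independent[OF fin])
    fix x assume "x \<in> A"
    have "set (word x) \<subseteq> insert Z (letters n)"
      using set_owd unfolding word_def case_prod_unfold by (auto simp: in_set_replicate)
    from wop_raises[OF this] lead0 show "lead n (0 + wexp (word x)) (app (wop (word x)) x0)"
      unfolding raises_def by blast
  next
    show "inj_on (\<lambda>x. 0 + wexp (word x)) A"
    proof (rule inj_onI)
      fix x y assume xy: "x \<in> A" "y \<in> A" "0 + wexp (word x) = 0 + wexp (word y)"
      obtain M l M' l' where *: "x = (M, l)" "y = (M', l')" by fastforce
      have wexp: "wexp (word (M, l)) = expo (\<lambda>p. ell * Poly_Mapping.lookup l p + M p) (ell * k M)" for M l
        unfolding word_def expo_def
        by (rule poly_mapping_eqI)
           (simp add: wexp_append lookup_add lookup_wexp_owd distrib_right sum.distrib)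
      have "Poly_Mapping.keys l \<subseteq> {1..n} \<times> {1..n}" "Poly_Mapping.keys l' \<subseteq> {1..n} \<times> {1..n}"
        "M \<in> expset ell n" "M' \<in> expset ell n"
        using xy(1,2) valid unfolding * A_def validM_def by blast+
      from expo_inj[OF this(3,4,1,2)] xy(3) show "x = y" unfolding * wexp by simp
    qed
  next
    show "(\<Sum>x\<in>A. coef x * app (wop (word x)) x0 u) = 0" for u
      using arg_cong[OF Phi0, of "\<lambda>F. app F x0 u"] by (simp add: app_sum app_simps scal.rep_eq)
  next
    show "(N, m) \<in> A" using N True by (simp add: A_def)
  qed
  thus ?thesis by (simp add: coef_def)
qed

end

text \<open>Each primitive root of unity has its own representation; vanishing at all of them is
  divisibility by \<open>cyclo ell\<close>.\<close>

lemma independent_GL: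
  assumes "ell > 0" "distinct ps" "set ps = {1..n} \<times> {1..n}"
    and "\<forall>N\<in>expset ell n. validM n (c N)"
    and "(\<Sum>N\<in>expset ell n. frobGL ell ps (c N) (k N) * omon ps N) \<in> tideal (relsGL ell n)"
    and "N \<in> expset ell n"
  shows "zeroE ell (c N)"
  unfolding zeroE_def cyclo_dvd_iff[OF assms(1)]
proof (intro allI ballI)
  fix m z assume z: "z \<in> primroots ell"
  interpret qmatrix_rep ell n ps z
    by unfold_locales (use assms z primroots_nonzero in auto)
  show "ev z (Poly_Mapping.lookup (c N) m) = 0"
    by (rule independent[OF assms(4-6)])
qed

theorem theorem2p3:
  fixes ell n :: nat and ps :: "(nat \<times> nat) list"
  assumes "odd ell"
    and "distinct ps" and "set ps = {1..n} \<times> {1..n}"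
  shows
    "(\<forall>x. in_freeM n x \<longrightarrow>
        (\<exists>c. (\<forall>N\<in>expset ell n. validM n (c N)) \<and>
             x - (\<Sum>N\<in>expset ell n. frob ell ps (c N) * omon ps N) \<in> tideal (relsM ell n)))
   \<and> (\<forall>c. (\<forall>N\<in>expset ell n. validM n (c N)) \<longrightarrow>
        (\<Sum>N\<in>expset ell n. frob ell ps (c N) * omon ps N) \<in> tideal (relsM ell n) \<longrightarrow>
        (\<forall>N\<in>expset ell n. zeroE ell (c N)))
   \<and> (\<forall>x. in_freeGL n x \<longrightarrow>
        (\<exists>c k. (\<forall>N\<in>expset ell n. validM n (c N)) \<and>
             x - (\<Sum>N\<in>expset ell n. frobGL ell ps (c N) (k N) * omon ps N) \<in> tideal (relsGL ell n)))
   \<and> (\<forall>c k. (\<forall>N\<in>expset ell n. validM n (c N)) \<longrightarrow>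
        (\<Sum>N\<in>expset ell n. frobGL ell ps (c N) (k N) * omon ps N) \<in> tideal (relsGL ell n) \<longrightarrow>
        (\<forall>N\<in>expset ell n. zeroGL ell n (c N)))
   \<and> card (expset ell n) = ell ^ (n ^ 2)"
proof -
  have ell: "ell > 0" using assms(1) by (rule odd_pos)
  interpret qmatrix_order ell n ps by unfold_locales (use assms ell in auto)
  note GL = independent_GL[OF ell assms(2,3)]
  show ?thesis
  proof (intro conjI allI impI ballI)
    fix x assume "in_freeM n x"
    from spanned_freeM[OF this] show "\<exists>c. (\<forall>N\<in>expset ell n. validM n (c N)) \<and>
             x - (\<Sum>N\<in>expset ell n. frob ell ps (c N) * omon ps N) \<in> tideal (relsM ell n)"
      by (simp add: spanned_def icong_def)
  next
    fix c N assume c: "\<forall>N\<in>expset ell n. validM n (c N)" and N: "N \<in> expset ell n"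
      and "(\<Sum>N\<in>expset ell n. frob ell ps (c N) * omon ps N) \<in> tideal (relsM ell n)"
    \<comment> \<open>O(M_n) is treated with exponent 0 of \<open>Z\<close>, and the ideal of
      \<open>relsM\<close> lies in that of \<open>relsGL\<close>.\<close>
    hence "(\<Sum>N\<in>expset ell n. frobGL ell ps (c N) 0 * omon ps N) \<in> tideal (relsM ell n)"
      by (simp add: frobGL_def)
    hence "(\<Sum>N\<in>expset ell n. frobGL ell ps (c N) 0 * omon ps N) \<in> tideal (relsGL ell n)"
      by (rule tideal_mono[rotated]) (auto simp: relsGL_def)
    from GL[of c "\<lambda>_. 0", OF c this N] show "zeroE ell (c N)" .
  next
    fix x assume "in_freeGL n x"
    from spanning_GL[OF this] show "\<exists>c k. (\<forall>N\<in>expset ell n. validM n (c N)) \<and>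
             x - (\<Sum>N\<in>expset ell n. frobGL ell ps (c N) (k N) * omon ps N) \<in> tideal (relsGL ell n)"
      by (simp add: icong_def)
  next
    fix c k N assume "\<forall>N\<in>expset ell n. validM n (c N)" "N \<in> expset ell n"
      "(\<Sum>N\<in>expset ell n. frobGL ell ps (c N) (k N) * omon ps N) \<in> tideal (relsGL ell n)"
    hence "zeroE ell (c N)" using GL by blast
    \<comment> \<open>The numerator is already zero before localisation, so the power 0 of the
      determinant suffices.\<close>
    thus "zeroGL ell n (c N)" unfolding zeroGL_def by (intro exI[of _ 0]) simp
  next
    show "card (expset ell n) = ell ^ (n ^ 2)" by (rule card_expset[OF ell])
  qed
qed

end
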